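(* Let $n,k\geqslant1$ be integers, and let $$(V,\rho)\simeq\bigoplus_{a=0}^k\left(V_{n+2k-2a},\rho_{n+2k-2a}\right)=(V_{n+2k},\rho_{n+2k})\oplus\cdots\oplus(V_{n+2},\rho_{n+2})\oplus(V_n,\rho_n).$$ Let $\mathcal{T}=(T_1,T_2,T_3)$ be a spherically symmetric solution to Nahm's equations on a connected open interval whose generators induce the representation $(V,\rho)$. For all $m\geqslant1$ and $i\in\{1,2,3\}$, let $Y_i^m:=\rho_m(X_i)$. Then, up to a $\rho$-invariant gauge (conjugation of all $T_i$ by one constant special unitary matrix commuting with $\rho$), there exist real-valued real analytic functions $f_0,f_1,\ldots,f_k,g_0,g_1,\ldots,g_{k-1}$ on the domain of $\mathcal{T}$ such that for all $i\in\{1,2,3\}$, with respect to the decomposition $V\simeq V_{n+2k}\oplus V_{n+2(k-1)}\oplus\cdots\oplus V_{n+2}\oplus V_n$ (summands in this order), $$T_i=\begin{pmatrix} f_kY_i^{n+2k} & g_{k-1}B_i^{n+2(k-1)} & 0 & \cdots & 0\\ -g_{k-1}\left(B_i^{n+2(k-1)}\right)^* & f_{k-1}Y_i^{n+2(k-1)} & g_{k-2}B_i^{n+2(k-2)} & & \vdots\\ 0 & -g_{k-2}\left(B_i^{n+2(k-2)}\right)^* & \ddots & & 0\\ \vdots & & & \ddots & g_0B_i^n\\ 0 & \cdots & 0 & -g_0\left(B_i^n\right)^* & f_0Y_i^n \end{pmatrix},$$ that is, the diagonal block on $V_{n+2a}$ is $f_aY_i^{n+2a}$, the block from $V_{n+2a}$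 to $V_{n+2a+2}$ is $g_aB_i^{n+2a}$, the block from $V_{n+2a+2}$ to $V_{n+2a}$ is $-g_a(B_i^{n+2a})^*$, and all other blocks vanish. With the convention $g_{-1}=g_k\equiv0$, the following hold. When $n=1$, we have $(Y_1^1,Y_2^1,Y_3^1)=(0,0,0)$, so $f_0$ can be omitted, and the remaining functions satisfy $$\forall a\in\{1,\ldots,k\}:\quad \dot f_a=f_a^2+\frac1a g_{a-1}^2-\frac{2a+3}{(2a+1)(a+1)}g_a^2,$$ $$\forall a\in\{0,\ldots,k-1\}:\quad \dot g_a=\big((a+2)f_{a+1}-af_a\big)g_a.$$ When $n\geqslant2$, the functions satisfy $$\forall a\in\{0,\ldots,k\}:\quad \dot f_a=f_a^2+\frac{2}{n+2a-1}g_{a-1}^2-\frac{2(n+2a+2)}{(n+2a)(n+2a+1)}g_a^2,$$ $$\forall a\in\{0,\ldots,k-1\}:\quad \dot g_a=\left(\frac{n+2a+3}{2}f_{a+1}-\frac{n+2a-1}{2}f_a\right)g_a.$$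
   Context: Nahm's equations for a triple $\mathcal{T}=(T_1,T_2,T_3)$ of functions from an open interval to $\mathfrak{su}(N)$ (here $N=\dim V$) are $\dot T_1=[T_2,T_3]$, $\dot T_2=[T_3,T_1]$, $\dot T_3=[T_1,T_2]$. For $A\in\mathrm{SO}(3)$ and $U\in\mathrm{SU}(N)$ set ${}^AT_i:=\sum_jA_{ij}T_j$ and ${}_UT_i:=UT_iU^{-1}$. A solution is spherically symmetric if for every $A\in\mathrm{SO}(3)$ there is $U_A\in\mathrm{SU}(N)$ with ${}^A\mathcal{T}={}_{U_A^{-1}}\mathcal{T}$. A triple $(Y_1,Y_2,Y_3)\in\mathfrak{su}(N)^{\oplus3}$ is a triple of generators of the spherical symmetry for $\mathcal{T}$ if $[Y_i,T_j]=\sum_{k}\epsilon_{ijk}T_k$ for all $i,j$ at every point of the domain ($\epsilon_{ijk}$ the Levi-Civita symbol). $(X_1,X_2,X_3)$ is the standard basis of $\mathfrak{so}(3)$, $(X_i)_{jk}=-\epsilon_{ijk}$. The generators induce the representation $\rho$ of $\mathfrak{so}(3)$ if $[Y_i,Y_j]=\sum_k\epsilon_{ijk}Y_k$ for all $i,j$ and $\rho(X_i)=Y_i$. $(V_m,\rho_m)$ is the $m$-dimensional irreducible complex representation of the Lie algebra $\mathfrak{so}(3)$, with an invariant Hermitian inner product; $V\cong\mathbb{C}^N$ is the orthogonal direct sum of its summands. For $m\geqslant1$, $(B_1^m,B_2^m,B_3^m)$ is the triple of linear maps $B_i^m:V_m\to V_{m+2}$ (unique up to a $\mathrm{U}(1)$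 factor) satisfying $Y_j^{m+2}B_k^m-B_k^mY_j^m=\sum_{i=1}^3\epsilon_{ijk}B_i^m$ for all $j,k\in\{1,2,3\}$ and normalized by $\sum_{i=1}^3B_i^m(B_i^m)^*=\mathrm{Id}_{V_{m+2}}$; equivalently it spans the unique 1-dimensional irreducible summand of $V_{m+2}\otimes V_m\otimes V_3$. *)

theory Defs
  imports
    Complex_Main
    "Jordan_Normal_Form.Schur_Decomposition"
    "Jordan_Normal_Form.Determinant"
    "Jordan_Normal_Form.VS_Connect"
begin

text \<open>
  Triples indexed by 1, 2, 3 are functions on \<open>nat\<close> of which only the values at the indices
  0, 1, 2 (in this order) matter, in accordance with the 0-based indexing of matrix entries.
\<close>

definition levi_civita :: "nat \<Rightarrow> nat \<Rightarrow> nat \<Rightarrow> 'a :: ring_1" where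
  "levi_civita i j k =
     (if (i, j, k) \<in> {(0, 1, 2), (1, 2, 0), (2, 0, 1)} then 1
      else if (i, j, k) \<in> {(0, 2, 1), (2, 1, 0), (1, 0, 2)} then - 1
      else 0)"

text \<open>Matrices of varying size do not form an additive monoid, so \<open>sum\<close> is not available.\<close>

definition lincomb3 :: "(nat \<Rightarrow> complex) \<Rightarrow> (nat \<Rightarrow> complex mat) \<Rightarrow> complex mat" where
  "lincomb3 c M = c 0 \<cdot>\<^sub>m M 0 + c 1 \<cdot>\<^sub>m M 1 + c 2 \<cdot>\<^sub>m M 2"

definition commutator :: "'a :: ring_1 mat \<Rightarrow> 'a mat \<Rightarrow> 'a mat" where
  "commutator A B = A * B - B * A"

definition SO3 :: "real mat set" where
  "SO3 = {A \<in> carrier_mat 3 3. A * transpose_mat A = 1\<^sub>m 3 \<and> det A = 1}"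

definition unitary_group :: "nat \<Rightarrow> complex mat set" where
  "unitary_group N = {U \<in> carrier_mat N N. U * mat_adjoint U = 1\<^sub>m N}"

definition SU :: "nat \<Rightarrow> complex mat set" where
  "SU N = {U \<in> unitary_group N. det U = 1}"

definition su :: "nat \<Rightarrow> complex mat set" where
  "su N = {M \<in> carrier_mat N N. mat_adjoint M = - M \<and> (\<Sum>p<N. M $$ (p, p)) = 0}"

text \<open>For unitary \<open>U\<close> this is conjugation by \<open>U\<close>, since the inverse of \<open>U\<close> is its adjoint.\<close>

definition conj_by :: "complex mat \<Rightarrow> complex mat \<Rightarrow> complex mat" where
  "conj_by U M = U * M * mat_adjoint U"

definition so3 :: "real mat set" where
  "so3 = {A \<in> carrier_mat 3 3. transpose_mat A = - A}"

definition so3_basis :: "nat \<Rightarrow> real mat" where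
  "so3_basis i = mat 3 3 (\<lambda>(j, k). - levi_civita i j k)"

definition so3_rep :: "nat \<Rightarrow> (real mat \<Rightarrow> complex mat) \<Rightarrow> bool" where
  "so3_rep m \<rho> \<longleftrightarrow>
     (\<forall>A\<in>so3. \<rho> A \<in> carrier_mat m m) \<and>
     (\<forall>A\<in>so3. \<forall>A'\<in>so3. \<rho> (A + A') = \<rho> A + \<rho> A') \<and>
     (\<forall>c. \<forall>A\<in>so3. \<rho> (c \<cdot>\<^sub>m A) = complex_of_real c \<cdot>\<^sub>m \<rho> A) \<and>
     (\<forall>A\<in>so3. \<forall>A'\<in>so3. \<rho> (commutator A A') = commutator (\<rho> A) (\<rho> A'))"

definition irreducible_so3_rep :: "nat \<Rightarrow> (real mat \<Rightarrow> complex mat) \<Rightarrow> bool" where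
  "irreducible_so3_rep m \<rho> \<longleftrightarrow>
     so3_rep m \<rho> \<and> m \<ge> 1 \<and>
     (\<forall>W. VectorSpace.subspace class_ring W (module_vec TYPE(complex) m) \<longrightarrow>
          (\<forall>A\<in>so3. \<forall>w\<in>W. \<rho> A *\<^sub>v w \<in> W) \<longrightarrow>
          W = {0\<^sub>v m} \<or> W = carrier_vec m)"

text \<open>
  Invariance of the standard Hermitian inner product; every invariant inner product takes this
  form in an orthonormal basis.
\<close>

definition unitary_so3_rep :: "nat \<Rightarrow> (real mat \<Rightarrow> complex mat) \<Rightarrow> bool" where
  "unitary_so3_rep m \<rho> \<longleftrightarrow> so3_rep m \<rho> \<and> (\<forall>A\<in>so3. mat_adjoint (\<rho> A) = - \<rho> A)"

text \<open>
  The orthogonal direct sum of \<open>V\<^bsub>n+2k\<^esub>, \<dots>, V\<^bsub>n+2\<^esub>, V\<^bsub>n\<^esub>\<close>, in this order.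
\<close>

definition ladder_rep ::
  "(nat \<Rightarrow> real mat \<Rightarrow> complex mat) \<Rightarrow> nat \<Rightarrow> nat \<Rightarrow> real mat \<Rightarrow> complex mat" where
  "ladder_rep \<phi> n k A = diag_block_mat (map (\<lambda>a. \<phi> (n + 2 * (k - a)) A) [0..<Suc k])"

text \<open>
  \<open>ladder_block n k a b M\<close> is the block of \<open>M\<close> that maps the summand \<open>V\<^bsub>n+2b\<^esub>\<close> to the summand
  \<open>V\<^bsub>n+2a\<^esub>\<close>. Since the largest summand comes first, the coordinates of \<open>V\<^bsub>n+2a\<^esub>\<close> are preceded by
  those of \<open>V\<^bsub>n+2c\<^esub>\<close> for \<open>a < c \<le> k\<close>.
\<close>

definition ladder_offset :: "nat \<Rightarrow> nat \<Rightarrow> nat \<Rightarrow> nat" where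
  "ladder_offset n k a = (\<Sum>c\<in>{a<..k}. n + 2 * c)"

definition ladder_block :: "nat \<Rightarrow> nat \<Rightarrow> nat \<Rightarrow> nat \<Rightarrow> complex mat \<Rightarrow> complex mat" where
  "ladder_block n k a b M =
     mat (n + 2 * a) (n + 2 * b)
       (\<lambda>(p, q). M $$ (ladder_offset n k a + p, ladder_offset n k b + q))"

definition normalized_B_triple ::
  "(nat \<Rightarrow> real mat \<Rightarrow> complex mat) \<Rightarrow> nat \<Rightarrow> (nat \<Rightarrow> complex mat) \<Rightarrow> bool" where
  "normalized_B_triple \<phi> m B \<longleftrightarrow>
     (\<forall>i<3. B i \<in> carrier_mat (m + 2) m) \<and>
     (\<forall>j<3. \<forall>k<3. \<phi> (m + 2) (so3_basis j) * B k - B k * \<phi> m (so3_basis j)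
                    = lincomb3 (\<lambda>i. levi_civita i j k) B) \<and>
     lincomb3 (\<lambda>_. 1) (\<lambda>i. B i * mat_adjoint (B i)) = 1\<^sub>m (m + 2)"

definition has_mat_derivative ::
  "(real \<Rightarrow> complex mat) \<Rightarrow> complex mat \<Rightarrow> real \<Rightarrow> bool" where
  "has_mat_derivative M D t \<longleftrightarrow>
     (\<forall>p<dim_row D. \<forall>q<dim_col D.
        ((\<lambda>s. M s $$ (p, q)) has_vector_derivative D $$ (p, q)) (at t))"

definition nahm_solution :: "nat \<Rightarrow> real set \<Rightarrow> (nat \<Rightarrow> real \<Rightarrow> complex mat) \<Rightarrow> bool" where
  "nahm_solution N J T \<longleftrightarrow>
     (\<forall>t\<in>J. (\<forall>i<3. T i t \<in> su N) \<and>
        has_mat_derivative (T 0) (commutator (T 1 t) (T 2 t)) t \<and>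
        has_mat_derivative (T 1) (commutator (T 2 t) (T 0 t)) t \<and>
        has_mat_derivative (T 2) (commutator (T 0 t) (T 1 t)) t)"

definition spherically_symmetric ::
  "nat \<Rightarrow> real set \<Rightarrow> (nat \<Rightarrow> real \<Rightarrow> complex mat) \<Rightarrow> bool" where
  "spherically_symmetric N J T \<longleftrightarrow>
     (\<forall>A\<in>SO3. \<exists>U\<in>SU N. \<forall>i<3. \<forall>t\<in>J.
        lincomb3 (\<lambda>j. complex_of_real (A $$ (i, j))) (\<lambda>j. T j t)
          = conj_by (mat_adjoint U) (T i t))"

definition symmetry_generators ::
  "nat \<Rightarrow> real set \<Rightarrow> (nat \<Rightarrow> real \<Rightarrow> complex mat) \<Rightarrow> (nat \<Rightarrow> complex mat) \<Rightarrow> bool" where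
  "symmetry_generators N J T Y \<longleftrightarrow>
     (\<forall>i<3. Y i \<in> su N) \<and>
     (\<forall>i<3. \<forall>j<3. \<forall>t\<in>J.
        commutator (Y i) (T j t) = lincomb3 (levi_civita i j) (\<lambda>k. T k t))"

definition generators_induce_rep ::
  "nat \<Rightarrow> (nat \<Rightarrow> complex mat) \<Rightarrow> (real mat \<Rightarrow> complex mat) \<Rightarrow> bool" where
  "generators_induce_rep N Y \<rho> \<longleftrightarrow>
     so3_rep N \<rho> \<and>
     (\<forall>i<3. \<forall>j<3. commutator (Y i) (Y j) = lincomb3 (levi_civita i j) Y) \<and>
     (\<forall>i<3. \<rho> (so3_basis i) = Y i)"

definition real_analytic_on :: "(real \<Rightarrow> real) \<Rightarrow> real set \<Rightarrow> bool" where
  "real_analytic_on f J \<longleftrightarrow>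
     (\<forall>x\<in>J. \<exists>r>0. \<exists>c. \<forall>y. \<bar>y - x\<bar> < r \<longrightarrow> (\<lambda>m. c m * (y - x) ^ m) sums f y)"

text \<open>Index shift by one with the convention that the function with index \<open>-1\<close> vanishes.\<close>

fun shifted :: "(nat \<Rightarrow> real \<Rightarrow> real) \<Rightarrow> nat \<Rightarrow> real \<Rightarrow> real" where
  "shifted g 0 t = 0"
| "shifted g (Suc a) t = g a t"

end

theory Submission
  imports Defs "Jordan_Normal_Form.Spectral_Radius"
begin

text \<open>
  Each block of the conjugated triple from \<open>V\<^bsub>q\<^esub>\<close> to \<open>V\<^bsub>p\<^esub>\<close> is a triple \<open>x\<close> with
  \<open>[y\<^sub>i, x\<^sub>j] = \<Sum>\<^sub>k \<epsilon>\<^sub>i\<^sub>j\<^sub>k x\<^sub>k\<close>. The Casimir elements of both sides make \<open>x\<close> an eigenvector of the curl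
  operators \<open>y \<times> x\<close> and \<open>x \<times> z\<close>, and the gradient of the divergence \<open>\<Sum> y\<^sub>i x\<^sub>i\<close> is a multiple of \<open>x\<close>.
  This multiple is nonzero and the divergence vanishes unless \<open>|p - q|\<close> is 0 or 2; for \<open>p = q\<close> the
  divergence is a scalar by Schur's lemma, so \<open>x\<close> is a multiple of \<open>y\<close>; for \<open>q = p + 2\<close> the triple is
  determined by its value on a highest weight vector. The same identities give the constants in
  \<open>B \<times> B\<^sup>*\<close> and \<open>B\<^sup>* \<times> B\<close>, hence the equations for the coefficients. The coefficients of the
  off-diagonal blocks satisfy linear equations with real factor, so their phases are constant and can
  be removed by a block scalar gauge. Finally, solutions of a quadratic system of equations are real
  analytic because the normalized derivatives \<open>x\<^sup>(\<^sup>m\<^sup>) / m!\<close> satisfy a convolution recursion, which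
  bounds them by \<open>A K\<^sup>m\<close>.
\<close>

section \<open>Operators on sequences as a common home for matrices\<close>

text \<open>The gradient-divergence eigenvalue for triples from \<open>V_q\<close> to
  \<open>V_p\<close> is \<open>((p - q)^2 - 4) ((p + q)^2 - 4) / 64\<close>; this is the origin of
  the condition on \<open>|p - q|\<close>. Uniqueness is obtained only for triples from a larger to
  a smaller summand, where a top weight vector has a weight above all those of the target, so that
  almost nothing of its image survives. The opposite blocks are reached through skew-adjointness.
  The trivial summand is exceptional throughout: its Casimir value is zero and its generators
  vanish, so the diagonal coefficient is not determined there and is set to zero. Reality of the
  diagonal coefficients comes from the skew-adjointness of triple and generators, and makes the
  factor in the linear equations real. The equations for the diagonal contain the off-diagonal
  coefficients only through their squared moduli, so removing the phases does not disturb them. The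
  constants come from the Casimir value \<open>-(m^2 - 1) / 4\<close>, the curl eigenvalues and the
  normalization of \<open>B\<close>, which a comparison of traces carries over to the products in
  the opposite order.\<close>

text \<open>
  Matrices of varying size do not form a ring. Extended by zero they all act on the sequences,
  and the linear endomorphisms of the space of sequences form a ring, so that identities between
  rectangular matrices become computations in a single noncommutative ring.
\<close>

typedef op = "{f :: (nat \<Rightarrow> complex) \<Rightarrow> nat \<Rightarrow> complex.
    (\<forall>x y. f (\<lambda>i. x i + y i) = (\<lambda>i. f x i + f y i)) \<and> (\<forall>c x. f (\<lambda>i. c * x i) = (\<lambda>i. c * f x i))}"
  morphisms app Abs_op
  by (rule exI[of _ "\<lambda>x. x"]) simp

setup_lifting type_definition_op

instantiation op :: ring_1
begin
lift_definition zero_op :: op is "\<lambda>x i. 0" by simp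
lift_definition one_op :: op is "\<lambda>x. x" by simp
lift_definition plus_op :: "op \<Rightarrow> op \<Rightarrow> op" is "\<lambda>f g x i. f x i + g x i"
  by (auto simp: fun_eq_iff algebra_simps)
lift_definition uminus_op :: "op \<Rightarrow> op" is "\<lambda>f x i. - f x i"
  by (auto simp: fun_eq_iff algebra_simps)
lift_definition minus_op :: "op \<Rightarrow> op \<Rightarrow> op" is "\<lambda>f g x i. f x i - g x i"
  by (auto simp: fun_eq_iff algebra_simps)
lift_definition times_op :: "op \<Rightarrow> op \<Rightarrow> op" is "\<lambda>f g x. f (g x)"
  by auto
instance
proof
  show "(0::op) \<noteq> 1"
    by transfer (metis one_neq_zero)
qed (transfer; auto simp: fun_eq_iff algebra_simps)+
end

lift_definition scale :: "complex \<Rightarrow> op \<Rightarrow> op" (infixr "\<star>" 75) is "\<lambda>c f x i. c * f x i"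
  by (auto simp: fun_eq_iff algebra_simps)

lemma scale_simps [simp]:
  "(c \<star> f) * g = c \<star> (f * g)" "f * (c \<star> g) = c \<star> (f * g)"
  "c \<star> d \<star> f = (c * d) \<star> f" "0 \<star> f = 0" "1 \<star> f = f" "c \<star> 0 = 0"
  by (transfer; simp add: fun_eq_iff)+

lemma scale_add: "c \<star> (f + g) = c \<star> f + c \<star> g" "c \<star> (f - g) = c \<star> f - c \<star> g"
   "c \<star> (- f) = - (c \<star> f)" "(c + d) \<star> f = c \<star> f + d \<star> f" "(c - d) \<star> f = c \<star> f - d \<star> f"
   "(- c) \<star> f = - (c \<star> f)"
  by (transfer; simp add: fun_eq_iff algebra_simps)+

lemma two_eq_scale: "f + f = 2 \<star> (f::op)"
  using scale_add(4)[of 1 1 f] by simp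

lemma scale_cancel: "c \<star> f = 0 \<Longrightarrow> c \<noteq> 0 \<Longrightarrow> f = 0"
proof -
  assume a: "c \<star> f = 0" "c \<noteq> 0"
  have "f = (1 / c) \<star> c \<star> f" using a(2) by (simp del: a(1))
  thus ?thesis using a by simp
qed

subsection \<open>Relations of angular momentum type\<close>

definition so3_relations :: "(nat \<Rightarrow> op) \<Rightarrow> bool" where
  "so3_relations y \<longleftrightarrow> y 0 * y 1 - y 1 * y 0 = y 2 \<and> y 1 * y 2 - y 2 * y 1 = y 0 \<and> y 2 * y 0 - y 0 * y 2 = y 1"

text \<open>The nine relations are solved for the products \<open>y i * x j\<close>: as rewrite
  rules they move every \<open>y\<close> to the right through \<open>x\<close>, where it turns into
  \<open>z\<close>. Many identities below then follow by expansion to a normal form.\<close>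

definition intertwines :: "(nat \<Rightarrow> op) \<Rightarrow> (nat \<Rightarrow> op) \<Rightarrow> (nat \<Rightarrow> op) \<Rightarrow> bool" where
  "intertwines y z x \<longleftrightarrow>
     y 0 * x 0 = x 0 * z 0 \<and> y 1 * x 1 = x 1 * z 1 \<and> y 2 * x 2 = x 2 * z 2 \<and>
     y 0 * x 1 = x 1 * z 0 + x 2 \<and> y 0 * x 2 = x 2 * z 0 - x 1 \<and>
     y 1 * x 0 = x 0 * z 1 - x 2 \<and> y 1 * x 2 = x 2 * z 1 + x 0 \<and>
     y 2 * x 0 = x 0 * z 2 + x 1 \<and> y 2 * x 1 = x 1 * z 2 - x 0"

text \<open>Makes a rule for a product applicable inside a right-associated product, the form that
  \<open>mult.assoc\<close> produces.\<close>

lemma mult_left: "a * b = c \<Longrightarrow> a * (b * d) = c * (d::op)"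
  by (simp add: mult.assoc[symmetric])

lemma yx_rules:
  assumes "intertwines y z x"
  shows
     "y 0 * x 0 = x 0 * z 0" "y 1 * x 1 = x 1 * z 1" "y 2 * x 2 = x 2 * z 2"
     "y 0 * x 1 = x 1 * z 0 + x 2" "y 0 * x 2 = x 2 * z 0 - x 1"
     "y 1 * x 0 = x 0 * z 1 - x 2" "y 1 * x 2 = x 2 * z 1 + x 0"
     "y 2 * x 0 = x 0 * z 2 + x 1" "y 2 * x 1 = x 1 * z 2 - x 0"
  using assms unfolding intertwines_def by blast+

context
  fixes y z x :: "nat \<Rightarrow> op" and cy cz :: complex
  assumes yx: "intertwines y z x"
    and Cy: "\<And>i. i < 3 \<Longrightarrow> (y 0 * y 0 + y 1 * y 1 + y 2 * y 2) * x i = cy \<star> x i"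
    and Cz: "\<And>i. i < 3 \<Longrightarrow> x i * (z 0 * z 0 + z 1 * z 1 + z 2 * z 2) = cz \<star> x i"
begin

lemmas yx_rules' = yx_rules[OF yx] yx_rules[OF yx, THEN mult_left]

text \<open>
  The Casimir element acts on the triple \<open>x\<close> from the left and from the right; comparing the two
  actions, the second commutators leave exactly the curl.
\<close>

lemma right_curl:
  fixes r defines "r \<equiv> 1 + (cy - cz) / 2"
  shows "x 1 * z 2 - x 2 * z 1 = r \<star> x 0" "x 2 * z 0 - x 0 * z 2 = r \<star> x 1" "x 0 * z 1 - x 1 * z 0 = r \<star> x 2"
proof -
  \<comment> \<open>Moving both factors of each \<open>y i * y i\<close> through \<open>x\<close>
    gives twice the curl from the terms with one \<open>z\<close>, and \<open>- 2 \<star> x\<close>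
    from those without, since \<Sum> \<epsilon>_ijk \<epsilon>_ikl over i and k is -2 for j = l.
    Solving for the curl gives this form.\<close>
  have a: "u = r \<star> w" if a: "2 \<star> u = cy \<star> w - cz \<star> w + 2 \<star> w" for u w
  proof -
    have "(1/2) \<star> 2 \<star> u = (1/2) \<star> (cy \<star> w - cz \<star> w + 2 \<star> w)" using a by simp
    thus ?thesis unfolding r_def by (simp add: scale_add diff_divide_distrib)
  qed
  show "x 1 * z 2 - x 2 * z 1 = r \<star> x 0"
    by (rule a, use Cy[of 0] Cz[of 0] in \<open>simp add: algebra_simps yx_rules' two_eq_scale[symmetric] del: One_nat_def\<close>)
  show "x 2 * z 0 - x 0 * z 2 = r \<star> x 1"
    by (rule a, use Cy[of 1] Cz[of 1] in \<open>simp add: algebra_simps yx_rules' two_eq_scale[symmetric] del: One_nat_def\<close>)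
  show "x 0 * z 1 - x 1 * z 0 = r \<star> x 2"
    by (rule a, use Cy[of 2] Cz[of 2] in \<open>simp add: algebra_simps yx_rules' two_eq_scale[symmetric] del: One_nat_def\<close>)
qed

text \<open>Moving \<open>y\<close> through \<open>x\<close> turns the left curl into
  \<open>2 \<star> x\<close> minus the right curl, so the two eigenvalues add up to 2.\<close>

lemma left_curl:
  fixes l defines "l \<equiv> 1 + (cz - cy) / 2"
  shows "y 1 * x 2 - y 2 * x 1 = l \<star> x 0" "y 2 * x 0 - y 0 * x 2 = l \<star> x 1" "y 0 * x 1 - y 1 * x 0 = l \<star> x 2"
proof -
  have l: "l = 2 - (1 + (cy - cz) / 2)" by (simp add: l_def field_simps)
  show "y 1 * x 2 - y 2 * x 1 = l \<star> x 0" "y 2 * x 0 - y 0 * x 2 = l \<star> x 1" "y 0 * x 1 - y 1 * x 0 = l \<star> x 2"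
    unfolding l scale_add(5) right_curl[symmetric] two_eq_scale[symmetric]
    by (simp_all add: yx_rules' algebra_simps del: One_nat_def)
qed

text \<open>The identity grad div = Laplacian + curl curl of vector calculus, for noncommuting
  \<open>y\<close>: the Laplacian is the Casimir value \<open>cy\<close>, curl curl gives
  \<open>l * l\<close>, and the commutators of the \<open>y i\<close> contribute one further curl
  with negative sign.\<close>

lemma left_grad_div:
  fixes l defines "l \<equiv> 1 + (cz - cy) / 2"
  assumes y: "so3_relations y" and i: "i < 3"
  shows "y i * (y 0 * x 0 + y 1 * x 1 + y 2 * x 2) = (cy + l * l - l) \<star> x i"
proof -
  have c: "y 0 * y 1 = y 1 * y 0 + y 2" "y 1 * y 2 = y 2 * y 1 + y 0" "y 2 * y 0 = y 0 * y 2 + y 1"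
    using y unfolding so3_relations_def by (auto simp: algebra_simps)
  have l: "y 1 * x 2 = y 2 * x 1 + l \<star> x 0" "y 2 * x 0 = y 0 * x 2 + l \<star> x 1" "y 0 * x 1 = y 1 * x 0 + l \<star> x 2"
    using left_curl unfolding l_def by (auto simp: diff_eq_eq add.commute simp del: One_nat_def)
  have C: "y 0 * (y 0 * x i) + y 1 * (y 1 * x i) + y 2 * (y 2 * x i) = cy \<star> x i"
    using Cy[OF i] by (simp add: algebra_simps)
  \<comment> \<open>Exchanging \<open>y 0\<close> with \<open>y 1\<close> and \<open>y 2\<close>
    leaves \<open>y 2 * x 1 - y 1 * x 2\<close>, which is \<open>- l \<star> x 0\<close>; replacing
    \<open>y 0 * x j\<close> by the curl equations then produces \<open>l\<close> times a curl,
    hence \<open>l * l\<close>. The other two identities are the cyclic images.\<close>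
  have h0: "y 0 * (y 0 * x 0) + y 0 * (y 1 * x 1) + y 0 * (y 2 * x 2) =
       y 0 * (y 0 * x 0) + y 1 * (y 1 * x 0) + y 2 * (y 2 * x 0) + (l * l - l) \<star> x 0"
  proof -
    have 1: "y 0 * (y 1 * x 1) = y 1 * (y 0 * x 1) + y 2 * x 1"
      using c(1)[THEN mult_left, of "x 1"] by (simp add: algebra_simps)
    have 2: "y 0 * (y 2 * x 2) = y 2 * (y 0 * x 2) - y 1 * x 2"
      using c(3)[THEN mult_left, of "x 2"] by (simp add: algebra_simps)
    have 3: "y 0 * x 2 = y 2 * x 0 - l \<star> x 1" using l(2) by simp
    show ?thesis unfolding 1 2 3 l(3) by (simp add: algebra_simps l(1) scale_add del: One_nat_def)
  qed
  have h1: "y 1 * (y 0 * x 0) + y 1 * (y 1 * x 1) + y 1 * (y 2 * x 2) =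
       y 0 * (y 0 * x 1) + y 1 * (y 1 * x 1) + y 2 * (y 2 * x 1) + (l * l - l) \<star> x 1"
  proof -
    have 1: "y 1 * (y 2 * x 2) = y 2 * (y 1 * x 2) + y 0 * x 2"
      using c(2)[THEN mult_left, of "x 2"] by (simp add: algebra_simps)
    have 2: "y 1 * (y 0 * x 0) = y 0 * (y 1 * x 0) - y 2 * x 0"
      using c(1)[THEN mult_left, of "x 0"] by (simp add: algebra_simps)
    have 3: "y 1 * x 0 = y 0 * x 1 - l \<star> x 2" using l(3) by simp
    show ?thesis unfolding 1 2 3 l(1) by (simp add: algebra_simps l(2) scale_add del: One_nat_def)
  qed
  have h2: "y 2 * (y 0 * x 0) + y 2 * (y 1 * x 1) + y 2 * (y 2 * x 2) =
       y 0 * (y 0 * x 2) + y 1 * (y 1 * x 2) + y 2 * (y 2 * x 2) + (l * l - l) \<star> x 2"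
  proof -
    have 1: "y 2 * (y 0 * x 0) = y 0 * (y 2 * x 0) + y 1 * x 0"
      using c(3)[THEN mult_left, of "x 0"] by (simp add: algebra_simps)
    have 2: "y 2 * (y 1 * x 1) = y 1 * (y 2 * x 1) - y 0 * x 1"
      using c(2)[THEN mult_left, of "x 1"] by (simp add: algebra_simps)
    have 3: "y 2 * x 1 = y 1 * x 2 - l \<star> x 0" using l(1) by simp
    show ?thesis unfolding 1 2 3 l(2) by (simp add: algebra_simps l(3) scale_add del: One_nat_def)
  qed
  have "(cy + l * l - l) \<star> x i = cy \<star> x i + (l * l - l) \<star> x i"
    by (simp add: scale_add)
  moreover have "i = 0 \<or> i = 1 \<or> i = 2" using i by auto
  ultimately show ?thesis
    unfolding C[symmetric] by (elim disjE) (simp_all only: distrib_left h0 h1 h2)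
qed

end

text \<open>The contraction of two vector operators is invariant under rotations.\<close>

lemma div_intertwines:
  assumes "so3_relations y" "so3_relations z" "intertwines y z x" "i < 3"
  shows "y i * (y 0 * x 0 + y 1 * x 1 + y 2 * x 2) = (y 0 * x 0 + y 1 * x 1 + y 2 * x 2) * z i"
proof -
  have c: "y 0 * y 1 = y 1 * y 0 + y 2" "y 1 * y 2 = y 2 * y 1 + y 0" "y 2 * y 0 = y 0 * y 2 + y 1"
    using assms unfolding so3_relations_def by (auto simp: algebra_simps)
  have d: "z 0 * z 1 = z 1 * z 0 + z 2" "z 1 * z 2 = z 2 * z 1 + z 0" "z 2 * z 0 = z 0 * z 2 + z 1"
    using assms unfolding so3_relations_def by (auto simp: algebra_simps)
  note yx = yx_rules[OF assms(3)]
  have "i = 0 \<or> i = 1 \<or> i = 2" using assms by auto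
  thus ?thesis
    by (auto simp: algebra_simps yx yx[THEN mult_left] d d[THEN mult_left] simp del: One_nat_def)
qed

text \<open>The order of the factors is kept, so that \<open>cross\<close> of a triple with itself
  is the right-hand side of Nahm's equations, and a block of it is a sum of \<open>cross\<close>
  products of blocks.\<close>

definition cross :: "(nat \<Rightarrow> op) \<Rightarrow> (nat \<Rightarrow> op) \<Rightarrow> nat \<Rightarrow> op" where
  "cross b b' i = (if i = 0 then b 1 * b' 2 - b 2 * b' 1
     else if i = 1 then b 2 * b' 0 - b 0 * b' 2 else b 0 * b' 1 - b 1 * b' 0)"

lemma cross_intertwines:
  assumes "intertwines y z b" "intertwines z w b'"
  shows "intertwines y w (cross b b')"
proof -
  note yx = yx_rules[OF assms(1)] yx_rules[OF assms(2)]
  show ?thesis unfolding intertwines_def cross_def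
    by (simp add: algebra_simps yx yx[THEN mult_left] del: One_nat_def)
qed

lemma dot_intertwines:
  assumes "intertwines y z b" "intertwines z w b'" "i < 3"
  shows "y i * (b 0 * b' 0 + b 1 * b' 1 + b 2 * b' 2) = (b 0 * b' 0 + b 1 * b' 1 + b 2 * b' 2) * w i"
proof -
  note yx = yx_rules[OF assms(1)] yx_rules[OF assms(2)]
  have "i = 0 \<or> i = 1 \<or> i = 2" using assms by auto
  thus ?thesis
    by (auto simp: algebra_simps yx yx[THEN mult_left] simp del: One_nat_def)
qed

text \<open>The scalar triple product: \<open>y\<close> dotted with \<open>b\<close> cross
  \<open>b'\<close> is \<open>y\<close> cross \<open>b\<close> dotted with \<open>b'\<close>. This
  form survives noncommutativity because no factors change their order, and here the inner curl is
  known.\<close>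

lemma div_cross:
  assumes "y 1 * b 2 - y 2 * b 1 = l \<star> b 0" "y 2 * b 0 - y 0 * b 2 = l \<star> b 1" "y 0 * b 1 - y 1 * b 0 = l \<star> b 2"
  shows "y 0 * cross b b' 0 + y 1 * cross b b' 1 + y 2 * cross b b' 2 =
    l \<star> (b 0 * b' 0 + b 1 * b' 1 + b 2 * b' 2)"
proof -
  have "l \<star> (b 0 * b' 0 + b 1 * b' 1 + b 2 * b' 2) = (l \<star> b 0) * b' 0 + (l \<star> b 1) * b' 1 + (l \<star> b 2) * b' 2"
    by (simp add: scale_add)
  thus ?thesis
    unfolding assms[symmetric] cross_def by (simp add: algebra_simps del: One_nat_def)
qed

section \<open>Matrices as operators, and their adjoints\<close>

lift_definition Op :: "complex mat \<Rightarrow> op" is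
  "\<lambda>A x i. if i < dim_row A then \<Sum>j<dim_col A. A $$ (i, j) * x j else 0"
  by (auto simp: fun_eq_iff algebra_simps sum.distrib sum_distrib_left)

lemma Op_add: "dim_row A = dim_row B \<Longrightarrow> dim_col A = dim_col B \<Longrightarrow> Op (A + B) = Op A + Op B"
  by transfer (auto simp: fun_eq_iff algebra_simps sum.distrib)

lemma Op_diff: "dim_row A = dim_row B \<Longrightarrow> dim_col A = dim_col B \<Longrightarrow> Op (A - B) = Op A - Op B"
  by transfer (auto simp: fun_eq_iff algebra_simps sum_subtractf)

lemma Op_uminus: "Op (- A) = - Op A"
  by transfer (auto simp: fun_eq_iff sum_negf)

lemma Op_smult: "Op (c \<cdot>\<^sub>m A) = c \<star> Op A"
  by transfer (auto simp: fun_eq_iff sum_distrib_left mult.assoc)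

lemma Op_zero: "Op (0\<^sub>m r c) = 0"
  by transfer (auto simp: fun_eq_iff)

lemma Op_mult: "dim_col A = dim_row B \<Longrightarrow> Op (A * B) = Op A * Op B"
proof (transfer, intro ext, goal_cases)
  case (1 A B x i)
  have "(\<Sum>j<dim_col B. (\<Sum>l<dim_row B. A $$ (i, l) * B $$ (l, j)) * x j)
      = (\<Sum>l<dim_row B. A $$ (i, l) * (\<Sum>j<dim_col B. B $$ (l, j) * x j))"
    by (simp add: sum_distrib_left sum_distrib_right mult.assoc) (rule sum.swap)
  with 1 show ?case
    by (auto simp: scalar_prod_def lessThan_atLeast0)
qed

lemma Op_inj:
  assumes "A \<in> carrier_mat r c" "B \<in> carrier_mat r c" "Op A = Op B"
  shows "A = B"
proof (rule eq_matI)
  fix i j assume ij: "i < dim_row B" "j < dim_col B"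
  have "app (Op A) (\<lambda>l. if l = j then 1 else 0) i = app (Op B) (\<lambda>l. if l = j then 1 else 0) i"
    using assms by simp
  thus "A $$ (i, j) = B $$ (i, j)"
    using assms(1,2) ij by (simp add: Op.rep_eq if_distrib[of "\<lambda>z. _ * z"] cong: if_cong)
qed (use assms in auto)

lemma Op_eqI: "dim_row A = dim_row B \<Longrightarrow> dim_col A = dim_col B \<Longrightarrow> Op A = Op B \<Longrightarrow> A = B"
  by (rule Op_inj[OF carrier_matI carrier_matI]) auto

text \<open>In the ring, \<open>Op (1\<^sub>m m)\<close> is the projection to the first
  \<open>m\<close> coordinates and not the unit, so it has to be absorbed explicitly.\<close>

lemma Op_one_left: "dim_row A = m \<Longrightarrow> Op (1\<^sub>m m) * Op A = Op A"
  by (subst Op_mult[symmetric]) auto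

lemma Op_one_right: "dim_col A = m \<Longrightarrow> Op A * Op (1\<^sub>m m) = Op A"
  by (subst Op_mult[symmetric]) auto

lemma Op_eq_0: "A \<in> carrier_mat r c \<Longrightarrow> Op A = 0 \<Longrightarrow> A = 0\<^sub>m r c"
  by (rule Op_inj[of _ r c]) (auto simp: Op_zero)

lemma dim_mat_adjoint [simp]:
  "dim_row (mat_adjoint A) = dim_col A" "dim_col (mat_adjoint A) = dim_row A"
  by (auto simp: mat_adjoint_def)

lemma mat_adjoint_index [simp]:
  "i < dim_col A \<Longrightarrow> j < dim_row A \<Longrightarrow> mat_adjoint A $$ (i, j) = cnj (A $$ (j, i :: nat))"
  by (simp add: mat_adjoint_def mat_of_rows_def)

lemma mat_adjoint_carrier [simp]: "A \<in> carrier_mat r c \<Longrightarrow> mat_adjoint A \<in> carrier_mat c (r :: nat)"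
  by (rule carrier_matI) auto

lemma mat_adjoint_adjoint [simp]: "mat_adjoint (mat_adjoint A) = (A :: complex mat)"
  by (rule eq_matI) auto

lemma mat_adjoint_mult:
  "dim_col A = dim_row B \<Longrightarrow> mat_adjoint (A * B) = mat_adjoint B * mat_adjoint (A :: complex mat)"
  by (rule eq_matI) (simp_all add: scalar_prod_def mult.commute)

lemma mat_adjoint_add:
  "dim_row A = dim_row B \<Longrightarrow> dim_col A = dim_col B \<Longrightarrow> mat_adjoint (A + B) = mat_adjoint A + mat_adjoint (B :: complex mat)"
  by (rule eq_matI) auto

lemma mat_adjoint_diff:
  "dim_row A = dim_row B \<Longrightarrow> dim_col A = dim_col B \<Longrightarrow> mat_adjoint (A - B) = mat_adjoint A - mat_adjoint (B :: complex mat)"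
  by (rule eq_matI) auto

lemma mat_adjoint_smult: "mat_adjoint (c \<cdot>\<^sub>m A) = cnj c \<cdot>\<^sub>m mat_adjoint (A :: complex mat)"
  by (rule eq_matI) auto

lemma mat_adjoint_one: "mat_adjoint (1\<^sub>m m) = (1\<^sub>m m :: complex mat)"
  by (rule eq_matI) auto

lemma mat_adjoint_zero: "mat_adjoint (0\<^sub>m r c) = (0\<^sub>m c r :: complex mat)"
  by (rule eq_matI) auto

section \<open>Irreducible triples of matrices and Schur's lemma\<close>

lemma mat_eq_zero_if_mult_vec_zero:
  fixes K :: "'a :: comm_ring_1 mat"
  assumes K: "K \<in> carrier_mat r m" and z: "\<And>v. v \<in> carrier_vec m \<Longrightarrow> K *\<^sub>v v = 0\<^sub>v r"
  shows "K = 0\<^sub>m r m"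
proof (rule eq_matI)
  fix i j assume ij: "i < dim_row (0\<^sub>m r m :: 'a mat)" "j < dim_col (0\<^sub>m r m :: 'a mat)"
    have "K $$ (i, j) = (K *\<^sub>v unit_vec m j) $ i" using K ij by simp
    also have "\<dots> = 0" using z[of "unit_vec m j"] ij by simp
    finally show "K $$ (i, j) = 0\<^sub>m r m $$ (i, j)" using ij by simp
qed (use K in auto)

text \<open>Irreducibility is given by elementary closure properties together with a nonzero witness
  \<open>x\<close>, the form in which it is applied to joint kernels and to the range of a
  matrix.\<close>

locale irrep =
  fixes m :: nat and Y :: "nat \<Rightarrow> complex mat"
  assumes pos: "m \<ge> 1"
    and carrier: "\<And>i. i < 3 \<Longrightarrow> Y i \<in> carrier_mat m m"
    and relations: "so3_relations (\<lambda>i. Op (Y i))"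
    and adjoint: "\<And>i. i < 3 \<Longrightarrow> mat_adjoint (Y i) = - Y i"
    and irreducible: "\<And>V x. V \<subseteq> carrier_vec m \<Longrightarrow> (\<And>v w. v \<in> V \<Longrightarrow> w \<in> V \<Longrightarrow> v + w \<in> V) \<Longrightarrow>
      (\<And>c v. v \<in> V \<Longrightarrow> c \<cdot>\<^sub>v v \<in> V) \<Longrightarrow> (\<And>i v. i < 3 \<Longrightarrow> v \<in> V \<Longrightarrow> Y i *\<^sub>v v \<in> V) \<Longrightarrow>
      x \<in> V \<Longrightarrow> x \<noteq> 0\<^sub>v m \<Longrightarrow> V = carrier_vec m"
begin

lemma Y_dim [simp]: "i < 3 \<Longrightarrow> dim_row (Y i) = m" "i < 3 \<Longrightarrow> dim_col (Y i) = m"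
  using carrier[of i] by auto

text \<open>The joint kernel is an invariant subspace containing \<open>u\<close>, hence everything.
  A family is treated because an equivariant triple mixes its members, so that only their joint
  kernel is invariant.\<close>

lemma common_kernel_zero:
  assumes K: "\<And>a. a \<in> I \<Longrightarrow> K a \<in> carrier_mat r m"
    and inv: "\<And>a j v. a \<in> I \<Longrightarrow> j < 3 \<Longrightarrow> v \<in> carrier_vec m \<Longrightarrow> (\<And>b. b \<in> I \<Longrightarrow> K b *\<^sub>v v = 0\<^sub>v r)
      \<Longrightarrow> K a *\<^sub>v (Y j *\<^sub>v v) = 0\<^sub>v r"
    and u: "u \<in> carrier_vec m" "u \<noteq> 0\<^sub>v m" "\<And>a. a \<in> I \<Longrightarrow> K a *\<^sub>v u = 0\<^sub>v r"
    and a: "a \<in> I"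
  shows "K a = 0\<^sub>m r m"
proof -
  define V where "V = {v \<in> carrier_vec m. \<forall>a\<in>I. K a *\<^sub>v v = 0\<^sub>v r}"
  have V: "V = carrier_vec m"
  proof (rule irreducible[of V u])
    show "v + w \<in> V" if "v \<in> V" "w \<in> V" for v w :: "complex vec"
      using that K unfolding V_def by (auto simp: mult_add_distrib_mat_vec[of _ r m])
    show "c \<cdot>\<^sub>v v \<in> V" if "v \<in> V" for c :: complex and v :: "complex vec"
      using that K unfolding V_def by (auto simp: mult_mat_vec[of _ r m])
    show "Y i *\<^sub>v v \<in> V" if "i < 3" "v \<in> V" for i and v :: "complex vec"
    proof -
      have "K a *\<^sub>v (Y i *\<^sub>v v) = 0\<^sub>v r" if "a \<in> I" for a
        by (rule inv) (use \<open>i < 3\<close> \<open>v \<in> V\<close> that in \<open>simp_all add: V_def\<close>)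
      moreover have "Y i *\<^sub>v v \<in> carrier_vec m"
        using carrier[OF \<open>i < 3\<close>] \<open>v \<in> V\<close> by (simp add: V_def)
      ultimately show ?thesis by (simp add: V_def)
    qed
  qed (use u V_def in simp_all)
  show ?thesis
  proof (rule mat_eq_zero_if_mult_vec_zero[OF K[OF a]])
    fix v :: "complex vec" assume "v \<in> carrier_vec m"
    hence "v \<in> V" using V by simp
    thus "K a *\<^sub>v v = 0\<^sub>v r" using a unfolding V_def by auto
  qed
qed

lemma commuting_zero:
  assumes K: "K \<in> carrier_mat m m" and comm: "\<And>j. j < 3 \<Longrightarrow> K * Y j = Y j * K"
    and u: "u \<in> carrier_vec m" "u \<noteq> 0\<^sub>v m" "K *\<^sub>v u = 0\<^sub>v m"
  shows "K = 0\<^sub>m m m"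
proof (rule common_kernel_zero[where I = "UNIV :: unit set" and K = "\<lambda>_. K"])
  fix j v assume j: "j < (3 :: nat)" and v: "v \<in> carrier_vec m"
    and z: "\<And>b. b \<in> (UNIV :: unit set) \<Longrightarrow> K *\<^sub>v v = 0\<^sub>v m"
  have "K *\<^sub>v (Y j *\<^sub>v v) = (K * Y j) *\<^sub>v v"
    by (rule assoc_mult_mat_vec[symmetric]) (use K carrier j v in auto)
  also have "\<dots> = Y j *\<^sub>v (K *\<^sub>v v)" unfolding comm[OF j]
    by (rule assoc_mult_mat_vec) (use K carrier j v in auto)
  also have "\<dots> = 0\<^sub>v m" using z carrier[OF j] by auto
  finally show "K *\<^sub>v (Y j *\<^sub>v v) = 0\<^sub>v m" .
qed (use K u in auto)

text \<open>An eigenvector lies in the kernel of \<open>K - c\<close>, which again commutes with the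
  \<open>Y j\<close>. The eigenvector is an argument so that the Casimir scalar can be read off from
  a highest weight vector.\<close>

lemma commuting_scalar:
  assumes K: "K \<in> carrier_mat m m" and comm: "\<And>j. j < 3 \<Longrightarrow> K * Y j = Y j * K"
    and u: "u \<in> carrier_vec m" "u \<noteq> 0\<^sub>v m" "K *\<^sub>v u = c \<cdot>\<^sub>v u"
  shows "K = c \<cdot>\<^sub>m 1\<^sub>m m"
proof -
  have "K - c \<cdot>\<^sub>m 1\<^sub>m m = 0\<^sub>m m m"
  proof (rule commuting_zero[OF _ _ u(1,2)])
    show "(K - c \<cdot>\<^sub>m 1\<^sub>m m) * Y j = Y j * (K - c \<cdot>\<^sub>m 1\<^sub>m m)" if "j < 3" for j
    proof (rule Op_inj[of _ m m])
      have "Op K * Op (Y j) = Op (Y j) * Op K"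
        using arg_cong[OF comm[OF that], of Op] K that by (simp add: Op_mult)
      thus "Op ((K - c \<cdot>\<^sub>m 1\<^sub>m m) * Y j) = Op (Y j * (K - c \<cdot>\<^sub>m 1\<^sub>m m))"
        using K carrier[OF that]
        by (simp add: Op_mult Op_diff Op_smult left_diff_distrib right_diff_distrib Op_one_left Op_one_right)
    qed (use K carrier[OF that] in auto)
    have "(c \<cdot>\<^sub>m 1\<^sub>m m) *\<^sub>v u = c \<cdot>\<^sub>v u"
      using u(1) by (intro eq_vecI) auto
    thus "(K - c \<cdot>\<^sub>m 1\<^sub>m m) *\<^sub>v u = 0\<^sub>v m"
      using u by (simp add: minus_mult_distrib_mat_vec[OF K _ u(1)])
  qed (use K in auto)
  moreover have "(K - c \<cdot>\<^sub>m 1\<^sub>m m) + c \<cdot>\<^sub>m 1\<^sub>m m = K"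
    by (rule eq_matI) (use K in auto)
  ultimately show ?thesis by simp
qed

lemma schur:
  assumes K: "K \<in> carrier_mat m m" and comm: "\<And>j. j < 3 \<Longrightarrow> K * Y j = Y j * K"
  obtains c where "K = c \<cdot>\<^sub>m 1\<^sub>m m"
proof -
  obtain c where "eigenvalue K c" using spectrum_non_empty[OF K] pos unfolding spectrum_def by auto
  then obtain u where "eigenvector K u c" unfolding eigenvalue_def by auto
  hence u: "u \<in> carrier_vec m" "u \<noteq> 0\<^sub>v m" "K *\<^sub>v u = c \<cdot>\<^sub>v u"
    using K unfolding eigenvector_def by auto
  show ?thesis
  proof (rule that)
    show "K = c \<cdot>\<^sub>m 1\<^sub>m m" by (rule commuting_scalar[OF K _ u]) (rule comm)
  qed
qed

end

section \<open>Weights of an irreducible representation\<close>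

lemma surjective_mat_invertible:
  assumes PQ: "(P :: 'a :: field mat) \<in> carrier_mat m m" "\<And>y. y \<in> carrier_vec m \<Longrightarrow> \<exists>x\<in>carrier_vec m. P *\<^sub>v x = y"
  obtains Q where "Q \<in> carrier_mat m m" "P * Q = 1\<^sub>m m" "Q * P = 1\<^sub>m m"
proof -
  obtain x where x: "\<And>i. x i \<in> carrier_vec m" "\<And>i. P *\<^sub>v x i = unit_vec m i"
    using PQ(2)[OF unit_vec_carrier] by metis
  define Q where "Q = mat m m (\<lambda>(j, i). x i $ j)"
  have Q: "Q \<in> carrier_mat m m" by (simp add: Q_def)
  have c: "col Q i = x i" if "i < m" for i
    using that x(1)[of i] by (intro eq_vecI) (auto simp: Q_def)
  have "P * Q = 1\<^sub>m m"
  proof (rule eq_matI)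
    fix i j assume ij: "i < dim_row (1\<^sub>m m)" "j < dim_col (1\<^sub>m m)"
    hence "(P * Q) $$ (i, j) = (P *\<^sub>v x j) $ i"
      using PQ(1) Q c by simp
    also have "\<dots> = 1\<^sub>m m $$ (i, j)" unfolding x(2) using ij by simp
    finally show "(P * Q) $$ (i, j) = 1\<^sub>m m $$ (i, j)" .
  qed (use PQ Q in auto)
  thus ?thesis using that[OF Q] mat_mult_left_right_inverse[OF PQ(1) Q] by blast
qed

text \<open>Eigenvalues are compared by their real parts, because the weights are not yet known to
  be real. A maximum exists as the spectrum is finite.\<close>

lemma exists_eigenvalue_max_Re:
  fixes A :: "complex mat"
  assumes A: "A \<in> carrier_mat n n" and n: "n > 0"
  obtains h u where "u \<in> carrier_vec n" "u \<noteq> 0\<^sub>v n" "A *\<^sub>v u = h \<cdot>\<^sub>v u"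
    "\<And>w c. w \<in> carrier_vec n \<Longrightarrow> A *\<^sub>v w = c \<cdot>\<^sub>v w \<Longrightarrow> Re c > Re h \<Longrightarrow> w = 0\<^sub>v n"
proof -
  have fin: "finite (spectrum A)" and ne: "spectrum A \<noteq> {}"
    using card_finite_spectrum(1)[OF A] spectrum_non_empty[OF A n] by auto
  obtain h where h: "h \<in> spectrum A" "Re h = Max (Re ` spectrum A)"
    using Max_in[of "Re ` spectrum A"] fin ne by fastforce
  have max: "Re c \<le> Re h" if "c \<in> spectrum A" for c
    unfolding h(2) using that fin by (intro Max_ge) auto
  from h(1) obtain u where u: "u \<in> carrier_vec n" "u \<noteq> 0\<^sub>v n" "A *\<^sub>v u = h \<cdot>\<^sub>v u"
    using A unfolding spectrum_def eigenvalue_def eigenvector_def by auto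
  show ?thesis
  proof (rule that[OF u])
    fix w c assume w: "w \<in> carrier_vec n" "A *\<^sub>v w = c \<cdot>\<^sub>v w" "Re c > Re h"
    show "w = 0\<^sub>v n"
    proof (rule ccontr)
      assume "w \<noteq> 0\<^sub>v n"
      hence "c \<in> spectrum A"
        using w A unfolding spectrum_def eigenvalue_def eigenvector_def by auto
      with max w(3) show False by force
    qed
  qed
qed

section \<open>Ladder operators and the basis generated by a highest weight vector\<close>

context irrep
begin

text \<open>The factor \<open>\<i>\<close> makes \<open>H\<close> Hermitian; its eigenvalues are the
  weights, which \<open>E\<close> raises and \<open>F\<close> lowers by one. Since the
  \<open>Y i\<close> are skew-adjoint and \<open>E\<close>, \<open>F\<close> carry no extra factor,
  their commutator is \<open>- 2\<close> times \<open>H\<close>, of opposite sign to the usual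
  normalization.\<close>

definition H where "H = \<i> \<cdot>\<^sub>m Y 2"
definition E where "E = Y 0 + \<i> \<cdot>\<^sub>m Y 1"
definition F where "F = Y 0 - \<i> \<cdot>\<^sub>m Y 1"
definition Cas where "Cas = Y 0 * Y 0 + Y 1 * Y 1 + Y 2 * Y 2"

lemma HEF_carrier [simp]: "H \<in> carrier_mat m m" "E \<in> carrier_mat m m" "F \<in> carrier_mat m m" "Cas \<in> carrier_mat m m"
  by (rule carrier_matI; simp add: H_def E_def F_def Cas_def)+

lemma HEF_dim [simp]: "dim_row H = m" "dim_row E = m" "dim_row F = m" "dim_col H = m" "dim_col E = m" "dim_col F = m"
  "dim_row Cas = m" "dim_col Cas = m"
  by (simp_all add: H_def E_def F_def Cas_def)

lemma HEF_vec_carrier [simp]: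
  assumes "w \<in> carrier_vec m"
  shows "H *\<^sub>v w \<in> carrier_vec m" "E *\<^sub>v w \<in> carrier_vec m" "F *\<^sub>v w \<in> carrier_vec m"
  using assms by (auto intro!: mult_mat_vec_carrier[OF HEF_carrier(1)] mult_mat_vec_carrier[OF HEF_carrier(2)]
      mult_mat_vec_carrier[OF HEF_carrier(3)])

lemma Op_HEF: "Op H = \<i> \<star> Op (Y 2)" "Op E = Op (Y 0) + \<i> \<star> Op (Y 1)" "Op F = Op (Y 0) - \<i> \<star> Op (Y 1)"
  "Op Cas = Op (Y 0) * Op (Y 0) + Op (Y 1) * Op (Y 1) + Op (Y 2) * Op (Y 2)"
  by (simp_all add: H_def E_def F_def Cas_def Op_add Op_diff Op_smult Op_mult del: One_nat_def)

lemma y_rules: "Op (Y 1) * Op (Y 0) = Op (Y 0) * Op (Y 1) - Op (Y 2)"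
    "Op (Y 2) * Op (Y 1) = Op (Y 1) * Op (Y 2) - Op (Y 0)" "Op (Y 2) * Op (Y 0) = Op (Y 0) * Op (Y 2) + Op (Y 1)"
  using relations unfolding so3_relations_def by (simp_all add: algebra_simps del: One_nat_def)

lemmas op_distrib = distrib_left distrib_right left_diff_distrib right_diff_distrib scale_add

lemma HF: "H * F = F * H - F"
  by (rule Op_eqI)
    (simp_all add: Op_mult Op_diff Op_HEF op_distrib y_rules add_ac del: One_nat_def)

lemma HE: "H * E = E * H + E"
  by (rule Op_eqI)
    (simp_all add: Op_mult Op_add Op_HEF op_distrib y_rules add_ac del: One_nat_def)

lemma EF: "E * F = F * E - 2 \<cdot>\<^sub>m H"
proof (rule Op_eqI)
  have "(\<i> + \<i>) \<star> Op (Y 2) = \<i> \<star> Op (Y 2) + \<i> \<star> Op (Y 2)"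
    by (simp only: scale_add)
  thus "Op (E * F) = Op (F * E - 2 \<cdot>\<^sub>m H)"
    by (simp add: Op_mult Op_diff Op_HEF Op_smult op_distrib y_rules(1) algebra_simps mult_2 del: One_nat_def)
qed simp_all

text \<open>\<open>E\<close> stands on the right so that on a highest weight vector of weight
  \<open>h\<close> only \<open>- h - h * h\<close> remains.\<close>

lemma Cas_eq: "Cas = F * E - H - H * H"
  by (rule Op_eqI)
    (simp_all add: Op_mult Op_diff Op_HEF op_distrib y_rules(1) add_ac del: One_nat_def)

lemma Cas_commute: "j < 3 \<Longrightarrow> Cas * Y j = Y j * Cas"
proof (rule Op_eqI)
  assume j: "j < 3"
  hence "j = 0 \<or> j = 1 \<or> j = 2" by auto
  thus "Op (Cas * Y j) = Op (Y j * Cas)"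
    by (elim disjE) (simp_all add: Op_mult Op_HEF op_distrib y_rules y_rules[THEN mult_left] mult.assoc add_ac del: One_nat_def)
qed simp_all

lemma HF_vec: 
  assumes "w \<in> carrier_vec m" "H *\<^sub>v w = c \<cdot>\<^sub>v w"
  shows "H *\<^sub>v (F *\<^sub>v w) = (c - 1) \<cdot>\<^sub>v (F *\<^sub>v w)"
proof -
  have "H *\<^sub>v (F *\<^sub>v w) = (H * F) *\<^sub>v w" 
    by (rule assoc_mult_mat_vec[of _ m m _ m, symmetric]) (use assms in auto)
  also have "\<dots> = F *\<^sub>v (H *\<^sub>v w) - F *\<^sub>v w"
    unfolding HF using assms
    by (subst minus_mult_distrib_mat_vec[of _ m m]) (auto simp: assoc_mult_mat_vec[of _ m m _ m])
  also have "\<dots> = (c - 1) \<cdot>\<^sub>v (F *\<^sub>v w)"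
    using assms by (intro eq_vecI) (auto simp: mult_mat_vec[of _ m m] algebra_simps)
  finally show ?thesis .
qed

lemma HE_vec: 
  assumes "w \<in> carrier_vec m" "H *\<^sub>v w = c \<cdot>\<^sub>v w"
  shows "H *\<^sub>v (E *\<^sub>v w) = (c + 1) \<cdot>\<^sub>v (E *\<^sub>v w)"
proof -
  have "H *\<^sub>v (E *\<^sub>v w) = (H * E) *\<^sub>v w" 
    by (rule assoc_mult_mat_vec[of _ m m _ m, symmetric]) (use assms in auto)
  also have "\<dots> = E *\<^sub>v (H *\<^sub>v w) + E *\<^sub>v w"
    unfolding HE using assms
    by (subst add_mult_distrib_mat_vec[of _ m m]) (auto simp: assoc_mult_mat_vec[of _ m m _ m])
  also have "\<dots> = (c + 1) \<cdot>\<^sub>v (E *\<^sub>v w)"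
    using assms by (intro eq_vecI) (auto simp: mult_mat_vec[of _ m m] algebra_simps)
  finally show ?thesis .
qed

lemma EF_vec: 
  assumes "w \<in> carrier_vec m"
  shows "E *\<^sub>v (F *\<^sub>v w) = F *\<^sub>v (E *\<^sub>v w) - 2 \<cdot>\<^sub>v (H *\<^sub>v w)"
proof -
  have s: "(2 \<cdot>\<^sub>m H) *\<^sub>v w = 2 \<cdot>\<^sub>v (H *\<^sub>v w)"
    using assms by (intro eq_vecI) (auto simp: scalar_prod_def sum_distrib_left mult.assoc)
  have "E *\<^sub>v (F *\<^sub>v w) = (E * F) *\<^sub>v w" 
    by (rule assoc_mult_mat_vec[of _ m m _ m, symmetric]) (use assms in auto)
  also have "\<dots> = F *\<^sub>v (E *\<^sub>v w) - 2 \<cdot>\<^sub>v (H *\<^sub>v w)"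
    unfolding EF using assms
    by (subst minus_mult_distrib_mat_vec[of _ m m]) (auto simp: assoc_mult_mat_vec[of _ m m _ m] s)
  finally show ?thesis .
qed

lemma Y_HEF: "Y 0 = (1/2) \<cdot>\<^sub>m (E + F)" "Y 1 = (- \<i> / 2) \<cdot>\<^sub>m (E - F)" "Y 2 = (- \<i>) \<cdot>\<^sub>m H"
  by (rule eq_matI; simp add: H_def E_def F_def field_simps)+

text \<open>\<open>E\<close> would raise the weight beyond the one with maximal real part.\<close>

lemma highest_weight_vector:
  obtains h u where "u \<in> carrier_vec m" "u \<noteq> 0\<^sub>v m" "H *\<^sub>v u = h \<cdot>\<^sub>v u" "E *\<^sub>v u = 0\<^sub>v m"
proof -
  obtain h u where u: "u \<in> carrier_vec m" "u \<noteq> 0\<^sub>v m" "H *\<^sub>v u = h \<cdot>\<^sub>v u"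
    and max: "\<And>w c. w \<in> carrier_vec m \<Longrightarrow> H *\<^sub>v w = c \<cdot>\<^sub>v w \<Longrightarrow> Re c > Re h \<Longrightarrow> w = 0\<^sub>v m"
  proof (rule exists_eigenvalue_max_Re[OF HEF_carrier(1)])
    show "0 < m" using pos by simp
  qed blast
  have "E *\<^sub>v u = 0\<^sub>v m"
    by (rule max[OF _ HE_vec[OF u(1,3)]]) (use u in auto)
  with u show ?thesis using that by blast
qed

definition chain :: "complex vec \<Rightarrow> nat \<Rightarrow> complex vec" where
  "chain u k = ((\<lambda>w. F *\<^sub>v w) ^^ k) u"

lemma chain_simps: "chain u 0 = u" "chain u (Suc k) = F *\<^sub>v chain u k"
  by (simp_all add: chain_def)

lemma chain_carrier [simp]: "u \<in> carrier_vec m \<Longrightarrow> chain u k \<in> carrier_vec m"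
  by (induction k) (auto simp: chain_simps)

lemma chain_dim [simp]: "u \<in> carrier_vec m \<Longrightarrow> dim_vec (chain u k) = m"
  using chain_carrier[of u k] by (simp del: chain_carrier)

lemma H_chain:
  assumes "u \<in> carrier_vec m" "H *\<^sub>v u = h \<cdot>\<^sub>v u"
  shows "H *\<^sub>v chain u k = (h - of_nat k) \<cdot>\<^sub>v chain u k"
proof (induction k)
  case (Suc k)
  show ?case using HF_vec[OF chain_carrier[OF assms(1)] Suc]
    by (simp add: chain_simps diff_diff_eq add.commute)
qed (use assms in \<open>simp add: chain_simps\<close>)

text \<open>Each exchange of \<open>E\<close> with \<open>F\<close> contributes \<open>- 2\<close>
  times the current weight, and the sum of \<open>2 * (h - j)\<close> over \<open>j \<le> k\<close>
  is \<open>(k + 1) * (2 * h - k)\<close>.\<close>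

lemma E_chain:
  assumes u: "u \<in> carrier_vec m" "H *\<^sub>v u = h \<cdot>\<^sub>v u" "E *\<^sub>v u = 0\<^sub>v m"
  shows "E *\<^sub>v chain u (Suc k) = (- of_nat (Suc k) * (2 * h - of_nat k)) \<cdot>\<^sub>v chain u k"
proof (induction k)
  case 0
  show ?case using u EF_vec[OF u(1)] mult_mat_vec[of F m m "0\<^sub>v m" 0]
    by (intro eq_vecI) (auto simp: chain_simps smult_smult_assoc)
next
  case (Suc k)
  let ?w = "chain u (Suc k)"
  have "E *\<^sub>v chain u (Suc (Suc k)) = F *\<^sub>v (E *\<^sub>v ?w) - 2 \<cdot>\<^sub>v (H *\<^sub>v ?w)"
    unfolding chain_simps(2)[of u "Suc k"] by (rule EF_vec) (simp add: u)
  also have "F *\<^sub>v (E *\<^sub>v ?w) = (- of_nat (Suc k) * (2 * h - of_nat k)) \<cdot>\<^sub>v ?w"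
    unfolding Suc using u by (subst mult_mat_vec[of _ m m]) (auto simp: chain_simps)
  also have "H *\<^sub>v ?w = (h - of_nat (Suc k)) \<cdot>\<^sub>v ?w" by (rule H_chain) (use u in auto)
  finally show ?case using u by (intro eq_vecI) (auto simp: algebra_simps)
qed

text \<open>Otherwise \<open>H\<close> would have the \<open>m + 1\<close> distinct eigenvalues
  \<open>h - k\<close> with \<open>k \<le> m\<close>.\<close>

lemma chain_vanishes:
  assumes u: "u \<in> carrier_vec m" "H *\<^sub>v u = h \<cdot>\<^sub>v u"
  shows "chain u m = 0\<^sub>v m"
proof (rule ccontr)
  assume nz: "chain u m \<noteq> 0\<^sub>v m"
  have nz: "chain u k \<noteq> 0\<^sub>v m" if "k \<le> m" for k
  proof
    assume z: "chain u k = 0\<^sub>v m"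
    have "chain u (k + j) = 0\<^sub>v m" for j
      by (induction j) (use z in \<open>auto simp: chain_simps\<close>)
    from this[of "m - k"] that nz show False by simp
  qed
  have "(\<lambda>k. h - of_nat k) ` {..m} \<subseteq> spectrum H"
  proof safe
    fix k assume "k \<le> m"
    hence "eigenvector H (chain u k) (h - of_nat k)"
      unfolding eigenvector_def using nz[of k] H_chain[OF u, of k] u by simp
    thus "h - of_nat k \<in> spectrum H" unfolding spectrum_def eigenvalue_def by blast
  qed
  hence "card ((\<lambda>k. h - of_nat k :: complex) ` {..m}) \<le> card (spectrum H)"
    by (intro card_mono card_finite_spectrum) auto
  also have "\<dots> \<le> m" by (intro card_finite_spectrum) auto
  finally show False by (subst (asm) card_image) (auto simp: inj_on_def)
qed

definition chain_mat :: "complex vec \<Rightarrow> complex mat" where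
  "chain_mat u = mat m m (\<lambda>(i, k). chain u k $ i)"

lemma chain_mat_carrier [simp]: "chain_mat u \<in> carrier_mat m m"
  by (simp add: chain_mat_def)

lemma chain_mat_col: "k < m \<Longrightarrow> u \<in> carrier_vec m \<Longrightarrow> col (chain_mat u) k = chain u k"
  by (intro eq_vecI) (auto simp: chain_mat_def)

text \<open>\<open>B\<close> describes the action of \<open>A\<close> on the chain. This does not
  presuppose that the chain is a basis, which is proved with its help.\<close>

lemma chain_mat_mult:
  assumes u: "u \<in> carrier_vec m" and A: "A \<in> carrier_mat m m" and B: "B \<in> carrier_mat m m"
    and AB: "\<And>k i. k < m \<Longrightarrow> i < m \<Longrightarrow> (A *\<^sub>v chain u k) $ i = (\<Sum>j<m. B $$ (j, k) * chain u j $ i)"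
  shows "A * chain_mat u = chain_mat u * B"
proof (rule eq_matI)
  fix i k assume "i < dim_row (chain_mat u * B)" "k < dim_col (chain_mat u * B)"
  hence ik: "i < m" "k < m" using B by (auto simp: chain_mat_def)
  have "(A * chain_mat u) $$ (i, k) = (A *\<^sub>v col (chain_mat u) k) $ i"
    using ik A by (auto simp: chain_mat_def)
  also have "\<dots> = (\<Sum>j<m. B $$ (j, k) * chain u j $ i)"
    unfolding chain_mat_col[OF ik(2) u] using AB ik by simp
  also have "\<dots> = (chain_mat u * B) $$ (i, k)"
    using ik B by (auto simp: chain_mat_def scalar_prod_def lessThan_atLeast0 mult.commute)
  finally show "(A * chain_mat u) $$ (i, k) = (chain_mat u * B) $$ (i, k)" .
qed (use A B in \<open>auto simp: chain_mat_def\<close>)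

lemma mult_chain_mat_vec:
  assumes "A \<in> carrier_mat m m" "B \<in> carrier_mat m m" "A * chain_mat u = chain_mat u * B" "x \<in> carrier_vec m"
  shows "A *\<^sub>v (chain_mat u *\<^sub>v x) = chain_mat u *\<^sub>v (B *\<^sub>v x)"
proof -
  have "A *\<^sub>v (chain_mat u *\<^sub>v x) = (A * chain_mat u) *\<^sub>v x"
    by (rule assoc_mult_mat_vec[OF assms(1) chain_mat_carrier assms(4), symmetric])
  thus ?thesis unfolding assms(3) using assoc_mult_mat_vec[OF chain_mat_carrier assms(2,4)] by simp
qed

lemma chain_mat_unit:
  assumes "k < m" "u \<in> carrier_vec m"
  shows "chain_mat u *\<^sub>v unit_vec m k = chain u k"
proof (rule eq_vecI)
  fix i assume "i < dim_vec (chain u k)"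
  hence "i < m" using assms by simp
  thus "(chain_mat u *\<^sub>v unit_vec m k) $ i = chain u k $ i"
    using assms by (simp add: chain_mat_def)
qed (use assms in \<open>simp add: chain_mat_def\<close>)

lemma Y_mult_vec:
  assumes "w \<in> carrier_vec m"
  shows "Y 0 *\<^sub>v w = (1/2) \<cdot>\<^sub>v (E *\<^sub>v w + F *\<^sub>v w)"
    and "Y 1 *\<^sub>v w = (- \<i> / 2) \<cdot>\<^sub>v (E *\<^sub>v w + (-1) \<cdot>\<^sub>v (F *\<^sub>v w))"
    and "Y 2 *\<^sub>v w = (- \<i>) \<cdot>\<^sub>v (H *\<^sub>v w)"
  unfolding Y_HEF
  using assms HEF_carrier[THEN carrier_matD(1)] HEF_carrier[THEN carrier_matD(2)]
  by (intro eq_vecI; simp add: scalar_prod_def sum_distrib_left sum.distrib sum_subtractf sum_negf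
      right_diff_distrib distrib_left distrib_right left_diff_distrib mult.assoc)+

text \<open>The range of \<open>chain_mat u\<close> is a nonzero invariant subspace.\<close>

lemma chain_mat_invertible:
  assumes u: "u \<in> carrier_vec m" "u \<noteq> 0\<^sub>v m" "H *\<^sub>v u = h \<cdot>\<^sub>v u" "E *\<^sub>v u = 0\<^sub>v m"
  obtains Q where "Q \<in> carrier_mat m m" "chain_mat u * Q = 1\<^sub>m m" "Q * chain_mat u = 1\<^sub>m m"
proof -
  define V where "V = {chain_mat u *\<^sub>v x | x. x \<in> carrier_vec m}"
  have V_add: "v + w \<in> V" if vw: "v \<in> V" "w \<in> V" for v w
  proof -
    obtain x y where "x \<in> carrier_vec m" "y \<in> carrier_vec m" "v = chain_mat u *\<^sub>v x" "w = chain_mat u *\<^sub>v y"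
      using vw unfolding V_def by blast
    hence "v + w = chain_mat u *\<^sub>v (x + y)" "x + y \<in> carrier_vec m"
      by (simp_all add: mult_add_distrib_mat_vec[OF chain_mat_carrier])
    thus ?thesis unfolding V_def by blast
  qed
  have V_smult: "c \<cdot>\<^sub>v v \<in> V" if v: "v \<in> V" for c v
  proof -
    obtain x where "x \<in> carrier_vec m" "v = chain_mat u *\<^sub>v x"
      using v unfolding V_def by blast
    hence "c \<cdot>\<^sub>v v = chain_mat u *\<^sub>v (c \<cdot>\<^sub>v x)" "c \<cdot>\<^sub>v x \<in> carrier_vec m"
      by (simp_all add: mult_mat_vec[OF chain_mat_carrier])
    thus ?thesis unfolding V_def by blast
  qed
  have V_inv: "A *\<^sub>v v \<in> V"
    if A: "A \<in> carrier_mat m m" and B: "B \<in> carrier_mat m m"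
      and AB: "\<And>k i. k < m \<Longrightarrow> i < m \<Longrightarrow> (A *\<^sub>v chain u k) $ i = (\<Sum>j<m. B $$ (j, k) * chain u j $ i)"
      and v: "v \<in> V" for A B v
  proof -
    obtain x where x: "x \<in> carrier_vec m" "v = chain_mat u *\<^sub>v x"
      using v unfolding V_def by blast
    have "A *\<^sub>v v = chain_mat u *\<^sub>v (B *\<^sub>v x)"
      unfolding x(2) by (rule mult_chain_mat_vec[OF A B chain_mat_mult[OF u(1) A B AB] x(1)])
    moreover have "B *\<^sub>v x \<in> carrier_vec m" using B x by simp
    ultimately show ?thesis unfolding V_def by blast
  qed
  have VH: "H *\<^sub>v v \<in> V" if "v \<in> V" for v
  proof (rule V_inv[OF HEF_carrier(1) _ _ that])
    show "(H *\<^sub>v chain u k) $ i = (\<Sum>j<m. mat m m (\<lambda>(j, k). if j = k then h - of_nat k else 0) $$ (j, k) * chain u j $ i)"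
      if "k < m" "i < m" for k i
      unfolding H_chain[OF u(1,3)] using that u by (simp add: if_distrib[of "\<lambda>z. z * _"] cong: if_cong)
  qed simp
  have VF: "F *\<^sub>v v \<in> V" if "v \<in> V" for v
  proof (rule V_inv[OF HEF_carrier(3) _ _ that])
    show "(F *\<^sub>v chain u k) $ i = (\<Sum>j<m. mat m m (\<lambda>(j, k). if j = Suc k then 1 else 0) $$ (j, k) * chain u j $ i)"
      if "k < m" "i < m" for k i
    proof (cases "Suc k < m")
      case True
      thus ?thesis unfolding chain_simps[symmetric]
        using that u by (simp add: if_distrib[of "\<lambda>z. z * _"] cong: if_cong)
    next
      \<comment> \<open>\<open>F\<close> leads out of the chain from its last vector: the
        coefficient column is empty, and \<open>chain_vanishes\<close> says that the image is
        zero.\<close>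
      case False
      hence "Suc k = m" using that by simp
      thus ?thesis unfolding chain_simps[symmetric]
        using that chain_vanishes[OF u(1,3)] by (simp add: if_distrib[of "\<lambda>z. z * _"] cong: if_cong)
    qed
  qed simp
  have VE: "E *\<^sub>v v \<in> V" if "v \<in> V" for v
  proof (rule V_inv[OF HEF_carrier(2) _ _ that])
    show "(E *\<^sub>v chain u k) $ i = (\<Sum>j<m. mat m m (\<lambda>(j, k). if k = Suc j then - of_nat k * (2 * h - of_nat j) else 0) $$ (j, k) * chain u j $ i)"
      if "k < m" "i < m" for k i
    proof (cases k)
      case 0
      thus ?thesis using u that by (simp add: chain_simps)
    next
      case (Suc k')
      show ?thesis unfolding Suc E_chain[OF u(1,3,4)]
        using that u Suc by (simp add: if_distrib[of "\<lambda>z. z * _"] cong: if_cong)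
    qed
  qed simp
  have V: "V = carrier_vec m"
  proof (rule irreducible[of V u])
    show Vc: "V \<subseteq> carrier_vec m"
      unfolding V_def using mult_mat_vec_carrier[OF chain_mat_carrier] by blast
    show "Y i *\<^sub>v v \<in> V" if i: "i < 3" and v: "v \<in> V" for i v
    proof -
      have vc: "v \<in> carrier_vec m" using v Vc by blast
      have "i = 0 \<or> i = 1 \<or> i = 2" using i by auto
      thus ?thesis
        using Y_mult_vec[OF vc] V_add V_smult VE[OF v] VF[OF v] VH[OF v] by (elim disjE) metis+
    qed
    show "u \<in> V" unfolding V_def using chain_mat_unit[of 0 u] u pos
      by (intro CollectI exI[of _ "unit_vec m 0"]) (auto simp: chain_simps)
  qed (use V_add V_smult u in blast)+
  show ?thesis
  proof (rule surjective_mat_invertible[OF chain_mat_carrier])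
    fix y :: "complex vec" assume "y \<in> carrier_vec m"
    hence "y \<in> V" unfolding V .
    thus "\<exists>x\<in>carrier_vec m. chain_mat u *\<^sub>v x = y" unfolding V_def by blast
  qed (rule that)
qed

text \<open>The spin belonging to dimension \<open>m\<close>; that it is indeed the highest weight
  is part of \<open>weights\<close>.\<close>

definition weight :: complex where "weight = (of_nat m - 1) / 2"

text \<open>In the chain basis \<open>H\<close> is diagonal with simple eigenvalues, so its spectrum
  and the line of top weight vectors can be read off in coordinates; the Casimir scalar is its value
  on \<open>u\<close>.\<close>

lemma weights:
  obtains u where "u \<in> carrier_vec m" "u \<noteq> 0\<^sub>v m" "H *\<^sub>v u = weight \<cdot>\<^sub>v u"
    "\<And>w c. w \<in> carrier_vec m \<Longrightarrow> w \<noteq> 0\<^sub>v m \<Longrightarrow> H *\<^sub>v w = c \<cdot>\<^sub>v w \<Longrightarrow> \<exists>k<m. c = weight - of_nat k"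
    "\<And>w. w \<in> carrier_vec m \<Longrightarrow> H *\<^sub>v w = weight \<cdot>\<^sub>v w \<Longrightarrow> \<exists>c. w = c \<cdot>\<^sub>v u"
    "Cas = (- weight * (weight + 1)) \<cdot>\<^sub>m 1\<^sub>m m"
proof -
  obtain h u where u: "u \<in> carrier_vec m" "u \<noteq> 0\<^sub>v m" "H *\<^sub>v u = h \<cdot>\<^sub>v u" "E *\<^sub>v u = 0\<^sub>v m"
    by (rule highest_weight_vector)
  obtain Q where Q: "Q \<in> carrier_mat m m" "chain_mat u * Q = 1\<^sub>m m" "Q * chain_mat u = 1\<^sub>m m"
    by (rule chain_mat_invertible[OF u])
  have QP: "Q *\<^sub>v (chain_mat u *\<^sub>v x) = x" if "x \<in> carrier_vec m" for x
    using that assoc_mult_mat_vec[OF Q(1) chain_mat_carrier[of u] that] Q(3) by simp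
  have PQ: "chain_mat u *\<^sub>v (Q *\<^sub>v x) = x" if "x \<in> carrier_vec m" for x
    using that assoc_mult_mat_vec[OF chain_mat_carrier[of u] Q(1) that] Q(2) by simp
  define l where "l = m - 1"
  have m: "m = Suc l" using pos by (simp add: l_def)
  \<comment> \<open>The chain stops exactly after \<open>m\<close> vectors. Applying
    \<open>E\<close> to the vanishing next one gives a multiple of the last nonzero vector
    \<open>chain u l\<close>, and the factor \<open>2 * h - l\<close> has to be zero.\<close>
  have h: "h = weight"
  proof -
    have "chain u l \<noteq> 0\<^sub>v m"
    proof
      assume z: "chain u l = 0\<^sub>v m"
      have "unit_vec m l = Q *\<^sub>v chain u l"
        using QP[of "unit_vec m l"] chain_mat_unit[of l u] u m by simp
      also have "\<dots> = 0\<^sub>v m" unfolding z using Q by (intro eq_vecI) auto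
      finally have "unit_vec m l $ l = (0\<^sub>v m $ l :: complex)" by simp
      thus False using m by simp
    qed
    then obtain i where i: "i < m" "chain u l $ i \<noteq> 0"
      using u by (metis chain_carrier carrier_vecD eq_vecI index_zero_vec)
    have "(- of_nat (Suc l) * (2 * h - of_nat l)) \<cdot>\<^sub>v chain u l = E *\<^sub>v chain u m"
      unfolding m by (rule E_chain[OF u(1,3,4), symmetric])
    also have "\<dots> = 0\<^sub>v m"
      unfolding chain_vanishes[OF u(1,3)] by (intro eq_vecI) auto
    finally have "((- of_nat (Suc l) * (2 * h - of_nat l)) \<cdot>\<^sub>v chain u l) $ i = 0\<^sub>v m $ i" by simp
    hence "(- of_nat (Suc l) * (2 * h - of_nat l)) * chain u l $ i = 0"
      using i u by simp
    hence "2 * h = of_nat l" using i by (simp del: of_nat_Suc)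
    hence "h = of_nat l / 2" by (simp add: field_simps)
    moreover have "weight = of_nat l / 2"
      unfolding weight_def l_def using pos by (simp add: of_nat_diff)
    ultimately show ?thesis by (simp only:)
  qed
  have eig: "\<exists>k<m. c = weight - of_nat k \<and> (Q *\<^sub>v w) $ k \<noteq> 0" 
    and eig': "\<And>k. k < m \<Longrightarrow> (weight - of_nat k) * (Q *\<^sub>v w) $ k = c * (Q *\<^sub>v w) $ k" 
    if w: "w \<in> carrier_vec m" "w \<noteq> 0\<^sub>v m" "H *\<^sub>v w = c \<cdot>\<^sub>v w" for w c
  proof -
    \<comment> \<open>In chain coordinates an eigenvector can be nonzero only at those positions
      where the diagonal entry of \<open>D\<close> equals the eigenvalue.\<close>
    define D where "D = mat m m (\<lambda>(j, k). if j = k then h - of_nat k else 0)"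
    define x where "x = Q *\<^sub>v w"
    have x: "x \<in> carrier_vec m" "chain_mat u *\<^sub>v x = w" using Q w PQ unfolding x_def by auto
    have D: "D \<in> carrier_mat m m" by (simp add: D_def)
    have HP: "H * chain_mat u = chain_mat u * D"
    proof (rule chain_mat_mult[OF u(1) HEF_carrier(1) D])
      show "(H *\<^sub>v chain u k) $ i = (\<Sum>j<m. D $$ (j, k) * chain u j $ i)" if "k < m" "i < m" for k i
        unfolding H_chain[OF u(1,3)] D_def
        using that u by (simp add: if_distrib[of "\<lambda>z. z * _"] cong: if_cong)
    qed
    have "chain_mat u *\<^sub>v (D *\<^sub>v x) = chain_mat u *\<^sub>v (c \<cdot>\<^sub>v x)"
      using mult_chain_mat_vec[OF HEF_carrier(1) D HP x(1)] w x
      by (simp add: mult_mat_vec[OF chain_mat_carrier])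
    hence "Q *\<^sub>v (chain_mat u *\<^sub>v (D *\<^sub>v x)) = Q *\<^sub>v (chain_mat u *\<^sub>v (c \<cdot>\<^sub>v x))"
      by (simp only:)
    moreover have "D *\<^sub>v x \<in> carrier_vec m" "c \<cdot>\<^sub>v x \<in> carrier_vec m"
      using mult_mat_vec_carrier[OF D x(1)] x(1) by simp_all
    ultimately have Dx: "D *\<^sub>v x = c \<cdot>\<^sub>v x" by (simp only: QP)
    have comp: "(weight - of_nat k) * x $ k = c * x $ k" if k: "k < m" for k
    proof -
      have "(D *\<^sub>v x) $ k = (h - of_nat k) * x $ k"
        using k x by (simp add: D_def scalar_prod_def if_distrib[of "\<lambda>z. z * _"] cong: if_cong)
      moreover have "(D *\<^sub>v x) $ k = c * x $ k" unfolding Dx using x(1) k by simp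
      ultimately show ?thesis unfolding h by (simp only:)
    qed
    thus "\<And>k. k < m \<Longrightarrow> (weight - of_nat k) * (Q *\<^sub>v w) $ k = c * (Q *\<^sub>v w) $ k" by (simp add: x_def)
    have "x \<noteq> 0\<^sub>v m"
    proof
      assume "x = 0\<^sub>v m"
      hence "w = 0\<^sub>v m" unfolding x(2)[symmetric] by (intro eq_vecI) (auto simp: chain_mat_def)
      with w show False by simp
    qed
    then obtain k where k: "k < m" "x $ k \<noteq> 0"
      using x by (metis carrier_vecD eq_vecI index_zero_vec)
    thus "\<exists>k<m. c = weight - of_nat k \<and> (Q *\<^sub>v w) $ k \<noteq> 0"
      using comp[OF k(1)] unfolding x_def by auto
  qed
  show ?thesis
  proof (rule that[of u])
    show "H *\<^sub>v u = weight \<cdot>\<^sub>v u" using u h by simp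
    show "\<exists>k<m. c = weight - of_nat k" if "w \<in> carrier_vec m" "w \<noteq> 0\<^sub>v m" "H *\<^sub>v w = c \<cdot>\<^sub>v w" for w c
      using eig[OF that] by blast
    show "\<exists>c. w = c \<cdot>\<^sub>v u" if w: "w \<in> carrier_vec m" "H *\<^sub>v w = weight \<cdot>\<^sub>v w" for w
    proof (cases "w = 0\<^sub>v m")
      case True
      thus ?thesis using u by (intro exI[of _ 0]) (auto intro!: eq_vecI)
    next
      case False
      define x where "x = Q *\<^sub>v w"
      have x: "x \<in> carrier_vec m" "chain_mat u *\<^sub>v x = w" using Q w PQ unfolding x_def by auto
      have "x $ k = 0" if "k < m" "k \<noteq> 0" for k
        using eig'[OF w(1) False w(2) that(1)] that by (simp add: x_def algebra_simps)
      hence "x = (x $ 0) \<cdot>\<^sub>v unit_vec m 0"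
        using x by (intro eq_vecI) auto
      hence "w = (x $ 0) \<cdot>\<^sub>v (chain_mat u *\<^sub>v unit_vec m 0)"
        using x(2) mult_mat_vec[OF chain_mat_carrier, of "unit_vec m 0" u "x $ 0"] by simp
      thus ?thesis using chain_mat_unit[of 0 u] u pos by (auto simp: chain_simps)
    qed
    show "Cas = (- weight * (weight + 1)) \<cdot>\<^sub>m 1\<^sub>m m"
    proof (rule commuting_scalar[OF _ _ u(1,2)])
      have "Cas *\<^sub>v u = F *\<^sub>v (E *\<^sub>v u) - H *\<^sub>v u - H *\<^sub>v (H *\<^sub>v u)"
      proof -
        have FE: "F * E \<in> carrier_mat m m" and HH: "H * H \<in> carrier_mat m m"
          by (rule mult_carrier_mat[OF HEF_carrier(3,2)] mult_carrier_mat[OF HEF_carrier(1,1)])+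
        show ?thesis
          unfolding Cas_eq assoc_mult_mat_vec[OF HEF_carrier(3,2) u(1), symmetric]
            assoc_mult_mat_vec[OF HEF_carrier(1,1) u(1), symmetric]
            minus_mult_distrib_mat_vec[OF minus_carrier_mat[OF HEF_carrier(1)] HH u(1)]
            minus_mult_distrib_mat_vec[OF FE HEF_carrier(1) u(1)] ..
      qed
      also have "\<dots> = (- weight * (weight + 1)) \<cdot>\<^sub>v u"
        unfolding u(3,4) h using u mult_mat_vec[OF HEF_carrier(1) u(1)]
        by (intro eq_vecI) (auto simp: h algebra_simps)
      finally show "Cas *\<^sub>v u = (- weight * (weight + 1)) \<cdot>\<^sub>v u" .
    qed (simp_all add: Cas_commute)
  qed (use u in auto)
qed

end

section \<open>Intertwining triples\<close>

definition intertwiner ::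
  "nat \<Rightarrow> nat \<Rightarrow> (nat \<Rightarrow> complex mat) \<Rightarrow> (nat \<Rightarrow> complex mat) \<Rightarrow> (nat \<Rightarrow> complex mat) \<Rightarrow> bool" where
  "intertwiner p q Y' Y X \<longleftrightarrow> (\<forall>i<3. X i \<in> carrier_mat p q) \<and>
     (\<forall>j<3. \<forall>k<3. Y' j * X k - X k * Y j = lincomb3 (\<lambda>i. levi_civita i j k) X)"

lemma less_3: "i < (3::nat) \<longleftrightarrow> i = 0 \<or> i = 1 \<or> i = 2"
  by auto

lemma Op_lincomb3:
  assumes "\<And>i. i < 3 \<Longrightarrow> X i \<in> carrier_mat p q"
  shows "Op (lincomb3 c X) = c 0 \<star> Op (X 0) + c 1 \<star> Op (X 1) + c 2 \<star> Op (X 2)"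
  using assms[of 0, THEN carrier_matD(1)] assms[of 1, THEN carrier_matD(1)] assms[of 2, THEN carrier_matD(1)]
    assms[of 0, THEN carrier_matD(2)] assms[of 1, THEN carrier_matD(2)] assms[of 2, THEN carrier_matD(2)]
  unfolding lincomb3_def by (simp add: Op_add Op_smult del: One_nat_def)

lemma lincomb3_carrier:
  assumes "\<And>i. i < 3 \<Longrightarrow> X i \<in> carrier_mat p q"
  shows "lincomb3 c X \<in> carrier_mat p q"
  unfolding lincomb3_def using assms[of 2] by auto

lemma intertwines_iff:
  "intertwines y z x \<longleftrightarrow> (\<forall>j<3. \<forall>k<3. y j * x k - x k * z j =
     levi_civita 0 j k \<star> x 0 + levi_civita 1 j k \<star> x 1 + levi_civita 2 j k \<star> x 2)"
proof -
  have e: "(- 1) \<star> f = - f" for f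
    using scale_add(6)[of 1 f] by simp
  show ?thesis
    unfolding intertwines_def less_3
    by (simp add: all_conj_distrib conj_disj_distribR imp_disjL levi_civita_def e diff_eq_eq
        uminus_add_conv_diff add_ac cong: conj_cong del: One_nat_def) (simp add: e add_ac, blast)
qed

lemma intertwiner_intertwines:
  assumes "irrep p Y'" "irrep q Y" "\<And>i. i < 3 \<Longrightarrow> X i \<in> carrier_mat p q"
  shows "intertwiner p q Y' Y X \<longleftrightarrow> intertwines (\<lambda>i. Op (Y' i)) (\<lambda>i. Op (Y i)) (\<lambda>i. Op (X i))"
proof -
  interpret L: irrep p Y' by fact
  interpret R: irrep q Y by fact
  have d: "dim_row (X i) = p" "dim_col (X i) = q" if "i < 3" for i
    using assms(3)[OF that] by auto
  have "Y' j * X k - X k * Y j = lincomb3 (\<lambda>i. levi_civita i j k) X \<longleftrightarrow>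
      Op (Y' j * X k - X k * Y j) = Op (lincomb3 (\<lambda>i. levi_civita i j k) X)"
    if jk: "j < 3" "k < 3" for j k
  proof
    have l: "lincomb3 (\<lambda>i. levi_civita i j k) X \<in> carrier_mat p q" by (rule lincomb3_carrier) (rule assms)
    assume "Op (Y' j * X k - X k * Y j) = Op (lincomb3 (\<lambda>i. levi_civita i j k) X)"
    thus "Y' j * X k - X k * Y j = lincomb3 (\<lambda>i. levi_civita i j k) X"
      using jk d l by (intro Op_eqI) simp_all
  qed simp
  thus ?thesis
    unfolding intertwiner_def intertwines_iff
    using assms(3) d by (simp add: Op_lincomb3[OF assms(3)] Op_mult Op_diff del: One_nat_def)
qed

lemma intertwinerD:
  "intertwiner p q Y' Y X \<Longrightarrow> i < 3 \<Longrightarrow> X i \<in> carrier_mat p q"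
  by (simp add: intertwiner_def)

lemma mat_adjoint_lincomb3:
  assumes "\<And>i. i < 3 \<Longrightarrow> X i \<in> carrier_mat p q"
  shows "mat_adjoint (lincomb3 c X) = lincomb3 (\<lambda>i. cnj (c i)) (\<lambda>i. mat_adjoint (X i))"
  using assms[of 0, THEN carrier_matD(1)] assms[of 1, THEN carrier_matD(1)] assms[of 2, THEN carrier_matD(1)]
    assms[of 0, THEN carrier_matD(2)] assms[of 1, THEN carrier_matD(2)] assms[of 2, THEN carrier_matD(2)]
  unfolding lincomb3_def by (simp add: mat_adjoint_add mat_adjoint_smult del: One_nat_def)

text \<open>Adjoints reverse the products and change the sign of \<open>Y'\<close> and
  \<open>Y\<close>; in a difference of two products these effects cancel, and the coefficients on
  the right are real.\<close>

lemma intertwiner_adjoint: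
  assumes "irrep p Y'" "irrep q Y" "intertwiner p q Y' Y X"
  shows "intertwiner q p Y Y' (\<lambda>i. mat_adjoint (X i))"
  unfolding intertwiner_def
proof (intro conjI allI impI)
  interpret L: irrep p Y' by fact
  interpret R: irrep q Y by fact
  note c = intertwinerD[OF assms(3)]
  show "mat_adjoint (X i) \<in> carrier_mat q p" if "i < 3" for i using c[OF that] by simp
  fix j k :: nat assume jk: "j < 3" "k < 3"
  have d: "dim_row (X k) = p" "dim_col (X k) = q" using c[OF jk(2)] by auto
  have e: "cnj (levi_civita i j k) = levi_civita i j k" for i
    by (simp add: levi_civita_def)
  have "mat_adjoint (Y' j * X k - X k * Y j) = lincomb3 (\<lambda>i. levi_civita i j k) (\<lambda>i. mat_adjoint (X i))"
    using assms(3) jk mat_adjoint_lincomb3[OF c] unfolding intertwiner_def by (simp add: e)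
  also have "mat_adjoint (Y' j * X k - X k * Y j) = mat_adjoint (X k) * (- Y' j) - (- Y j) * mat_adjoint (X k)"
    using jk d by (simp add: mat_adjoint_diff mat_adjoint_mult L.adjoint R.adjoint)
  also have "\<dots> = Y j * mat_adjoint (X k) - mat_adjoint (X k) * Y' j"
    by (rule Op_eqI) (use jk d in \<open>simp_all add: Op_mult Op_diff Op_uminus\<close>)
  finally show "Y j * mat_adjoint (X k) - mat_adjoint (X k) * Y' j
    = lincomb3 (\<lambda>i. levi_civita i j k) (\<lambda>i. mat_adjoint (X i))" .
qed

text \<open>This is \<open>- s * (s + 1)\<close> for the spin \<open>s = (m - 1) / 2\<close>; it is
  not positive because the matrices of the representation are skew-adjoint.\<close>

definition casimir :: "nat \<Rightarrow> complex" where
  "casimir m = - ((of_nat m)\<^sup>2 - 1) / 4"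

lemma (in irrep) Op_Cas: "Op (Y 0) * Op (Y 0) + Op (Y 1) * Op (Y 1) + Op (Y 2) * Op (Y 2) = casimir m \<star> Op (1\<^sub>m m)"
proof -
  have "casimir m = - weight * (weight + 1)"
    by (simp add: casimir_def weight_def field_simps power2_eq_square)
  moreover have "Cas = (- weight * (weight + 1)) \<cdot>\<^sub>m 1\<^sub>m m" by (rule weights)
  ultimately have "Cas = casimir m \<cdot>\<^sub>m 1\<^sub>m m" by (simp only:)
  from arg_cong[OF this, of Op] show ?thesis by (simp add: Op_HEF Op_smult)
qed

section \<open>Triples between two irreducible representations\<close>

locale intertwined_irreps =
  fixes p q Y' Y X
  assumes L: "irrep p Y'" and R: "irrep q Y" and X: "intertwiner p q Y' Y X"
begin

sublocale L: irrep p Y' by (rule L)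
sublocale R: irrep q Y by (rule R)

abbreviation "y i \<equiv> Op (Y' i)"
abbreviation "z i \<equiv> Op (Y i)"
abbreviation "x i \<equiv> Op (X i)"

lemma X_carrier: "i < 3 \<Longrightarrow> X i \<in> carrier_mat p q"
  using X by (rule intertwinerD)

lemma X_dim [simp]: "i < 3 \<Longrightarrow> dim_row (X i) = p" "i < 3 \<Longrightarrow> dim_col (X i) = q"
  using X_carrier[of i] by auto

lemma yzx: "intertwines y z x"
  using X intertwiner_intertwines[OF L R X_carrier] by simp

lemma Cas_left: "i < 3 \<Longrightarrow> (y 0 * y 0 + y 1 * y 1 + y 2 * y 2) * x i = casimir p \<star> x i"
  unfolding L.Op_Cas by (simp add: Op_one_left)

lemma Cas_right: "i < 3 \<Longrightarrow> x i * (z 0 * z 0 + z 1 * z 1 + z 2 * z 2) = casimir q \<star> x i"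
  unfolding R.Op_Cas by (simp add: Op_one_right)

lemma curl_left:
  "y 1 * x 2 - y 2 * x 1 = (1 + (casimir q - casimir p) / 2) \<star> x 0"
  "y 2 * x 0 - y 0 * x 2 = (1 + (casimir q - casimir p) / 2) \<star> x 1"
  "y 0 * x 1 - y 1 * x 0 = (1 + (casimir q - casimir p) / 2) \<star> x 2"
  using left_curl[OF yzx Cas_left Cas_right] by simp_all

lemma curl_right:
  "x 1 * z 2 - x 2 * z 1 = (1 + (casimir p - casimir q) / 2) \<star> x 0"
  "x 2 * z 0 - x 0 * z 2 = (1 + (casimir p - casimir q) / 2) \<star> x 1"
  "x 0 * z 1 - x 1 * z 0 = (1 + (casimir p - casimir q) / 2) \<star> x 2"
  using right_curl[OF yzx Cas_left Cas_right] by simp_all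

lemma grad_div:
  fixes l defines "l \<equiv> 1 + (casimir q - casimir p) / 2"
  assumes "i < 3"
  shows "y i * (y 0 * x 0 + y 1 * x 1 + y 2 * x 2) = (casimir p + l * l - l) \<star> x i"
  unfolding l_def by (rule left_grad_div[OF yzx Cas_left Cas_right L.relations assms(2)])

abbreviation "d \<equiv> y 0 * x 0 + y 1 * x 1 + y 2 * x 2"

lemma d_intertwines: "i < 3 \<Longrightarrow> y i * d = d * z i"
  by (rule div_intertwines[OF L.relations R.relations yzx])

text \<open>The divergence intertwines the two representations, so the Casimir elements of both
  sides act on it alike, but their values differ for different dimensions.\<close>

lemma d_zero:
  assumes "p \<noteq> q"
  shows "d = 0"
proof -
  have "(y 0 * y 0 + y 1 * y 1 + y 2 * y 2) * d = d * (z 0 * z 0 + z 1 * z 1 + z 2 * z 2)"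
    using d_intertwines[of 0, THEN mult_left] d_intertwines[of 1, THEN mult_left] d_intertwines[of 2, THEN mult_left]
      d_intertwines[of 0] d_intertwines[of 1] d_intertwines[of 2]
    by (simp only: distrib_right[of _ _ d] distrib_left[of d] mult.assoc)
  moreover have "Op (1\<^sub>m p) * d = d"
    by (simp add: distrib_left mult.assoc[symmetric] Op_one_left)
  moreover have "d * Op (1\<^sub>m q) = d"
    by (simp add: distrib_right mult.assoc Op_one_right)
  ultimately have "(casimir p - casimir q) \<star> d = 0"
    unfolding L.Op_Cas R.Op_Cas by (simp add: scale_add(5))
  moreover have "casimir p - casimir q \<noteq> 0"
  proof
    assume "casimir p - casimir q = 0"
    hence "(of_nat p)\<^sup>2 = ((of_nat q)\<^sup>2 :: complex)" by (simp add: casimir_def)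
    hence "p\<^sup>2 = q\<^sup>2" by (metis of_nat_eq_iff of_nat_power)
    thus False using assms by simp
  qed
  ultimately show ?thesis by (rule scale_cancel)
qed

lemma zero_if_far:
  assumes "p \<noteq> q" "p \<noteq> q + 2" "q \<noteq> p + 2" "i < 3"
  shows "X i = 0\<^sub>m p q"
proof (rule Op_eq_0[OF X_carrier[OF assms(4)]], rule scale_cancel)
  define l where "l = 1 + (casimir q - casimir p) / 2"
  show "(casimir p + l * l - l) \<star> x i = 0"
    using grad_div[OF assms(4)] d_zero[OF assms(1)] unfolding l_def by simp
  \<comment> \<open>The product is \<open>((p - q)^2 - 4) * ((p + q)^2 - 4)\<close>; the first
    factor vanishes only for neighbours at distance 2, the second only for \<open>p = q = 1\<close>.
    It is written over the integers to avoid truncated subtraction.\<close>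
  have "casimir p + l * l - l = (of_int ((int p - 2 - int q) * (int p - 2 + int q) * (int p + 2 - int q) * (int p + 2 + int q))) / 64"
    unfolding l_def casimir_def by (simp add: field_simps power2_eq_square)
  moreover have "(int p - 2 - int q) * (int p - 2 + int q) * (int p + 2 - int q) * (int p + 2 + int q) \<noteq> 0"
    using assms L.pos R.pos by auto
  ultimately show "casimir p + l * l - l \<noteq> 0"
    by (metis divide_eq_0_iff of_int_eq_0_iff zero_neq_numeral)
qed

text \<open>The spherical components of a vector operator, of weights 0, 1 and -1.\<close>

lemma H_weights:
  "L.H * X 2 = X 2 * R.H"
  "L.H * (X 0 + \<i> \<cdot>\<^sub>m X 1) = (X 0 + \<i> \<cdot>\<^sub>m X 1) * R.H + (X 0 + \<i> \<cdot>\<^sub>m X 1)"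
  "L.H * (X 0 - \<i> \<cdot>\<^sub>m X 1) = (X 0 - \<i> \<cdot>\<^sub>m X 1) * R.H - (X 0 - \<i> \<cdot>\<^sub>m X 1)"
  by (rule Op_eqI; simp add: Op_mult Op_add Op_diff Op_smult L.Op_HEF R.Op_HEF yx_rules[OF yzx] L.op_distrib
      add_ac del: One_nat_def)+

text \<open>The top weight of the source exceeds that of the target by one. Hence the components
  that keep or raise the weight kill \<open>w\<close>, and the lowering component maps it to the
  line of top weight vectors of the target: one number describes the whole triple on
  \<open>w\<close>.\<close>

lemma top_vector_image:
  assumes qp: "q = p + 2"
    and u: "\<And>v. v \<in> carrier_vec p \<Longrightarrow> L.H *\<^sub>v v = L.weight \<cdot>\<^sub>v v \<Longrightarrow> \<exists>c. v = c \<cdot>\<^sub>v u"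
    and spec: "\<And>v c. v \<in> carrier_vec p \<Longrightarrow> v \<noteq> 0\<^sub>v p \<Longrightarrow> L.H *\<^sub>v v = c \<cdot>\<^sub>v v \<Longrightarrow> \<exists>k<p. c = L.weight - of_nat k"
    and w: "w \<in> carrier_vec q" "R.H *\<^sub>v w = R.weight \<cdot>\<^sub>v w"
  obtains c where "X 0 *\<^sub>v w = c \<cdot>\<^sub>v u" "X 1 *\<^sub>v w = (\<i> * c) \<cdot>\<^sub>v u" "X 2 *\<^sub>v w = 0\<^sub>v p"
proof -
  have Rw: "R.weight = L.weight + 1" unfolding L.weight_def R.weight_def unfolding qp by (simp add: field_simps)
  have C: "X 0 \<in> carrier_mat p q" "X 1 \<in> carrier_mat p q" "X 2 \<in> carrier_mat p q" by (rule X_carrier, simp)+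
  define P where "P = X 0 + \<i> \<cdot>\<^sub>m X 1"
  define M where "M = X 0 - \<i> \<cdot>\<^sub>m X 1"
  have PM: "P \<in> carrier_mat p q" "M \<in> carrier_mat p q" unfolding P_def M_def
    by (rule add_carrier_mat[OF smult_carrier_mat[OF C(2)]] minus_carrier_mat[OF smult_carrier_mat[OF C(2)]])+
  have mv: "L.H *\<^sub>v (A *\<^sub>v w) = (L.H * A) *\<^sub>v w" "(A * R.H) *\<^sub>v w = A *\<^sub>v (R.H *\<^sub>v w)"
    "A *\<^sub>v (R.weight \<cdot>\<^sub>v w) = R.weight \<cdot>\<^sub>v (A *\<^sub>v w)" if A: "A \<in> carrier_mat p q" for A
    by (rule assoc_mult_mat_vec[OF L.HEF_carrier(1) A w(1), symmetric])
       (rule assoc_mult_mat_vec[OF A R.HEF_carrier(1) w(1)], rule mult_mat_vec[OF A w(1)])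
  \<comment> \<open>There is no weight of the target above its top weight.\<close>
  have big: "v = 0\<^sub>v p" if "v \<in> carrier_vec p" "L.H *\<^sub>v v = (L.weight + of_nat (Suc j)) \<cdot>\<^sub>v v" for v j
  proof (rule ccontr)
    assume "v \<noteq> 0\<^sub>v p"
    with spec that obtain k where "L.weight + of_nat (Suc j) = L.weight - of_nat k" by blast
    hence "of_nat (Suc j + k) = (0 :: complex)" by (simp add: algebra_simps)
    thus False by (simp only: of_nat_eq_0_iff)
  qed
  have "L.H *\<^sub>v (X 2 *\<^sub>v w) = (L.weight + of_nat (Suc 0)) \<cdot>\<^sub>v (X 2 *\<^sub>v w)"
    unfolding mv(1)[OF C(3)] H_weights(1) mv(2)[OF C(3)] w(2) mv(3)[OF C(3)] unfolding Rw by simp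
  hence X2: "X 2 *\<^sub>v w = 0\<^sub>v p"
    by (rule big[OF mult_mat_vec_carrier[OF C(3) w(1)]])
  have PR: "P * R.H \<in> carrier_mat p q" "M * R.H \<in> carrier_mat p q" by (rule mult_carrier_mat[OF PM(1) R.HEF_carrier(1)] mult_carrier_mat[OF PM(2) R.HEF_carrier(1)])+
  have "L.H *\<^sub>v (P *\<^sub>v w) = R.weight \<cdot>\<^sub>v (P *\<^sub>v w) + P *\<^sub>v w"
    unfolding mv(1)[OF PM(1)] H_weights(2)[folded P_def] add_mult_distrib_mat_vec[OF PR(1) PM(1) w(1)]
      mv(2)[OF PM(1)] w(2) mv(3)[OF PM(1)] ..
  also have "\<dots> = (L.weight + of_nat (Suc 1)) \<cdot>\<^sub>v (P *\<^sub>v w)"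
    unfolding Rw using PM by (intro eq_vecI) (auto simp: algebra_simps)
  finally have P0: "P *\<^sub>v w = 0\<^sub>v p"
    by (rule big[OF mult_mat_vec_carrier[OF PM(1) w(1)]])
  have "L.H *\<^sub>v (M *\<^sub>v w) = R.weight \<cdot>\<^sub>v (M *\<^sub>v w) - M *\<^sub>v w"
    unfolding mv(1)[OF PM(2)] H_weights(3)[folded M_def] minus_mult_distrib_mat_vec[OF PR(2) PM(2) w(1)]
      mv(2)[OF PM(2)] w(2) mv(3)[OF PM(2)] ..
  also have "\<dots> = L.weight \<cdot>\<^sub>v (M *\<^sub>v w)"
    unfolding Rw using PM by (intro eq_vecI) (auto simp: algebra_simps)
  finally obtain c where c: "M *\<^sub>v w = c \<cdot>\<^sub>v u"
    using u[OF mult_mat_vec_carrier[OF PM(2) w(1)]] by blast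
  have iX: "\<i> \<cdot>\<^sub>m X 1 \<in> carrier_mat p q" by (rule smult_carrier_mat[OF C(2)])
  have i1: "(\<i> \<cdot>\<^sub>m X 1) *\<^sub>v w = \<i> \<cdot>\<^sub>v (X 1 *\<^sub>v w)"
    using C(2) w(1) by (intro eq_vecI) (auto simp: scalar_prod_def sum_distrib_left mult.assoc)
  have pm: "P *\<^sub>v w = X 0 *\<^sub>v w + \<i> \<cdot>\<^sub>v (X 1 *\<^sub>v w)" "M *\<^sub>v w = X 0 *\<^sub>v w - \<i> \<cdot>\<^sub>v (X 1 *\<^sub>v w)"
    unfolding P_def M_def add_mult_distrib_mat_vec[OF C(1) iX w(1)] minus_mult_distrib_mat_vec[OF C(1) iX w(1)] i1
    by simp_all
  have du: "p = dim_vec u" using arg_cong[OF c, of dim_vec] PM(2) by simp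
  have e: "(X 0 *\<^sub>v w) $ i + \<i> * (X 1 *\<^sub>v w) $ i = 0"
     "(X 0 *\<^sub>v w) $ i - \<i> * (X 1 *\<^sub>v w) $ i = c * u $ i" if i: "i < p" for i
    using arg_cong[OF P0[unfolded pm], of "\<lambda>v. v $ i"] arg_cong[OF c[unfolded pm], of "\<lambda>v. v $ i"] i C(1,2) du
    by (simp_all del: index_mult_mat_vec)
  \<comment> \<open>\<open>X 0\<close> is half the sum of the raising component \<open>P\<close> and
    the lowering component \<open>M\<close>, and \<open>P\<close> kills \<open>w\<close>; this is
    the origin of the witness \<open>c / 2\<close>.\<close>
  have e0: "(X 0 *\<^sub>v w) $ i = (c / 2) * u $ i" if i: "i < p" for i
    using e[OF i] by (simp add: algebra_simps eq_neg_iff_add_eq_0 del: index_mult_mat_vec) 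
  have e1: "(X 1 *\<^sub>v w) $ i = (\<i> * (c / 2)) * u $ i" if i: "i < p" for i
  proof -
    have "(X 1 *\<^sub>v w) $ i = \<i> * (- (\<i> * (X 1 *\<^sub>v w) $ i))" by (simp del: index_mult_mat_vec)
    also have "- (\<i> * (X 1 *\<^sub>v w) $ i) = (c / 2) * u $ i"
      using e(1)[OF i] e0[OF i] by (simp add: add_eq_0_iff del: index_mult_mat_vec)
    finally show ?thesis by (simp del: index_mult_mat_vec)
  qed
  show ?thesis
    by (rule that[of "c / 2", OF _ _ X2]; rule eq_vecI)
       (use du C(1,2) e0 e1 in \<open>simp_all del: index_mult_mat_vec\<close>)
qed

text \<open>Moving \<open>Y j\<close> through a member of the triple leaves only members of the
  triple next to the vector, so the joint kernel is invariant.\<close>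

lemma kills_zero:
  assumes w: "w \<in> carrier_vec q" "w \<noteq> 0\<^sub>v q" and z: "\<And>k. k < 3 \<Longrightarrow> X k *\<^sub>v w = 0\<^sub>v p" and i: "i < 3"
  shows "X i = 0\<^sub>m p q"
proof (rule R.common_kernel_zero[where I = "{..<3}" and K = X])
  fix a j v assume a: "a \<in> {..<3::nat}" and j: "j < (3::nat)" and v: "v \<in> carrier_vec q"
    and z: "\<And>b. b \<in> {..<3} \<Longrightarrow> X b *\<^sub>v v = 0\<^sub>v p"
  have a3: "a < 3" using a by simp
  have z': "X 0 *\<^sub>v v = 0\<^sub>v p" "X 1 *\<^sub>v v = 0\<^sub>v p" "X 2 *\<^sub>v v = 0\<^sub>v p" using z by auto
  have lc: "lincomb3 c X \<in> carrier_mat p q" for c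
    by (rule lincomb3_carrier) (rule X_carrier)
  have dl: "dim_row (lincomb3 c X) = p" "dim_col (lincomb3 c X) = q" for c
    using lc[of c] by auto
  have eq: "X a * Y j = Y' j * X a - lincomb3 (\<lambda>i. levi_civita i j a) X"
  proof (rule Op_eqI)
    have "Op (Y' j * X a - X a * Y j) = Op (lincomb3 (\<lambda>i. levi_civita i j a) X)"
      using X j a3 unfolding intertwiner_def by simp
    thus "Op (X a * Y j) = Op (Y' j * X a - lincomb3 (\<lambda>i. levi_civita i j a) X)"
      using j a3 dl by (simp add: Op_mult Op_diff algebra_simps)
  qed (use j a3 dl in auto)
  have C: "X 0 \<in> carrier_mat p q" "X 1 \<in> carrier_mat p q" "X 2 \<in> carrier_mat p q" by (rule X_carrier, simp)+
  have sm: "(c \<cdot>\<^sub>m A) *\<^sub>v v = c \<cdot>\<^sub>v (A *\<^sub>v v)" if "A \<in> carrier_mat p q" for c A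
    using that v by (intro eq_vecI) (auto simp: scalar_prod_def sum_distrib_left mult.assoc)
  have "lincomb3 (\<lambda>i. levi_civita i j a) X *\<^sub>v v = 0\<^sub>v p"
    unfolding lincomb3_def
      add_mult_distrib_mat_vec[OF add_carrier_mat[OF smult_carrier_mat[OF C(2)]] smult_carrier_mat[OF C(3)] v]
      add_mult_distrib_mat_vec[OF smult_carrier_mat[OF C(1)] smult_carrier_mat[OF C(2)] v] sm[OF C(1)] sm[OF C(2)] sm[OF C(3)] z'
    by (intro eq_vecI) auto
  moreover have "(Y' j * X a) *\<^sub>v v = 0\<^sub>v p"
    unfolding assoc_mult_mat_vec[OF L.carrier[OF j] X_carrier[OF a3] v] z[OF a]
    using L.carrier[OF j] by (intro eq_vecI) auto
  ultimately have "(X a * Y j) *\<^sub>v v = 0\<^sub>v p"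
    unfolding eq minus_mult_distrib_mat_vec[OF mult_carrier_mat[OF L.carrier[OF j] X_carrier[OF a3]]
      lc v] by auto
  thus "X a *\<^sub>v (Y j *\<^sub>v v) = 0\<^sub>v p"
    unfolding assoc_mult_mat_vec[OF X_carrier[OF a3] R.carrier[OF j] v] .
qed (use w z i X_carrier in auto)

end

text \<open>A multiple of \<open>C\<close> agrees with \<open>X\<close> on the top weight vector
  \<open>w\<close>; the difference is an intertwining triple that kills \<open>w\<close> and hence
  vanishes.\<close>

lemma intertwiner_unique:
  assumes "irrep p Y'" "irrep q Y" "q = p + 2" "intertwiner p q Y' Y X" "intertwiner p q Y' Y C"
    and nz: "i0 < 3" "C i0 \<noteq> 0\<^sub>m p q"
  obtains t where "\<And>i. i < 3 \<Longrightarrow> X i = t \<cdot>\<^sub>m C i"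
proof -
  interpret X: intertwined_irreps p q Y' Y X by (rule intertwined_irreps.intro; fact)
  interpret C: intertwined_irreps p q Y' Y C by (rule intertwined_irreps.intro; fact)
  obtain u where u: "\<And>v. v \<in> carrier_vec p \<Longrightarrow> X.L.H *\<^sub>v v = X.L.weight \<cdot>\<^sub>v v \<Longrightarrow> \<exists>c. v = c \<cdot>\<^sub>v u"
    and spec: "\<And>v c. v \<in> carrier_vec p \<Longrightarrow> v \<noteq> 0\<^sub>v p \<Longrightarrow> X.L.H *\<^sub>v v = c \<cdot>\<^sub>v v \<Longrightarrow> \<exists>k<p. c = X.L.weight - of_nat k"
    by (rule X.L.weights) blast
  obtain w where w: "w \<in> carrier_vec q" "w \<noteq> 0\<^sub>v q" "X.R.H *\<^sub>v w = X.R.weight \<cdot>\<^sub>v w"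
    by (rule X.R.weights) blast
  obtain a where a: "X 0 *\<^sub>v w = a \<cdot>\<^sub>v u" "X 1 *\<^sub>v w = (\<i> * a) \<cdot>\<^sub>v u" "X 2 *\<^sub>v w = 0\<^sub>v p"
    by (rule X.top_vector_image[OF assms(3) u spec w(1,3)])
  obtain c where c: "C 0 *\<^sub>v w = c \<cdot>\<^sub>v u" "C 1 *\<^sub>v w = (\<i> * c) \<cdot>\<^sub>v u" "C 2 *\<^sub>v w = 0\<^sub>v p"
    by (rule C.top_vector_image[OF assms(3) u spec w(1,3)])
  have du: "dim_vec u = p" using arg_cong[OF a(1), of dim_vec] by simp
  \<comment> \<open>Otherwise \<open>C\<close> itself would kill \<open>w\<close> and be
    zero.\<close>
  have "c \<noteq> 0"
  proof
    assume "c = 0"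
    hence "C k *\<^sub>v w = 0\<^sub>v p" if "k < 3" for k
      using that c du unfolding less_3 by (auto simp del: One_nat_def intro!: eq_vecI)
    from C.kills_zero[OF w(1,2) this nz(1)] nz(2) show False by simp
  qed
  define t where "t = a / c"
  define K where "K i = X i - t \<cdot>\<^sub>m C i" for i
  have Kc: "K i \<in> carrier_mat p q" if "i < 3" for i
    unfolding K_def using that by (intro carrier_matI) auto
  have omK: "Op (K i) = Op (X i) - t \<star> Op (C i)" if "i < 3" for i
    unfolding K_def using that by (simp add: Op_diff Op_smult)
  have "intertwines (\<lambda>i. Op (Y' i)) (\<lambda>i. Op (Y i)) (\<lambda>i. Op (K i))"
    unfolding intertwines_def
    by (simp add: omK left_diff_distrib right_diff_distrib yx_rules[OF X.yzx] yx_rules[OF C.yzx]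
        scale_add del: One_nat_def)
  hence K: "intertwiner p q Y' Y K" using intertwiner_intertwines[OF assms(1,2) Kc] by simp
  interpret K: intertwined_irreps p q Y' Y K by (rule intertwined_irreps.intro; fact)
  have Kw: "K k *\<^sub>v w = X k *\<^sub>v w - t \<cdot>\<^sub>v (C k *\<^sub>v w)" if k: "k < 3" for k
  proof -
    have "(t \<cdot>\<^sub>m C k) *\<^sub>v w = t \<cdot>\<^sub>v (C k *\<^sub>v w)"
      using k w(1) by (intro eq_vecI) (auto simp: scalar_prod_def sum_distrib_left mult.assoc)
    thus ?thesis unfolding K_def
      using minus_mult_distrib_mat_vec[OF X.X_carrier[OF k] smult_carrier_mat[OF C.X_carrier[OF k]] w(1)] by simp
  qed
  have "K k *\<^sub>v w = 0\<^sub>v p" if k: "k < 3" for k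
    using k unfolding Kw[OF k] unfolding less_3 t_def
    by (elim disjE; simp only: a c; intro eq_vecI) (use \<open>c \<noteq> 0\<close> du in auto)
  from K.kills_zero[OF w(1,2) this] have K0: "K i = 0\<^sub>m p q" if "i < 3" for i using that by blast
  have "X i = t \<cdot>\<^sub>m C i" if "i < 3" for i
  proof (rule Op_eqI)
    show "Op (X i) = Op (t \<cdot>\<^sub>m C i)" using omK[OF that] K0[OF that] by (simp add: Op_zero Op_smult)
  qed (use that in auto)
  thus ?thesis using that by blast
qed

section \<open>Proportionality to the generators and cross products of the normalized triple\<close>

lemma cross_scale: "cross (\<lambda>i. c \<star> b i) (\<lambda>i. d \<star> b' i) j = (c * d) \<star> cross b b' j"
  by (simp add: cross_def scale_add mult.commute)

lemma mult_cross_left: "(\<And>i. i < 3 \<Longrightarrow> e * b i = b i) \<Longrightarrow> e * cross b b' i = cross b b' i"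
  by (simp add: cross_def right_diff_distrib mult.assoc[symmetric])

lemma mult_cross_right: "(\<And>i. i < 3 \<Longrightarrow> b' i * e = b' i) \<Longrightarrow> cross b b' i * e = cross b b' i"
  by (simp add: cross_def left_diff_distrib mult.assoc)

lemma (in irrep) cross_self: "i < 3 \<Longrightarrow> cross (\<lambda>i. Op (Y i)) (\<lambda>i. Op (Y i)) i = Op (Y i)"
  using relations unfolding so3_relations_def less_3 cross_def by (auto simp del: One_nat_def)

text \<open>With equal Casimir values the curl eigenvalue is 1, so \<open>l * l - l\<close> drops
  out of the gradient-divergence identity and the factor is the Casimir value itself. It is not
  divided by, since it is zero for \<open>m = 1\<close>.\<close>

lemma (in irrep) scaled_if_div_scalar:
  assumes x: "intertwines (\<lambda>i. Op (Y i)) (\<lambda>i. Op (Y i)) x"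
    and one: "\<And>i. i < 3 \<Longrightarrow> Op (1\<^sub>m m) * x i = x i" "\<And>i. i < 3 \<Longrightarrow> x i * Op (1\<^sub>m m) = x i"
    and div: "Op (Y 0) * x 0 + Op (Y 1) * x 1 + Op (Y 2) * x 2 = l \<star> Op (1\<^sub>m m)"
    and i: "i < 3"
  shows "casimir m \<star> x i = l \<star> Op (Y i)"
proof -
  have "Op (Y i) * (Op (Y 0) * x 0 + Op (Y 1) * x 1 + Op (Y 2) * x 2) =
     (casimir m + (1 + (casimir m - casimir m) / 2) * (1 + (casimir m - casimir m) / 2) - (1 + (casimir m - casimir m) / 2)) \<star> x i"
    by (rule left_grad_div[OF x _ _ relations i]; unfold Op_Cas; simp add: one)
  thus ?thesis unfolding div using i by (simp add: Op_one_right)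
qed

lemma (in irrep) Y_eq_0:
  assumes "m = 1" "i < 3"
  shows "Y i = 0\<^sub>m 1 1"
proof -
  have comm: "Op A * Op B = Op B * Op A" if "A \<in> carrier_mat 1 1" "B \<in> carrier_mat 1 1" for A B
  proof -
    have "A * B = B * A" using that by (intro eq_matI) (auto simp: scalar_prod_def mult.commute)
    thus ?thesis using that Op_mult[of A B] Op_mult[of B A] by auto
  qed
  have c: "Op (Y a) * Op (Y b) - Op (Y b) * Op (Y a) = 0" if "a < 3" "b < 3" for a b
    using comm carrier that assms(1) by simp
  have "Op (Y i) = 0"
    using relations c[of 0 1] c[of 1 2] c[of 2 0] assms(2) unfolding so3_relations_def less_3 
    by (auto simp del: One_nat_def)
  thus ?thesis using Op_eq_0[OF carrier[OF assms(2)]] assms(1) by simp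
qed

lemma casimir_nonzero: "m \<ge> 2 \<Longrightarrow> casimir m \<noteq> 0"
proof
  assume "m \<ge> 2" "casimir m = 0"
  hence "(of_nat m)\<^sup>2 = (1 :: complex)" by (simp add: casimir_def)
  hence "m\<^sup>2 = 1" by (metis of_nat_1 of_nat_eq_iff of_nat_power)
  thus False using \<open>m \<ge> 2\<close> by (simp add: power2_eq_square)
qed

text \<open>For \<open>m = 1\<close> the Casimir value cannot be cancelled, but there the generators
  vanish and the intertwining relations express each \<open>X i\<close> by zero.\<close>

lemma intertwiner_scalar:
  assumes Y: "irrep m Y" and X: "intertwiner m m Y Y X"
  obtains f where "\<And>i. i < 3 \<Longrightarrow> X i = f \<cdot>\<^sub>m Y i"
proof -
  interpret intertwined_irreps m m Y Y X using Y Y X by (rule intertwined_irreps.intro)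
  show ?thesis
  proof (cases "m = 1")
    case True
    have z: "Op (Y i) = 0" if "i < 3" for i
      using L.Y_eq_0[OF True that] by (simp add: Op_zero)
    have "X i = 0 \<cdot>\<^sub>m Y i" if "i < 3" for i
      using yx_rules(4,5,7)[OF yzx] that unfolding less_3
      by (intro Op_eqI) (auto simp: z Op_smult simp del: One_nat_def)
    thus ?thesis using that by blast
  next
    case False
    define D where "D = Y 0 * X 0 + Y 1 * X 1 + Y 2 * X 2"
    have D: "D \<in> carrier_mat m m" unfolding D_def by (rule carrier_matI) auto
    have omD: "Op D = Op (Y 0) * Op (X 0) + Op (Y 1) * Op (X 1) + Op (Y 2) * Op (X 2)"
      unfolding D_def by (simp add: Op_add Op_mult del: One_nat_def)
    obtain l where l: "D = l \<cdot>\<^sub>m 1\<^sub>m m"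
    proof (rule L.schur[OF D])
      show "D * Y j = Y j * D" if "j < 3" for j
        using d_intertwines[OF that] D that by (intro Op_eqI) (simp_all add: Op_mult omD)
    qed
    have "casimir m \<star> Op (X i) = l \<star> Op (Y i)" if "i < 3" for i
      by (rule L.scaled_if_div_scalar[OF yzx _ _ _ that])
         (simp_all add: Op_one_left Op_one_right omD[symmetric] l Op_smult del: One_nat_def)
    hence "(1 / casimir m) \<star> casimir m \<star> Op (X i) = (1 / casimir m) \<star> l \<star> Op (Y i)" if "i < 3" for i
      using that by simp
    hence "X i = (l / casimir m) \<cdot>\<^sub>m Y i" if "i < 3" for i
      using that casimir_nonzero[of m] False L.pos by (intro Op_eqI) (simp_all add: Op_smult)
    thus ?thesis using that by blast
  qed
qed

locale normalized_intertwiner =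
  fixes q Y' Y B
  assumes L: "irrep (q + 2) Y'" and R: "irrep q Y" and B: "intertwiner (q + 2) q Y' Y B"
    and normalized: "lincomb3 (\<lambda>_. 1) (\<lambda>i. B i * mat_adjoint (B i)) = 1\<^sub>m (q + 2)"
begin

sublocale up: intertwined_irreps "q + 2" q Y' Y B
  using L R B by (rule intertwined_irreps.intro)

sublocale down: intertwined_irreps q "q + 2" Y Y' "\<lambda>i. mat_adjoint (B i)"
  using R L intertwiner_adjoint[OF L R B] by (rule intertwined_irreps.intro)

abbreviation "y i \<equiv> Op (Y' i)"
abbreviation "z i \<equiv> Op (Y i)"
abbreviation "b i \<equiv> Op (B i)"
abbreviation "b' i \<equiv> Op (mat_adjoint (B i))"

text \<open>The curl eigenvalues for \<open>b\<close> and for its adjoint. They reappear as the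
  coefficients of the two diagonal functions in the equation for the off-diagonal one.\<close>

lemma casimir_diff: "1 + (casimir q - casimir (q + 2)) / 2 = (of_nat q + 3) / 2"
  "1 + (casimir (q + 2) - casimir q) / 2 = (1 - of_nat q) / 2"
  by (simp_all add: casimir_def field_simps power2_eq_square)

lemma cross_yb: "i < 3 \<Longrightarrow> cross y b i = ((of_nat q + 3) / 2) \<star> b i"
  using up.curl_left unfolding casimir_diff less_3 by (auto simp: cross_def simp del: One_nat_def)

lemma cross_bz: "i < 3 \<Longrightarrow> cross b z i = ((1 - of_nat q) / 2) \<star> b i"
  using up.curl_right unfolding casimir_diff less_3 by (auto simp: cross_def simp del: One_nat_def)

lemma Op_normalized: "b 0 * b' 0 + b 1 * b' 1 + b 2 * b' 2 = Op (1\<^sub>m (q + 2))"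
proof -
  have "Op (lincomb3 (\<lambda>_. 1) (\<lambda>i. B i * mat_adjoint (B i))) = b 0 * b' 0 + b 1 * b' 1 + b 2 * b' 2"
    by (subst Op_lincomb3[of _ "q + 2" "q + 2"])
      (auto simp: Op_mult simp del: One_nat_def intro!: mult_carrier_mat[OF up.X_carrier down.X_carrier])
  thus ?thesis unfolding normalized by simp
qed

lemma div_cross_b: "y 0 * cross b b' 0 + y 1 * cross b b' 1 + y 2 * cross b b' 2 =
    ((of_nat q + 3) / 2) \<star> Op (1\<^sub>m (q + 2))"
  unfolding Op_normalized[symmetric] by (rule div_cross; fold casimir_diff; rule up.curl_left)

text \<open>This cross product is an intertwining triple of the larger representation with scalar
  divergence. The constant is the curl eigenvalue \<open>(q + 3) / 2\<close> divided by the Casimir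
  value \<open>- (q + 1) * (q + 3) / 4\<close>.\<close>

lemma cross_bb': 
  assumes "i < 3"
  shows "cross b b' i = (- 2 / (of_nat q + 1)) \<star> y i"
proof -
  have "casimir (q + 2) \<star> cross b b' i = ((of_nat q + 3) / 2) \<star> y i"
    by (rule up.L.scaled_if_div_scalar[OF cross_intertwines[OF up.yzx down.yzx] _ _ div_cross_b assms])
      (auto simp: Op_one_left Op_one_right intro!: mult_cross_left mult_cross_right)
  hence "(1 / casimir (q + 2)) \<star> casimir (q + 2) \<star> cross b b' i = (1 / casimir (q + 2)) \<star> ((of_nat q + 3) / 2) \<star> y i"
    by simp
  moreover have "1 / casimir (q + 2) * ((of_nat q + 3) / 2) = - 2 / (of_nat q + 1)"
  proof -
    have c: "casimir (q + 2) = - ((of_nat q + 1) * (of_nat q + 3)) / 4"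
      by (simp add: casimir_def field_simps power2_eq_square)
    have "(of_nat q + 1 :: complex) \<noteq> 0" "(of_nat q + 3 :: complex) \<noteq> 0"
      by (metis of_nat_eq_0_iff of_nat_Suc add.commute nat.simps(3))
        (metis of_nat_eq_0_iff of_nat_add of_nat_numeral add_eq_0_iff_both_eq_0 zero_neq_numeral)
    moreover have "1 / (- (a * b) / 4) * (b / 2) = - 2 / a" if "a \<noteq> 0" "b \<noteq> 0" for a b :: complex
      using that by (simp add: field_simps)
    ultimately show ?thesis unfolding c by blast
  qed
  ultimately show ?thesis using casimir_nonzero[of "q + 2"] by simp
qed

text \<open>By Schur's lemma the sum is a scalar. Its trace equals that of the sum of the products
  in the opposite order, which is \<open>q + 2\<close> by the normalization, and the identity of
  size \<open>q\<close> has trace \<open>q\<close>.\<close>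

lemma B_adjoint_B: "b' 0 * b 0 + b' 1 * b 1 + b' 2 * b 2 = ((of_nat q + 2) / of_nat q) \<star> Op (1\<^sub>m q)"
proof -
  define D where "D = mat_adjoint (B 0) * B 0 + mat_adjoint (B 1) * B 1 + mat_adjoint (B 2) * B 2"
  have D: "D \<in> carrier_mat q q" unfolding D_def by (rule carrier_matI) auto
  have omD: "Op D = b' 0 * b 0 + b' 1 * b 1 + b' 2 * b 2"
    unfolding D_def by (simp add: Op_add Op_mult del: One_nat_def)
  obtain l where l: "D = l \<cdot>\<^sub>m 1\<^sub>m q"
  proof (rule up.R.schur[OF D])
    show "D * Y j = Y j * D" if "j < 3" for j
      using dot_intertwines[OF down.yzx up.yzx that] D that by (intro Op_eqI) (simp_all add: Op_mult omD)
  qed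
  define S where "S a = (\<Sum>i<q. \<Sum>r<q + 2. cnj (B a $$ (r, i)) * B a $$ (r, i))" for a
  have 1: "(mat_adjoint (B a) * B a) $$ (i, i) = (\<Sum>r<q + 2. cnj (B a $$ (r, i)) * B a $$ (r, i))"
    if "a < 3" "i < q" for a i
    using that by (simp add: scalar_prod_def lessThan_atLeast0)
  have 2: "(B a * mat_adjoint (B a)) $$ (r, r) = (\<Sum>i<q. cnj (B a $$ (r, i)) * B a $$ (r, i))"
    if "a < 3" "r < q + 2" for a r
    using that by (simp add: scalar_prod_def lessThan_atLeast0 mult.commute)
  have "of_nat q * l = (\<Sum>i<q. D $$ (i, i))" unfolding l by simp
  also have "\<dots> = (\<Sum>i<q. (mat_adjoint (B 0) * B 0) $$ (i, i) + (mat_adjoint (B 1) * B 1) $$ (i, i) + (mat_adjoint (B 2) * B 2) $$ (i, i))"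
    unfolding D_def by (rule sum.cong) (simp_all del: index_mult_mat(1))
  also have "\<dots> = S 0 + S 1 + S 2"
    unfolding S_def by (simp add: 1 sum.distrib del: index_mult_mat(1) One_nat_def)
  also have "\<dots> = (\<Sum>r<q + 2. (B 0 * mat_adjoint (B 0)) $$ (r, r) + (B 1 * mat_adjoint (B 1)) $$ (r, r) + (B 2 * mat_adjoint (B 2)) $$ (r, r))"
    unfolding S_def sum.swap[of _ "{..<q + 2}" "{..<q}"]
    by (simp add: 2 sum.distrib del: index_mult_mat(1) One_nat_def sum.lessThan_Suc)
  also have "\<dots> = (\<Sum>r<q + 2. lincomb3 (\<lambda>_. 1) (\<lambda>i. B i * mat_adjoint (B i)) $$ (r, r))"
    by (rule sum.cong) (simp_all add: lincomb3_def del: index_mult_mat(1))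
  also have "\<dots> = of_nat q + 2" unfolding normalized by (simp del: sum.lessThan_Suc)
  finally have "l = (of_nat q + 2) / of_nat q" using up.R.pos by (simp add: field_simps)
  thus ?thesis unfolding omD[symmetric] l by (simp add: Op_smult)
qed

text \<open>The divergence is \<open>(1 - q) / 2\<close> times the scalar of
  \<open>B_adjoint_B\<close>, and the Casimir value is \<open>(1 - q) * (q + 1) / 4\<close>. The
  common factor \<open>1 - q\<close> can be cancelled only for \<open>q \<ge> 2\<close>.\<close>

lemma cross_b'b: 
  assumes "i < 3" "q \<ge> 2"
  shows "cross b' b i = (2 * (of_nat q + 2) / (of_nat q * (of_nat q + 1))) \<star> z i"
proof -
  have d: "z 0 * cross b' b 0 + z 1 * cross b' b 1 + z 2 * cross b' b 2 =
    ((1 - of_nat q) / 2 * ((of_nat q + 2) / of_nat q)) \<star> Op (1\<^sub>m q)"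
    unfolding scale_simps(3)[symmetric] B_adjoint_B[symmetric]
    by (rule div_cross; fold casimir_diff; rule down.curl_left)
  have "casimir q \<star> cross b' b i = ((1 - of_nat q) / 2 * ((of_nat q + 2) / of_nat q)) \<star> z i"
    by (rule up.R.scaled_if_div_scalar[OF cross_intertwines[OF down.yzx up.yzx] _ _ d assms(1)])
      (auto simp: Op_one_left Op_one_right intro!: mult_cross_left mult_cross_right)
  hence "(1 / casimir q) \<star> casimir q \<star> cross b' b i = (1 / casimir q) \<star> ((1 - of_nat q) / 2 * ((of_nat q + 2) / of_nat q)) \<star> z i"
    by simp
  moreover have "1 / casimir q * ((1 - of_nat q) / 2 * ((of_nat q + 2) / of_nat q)) = 2 * (of_nat q + 2) / (of_nat q * (of_nat q + 1))"
  proof -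
    have c: "casimir q = (1 - of_nat q) * (of_nat q + 1) / 4"
      by (simp add: casimir_def field_simps power2_eq_square)
    have "(of_nat q + 1 :: complex) \<noteq> 0" "(of_nat q :: complex) \<noteq> 0" "(1 - of_nat q :: complex) \<noteq> 0"
      using assms(2) by (metis of_nat_eq_0_iff of_nat_Suc add.commute nat.simps(3), simp,
        metis eq_iff_diff_eq_0 of_nat_1 of_nat_eq_iff numeral_le_one_iff semiring_norm(69))
    moreover have "1 / (e * a / 4) * (e / 2 * (b / c)) = 2 * b / (c * a)"
      if "a \<noteq> 0" "c \<noteq> 0" "e \<noteq> 0" for a b c e :: complex
      using that by (simp add: field_simps)
    ultimately show ?thesis unfolding c by blast
  qed
  ultimately show ?thesis using casimir_nonzero[of q] assms(2) by simp
qed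

end

section \<open>Blocks\<close>

lemma so3_basis_carrier [simp]: "so3_basis i \<in> carrier_mat 3 3"
  by (simp add: so3_basis_def)

lemma so3_basis_dim [simp]: "dim_row (so3_basis i) = 3" "dim_col (so3_basis i) = 3"
  by (simp_all add: so3_basis_def)

lemma so3_basis_in_so3 [simp]: "so3_basis i \<in> so3"
proof -
  have "transpose_mat (so3_basis i) = - so3_basis i"
    by (rule eq_matI) (auto simp: so3_basis_def levi_civita_def)
  thus ?thesis by (simp add: so3_def)
qed

lemma so3_basis_commutators:
  "commutator (so3_basis 0) (so3_basis 1) = so3_basis 2"
  "commutator (so3_basis 1) (so3_basis 2) = so3_basis 0"
  "commutator (so3_basis 2) (so3_basis 0) = so3_basis 1"
proof -
  have *: "(\<Sum>i = 0..<3. f i) = f 0 + f 1 + f (2::nat)" for f :: "nat \<Rightarrow> real"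
    by (simp add: numeral_3_eq_3 numeral_2_eq_2)
  show "commutator (so3_basis 0) (so3_basis 1) = so3_basis 2"
    by (rule eq_matI) (auto simp: commutator_def so3_basis_def scalar_prod_def * levi_civita_def less_3)
  show "commutator (so3_basis 1) (so3_basis 2) = so3_basis 0"
    by (rule eq_matI) (auto simp: commutator_def so3_basis_def scalar_prod_def * levi_civita_def less_3)
  show "commutator (so3_basis 2) (so3_basis 0) = so3_basis 1"
    by (rule eq_matI) (auto simp: commutator_def so3_basis_def scalar_prod_def * levi_civita_def less_3)
qed

text \<open>The basis matrices have the entries -1, 1, -1 at the positions (1,2), (0,2), (0,1)
  respectively, whence the signs.\<close>

lemma so3_decomp:
  assumes "A \<in> so3"
  shows "A = (- (A $$ (1, 2))) \<cdot>\<^sub>m so3_basis 0 + ((A $$ (0, 2)) \<cdot>\<^sub>m so3_basis 1 + (- (A $$ (0, 1))) \<cdot>\<^sub>m so3_basis 2)"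
proof -
  have c: "dim_row A = 3" "dim_col A = 3" using assms by (auto simp: so3_def)
  have t: "A $$ (j, i) = - A $$ (i, j)" if "i < 3" "j < 3" for i j
  proof -
    have "transpose_mat A $$ (i, j) = (- A) $$ (i, j)" using assms by (simp add: so3_def)
    thus ?thesis using c that by simp
  qed
  have z: "A $$ (i, i) = 0" if "i < 3" for i using t[OF that that] by simp
  show ?thesis
    by (rule eq_matI)
      (use t[of 0 1] t[of 0 2] t[of 1 2] z[of 0] z[of 1] z[of 2] c in
        \<open>auto simp: so3_basis_def levi_civita_def less_3\<close>)
qed

lemma so3_closed: "A \<in> so3 \<Longrightarrow> A' \<in> so3 \<Longrightarrow> A + A' \<in> so3" "A \<in> so3 \<Longrightarrow> c \<cdot>\<^sub>m A \<in> so3"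
proof -
  assume A: "A \<in> so3"
  have t: "A $$ (j, i) = - A $$ (i, j)" if "i < 3" "j < 3" "A \<in> so3" for i j A
  proof -
    have "transpose_mat A $$ (i, j) = (- A) $$ (i, j)" using that by (simp add: so3_def)
    moreover have "dim_row A = 3" "dim_col A = 3" using that by (auto simp: so3_def)
    ultimately show ?thesis using that by simp
  qed
  have c: "dim_row A = 3" "dim_col A = 3" if "A \<in> so3" for A using that by (auto simp: so3_def)
  show "A + A' \<in> so3" if A': "A' \<in> so3"
  proof -
    have "transpose_mat (A + A') = - (A + A')"
    proof (rule eq_matI)
      fix i j assume "i < dim_row (- (A + A'))" "j < dim_col (- (A + A'))"
      hence ij: "i < 3" "j < 3" using c[OF A'] by auto
      show "transpose_mat (A + A') $$ (i, j) = (- (A + A')) $$ (i, j)"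
        using ij c[OF A] c[OF A'] by (simp add: t[OF ij A] t[OF ij A'])
    qed (use c[OF A'] in auto)
    moreover have "A + A' \<in> carrier_mat 3 3" by (rule carrier_matI) (use c[OF A] c[OF A'] in auto)
    ultimately show ?thesis by (simp add: so3_def)
  qed
  have "transpose_mat (c \<cdot>\<^sub>m A) = - (c \<cdot>\<^sub>m A)"
  proof (rule eq_matI)
    fix i j assume "i < dim_row (- (c \<cdot>\<^sub>m A))" "j < dim_col (- (c \<cdot>\<^sub>m A))"
    hence ij: "i < 3" "j < 3" using c[OF A] by auto
    show "transpose_mat (c \<cdot>\<^sub>m A) $$ (i, j) = (- (c \<cdot>\<^sub>m A)) $$ (i, j)"
      using ij c[OF A] by (simp add: t[OF ij A])
  qed (use c[OF A] in auto)
  moreover have "c \<cdot>\<^sub>m A \<in> carrier_mat 3 3" by (rule carrier_matI) (use c[OF A] in auto)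
  ultimately show "c \<cdot>\<^sub>m A \<in> so3" by (simp add: so3_def)
qed

text \<open>The locale \<open>irrep\<close> asks for invariance under the three basis matrices only;
  real linearity of the representation extends it to all of \<open>so3\<close>.\<close>

lemma irrepI:
  assumes irr: "irreducible_so3_rep m \<psi>" and un: "unitary_so3_rep m \<psi>"
  shows "irrep m (\<lambda>i. \<psi> (so3_basis i))"
proof
  have rep: "so3_rep m \<psi>" and m: "m \<ge> 1" using irr by (auto simp: irreducible_so3_rep_def)
  show "m \<ge> 1" by (rule m)
  have c: "\<psi> A \<in> carrier_mat m m" if "A \<in> so3" for A using rep that by (simp add: so3_rep_def)
  have d: "dim_row (\<psi> A) = m" "dim_col (\<psi> A) = m" if "A \<in> so3" for A using c[OF that] by auto
  show "\<psi> (so3_basis i) \<in> carrier_mat m m" for i by (rule c) simp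
  show "mat_adjoint (\<psi> (so3_basis i)) = - \<psi> (so3_basis i)" for i
    using un by (simp add: unitary_so3_rep_def)
  have "Op (\<psi> A) * Op (\<psi> A') - Op (\<psi> A') * Op (\<psi> A) = Op (\<psi> (commutator A A'))"
    if "A \<in> so3" "A' \<in> so3" for A A'
  proof -
    have "\<psi> (commutator A A') = commutator (\<psi> A) (\<psi> A')" using rep that by (simp add: so3_rep_def)
    thus ?thesis using d[OF that(1)] d[OF that(2)] by (simp add: commutator_def Op_diff Op_mult)
  qed
  thus "so3_relations (\<lambda>i. Op (\<psi> (so3_basis i)))"
    unfolding so3_relations_def by (simp add: so3_basis_commutators del: One_nat_def)
  fix V x
  assume V: "V \<subseteq> carrier_vec m" and add: "\<And>v w. v \<in> V \<Longrightarrow> w \<in> V \<Longrightarrow> v + w \<in> V"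
    and smult: "\<And>c v. v \<in> V \<Longrightarrow> c \<cdot>\<^sub>v v \<in> V"
    and inv: "\<And>i v. i < 3 \<Longrightarrow> v \<in> V \<Longrightarrow> \<psi> (so3_basis i) *\<^sub>v v \<in> V" and x: "x \<in> V" "x \<noteq> 0\<^sub>v m"
  have "0 \<cdot>\<^sub>v x = 0\<^sub>v m" using x V by (intro eq_vecI) auto
  hence z: "0\<^sub>v m \<in> V" using smult[OF x(1), of 0] by simp
  have sub: "VectorSpace.subspace class_ring V (module_vec TYPE(complex) m)"
    unfolding VectorSpace.subspace_def submodule_def
    using V add smult z vec_module vec_vs by (auto simp: module_vec_simps)
  have "\<psi> A *\<^sub>v w \<in> V" if A: "A \<in> so3" and w: "w \<in> V" for A w
  proof -
    define a b c' where "a = - (A $$ (1, 2))" and "b = A $$ (0, 2)" and "c' = - (A $$ (0, 1))"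
    have "A = a \<cdot>\<^sub>m so3_basis 0 + (b \<cdot>\<^sub>m so3_basis 1 + c' \<cdot>\<^sub>m so3_basis 2)"
      unfolding a_def b_def c'_def by (rule so3_decomp[OF A])
    hence "\<psi> A = \<psi> (a \<cdot>\<^sub>m so3_basis 0 + (b \<cdot>\<^sub>m so3_basis 1 + c' \<cdot>\<^sub>m so3_basis 2))" by simp
    also have "\<dots> = of_real a \<cdot>\<^sub>m \<psi> (so3_basis 0) + (of_real b \<cdot>\<^sub>m \<psi> (so3_basis 1) + of_real c' \<cdot>\<^sub>m \<psi> (so3_basis 2))"
      using rep by (simp add: so3_rep_def so3_closed)
    also have "\<dots> *\<^sub>v w = of_real a \<cdot>\<^sub>v (\<psi> (so3_basis 0) *\<^sub>v w)
        + (of_real b \<cdot>\<^sub>v (\<psi> (so3_basis 1) *\<^sub>v w) + of_real c' \<cdot>\<^sub>v (\<psi> (so3_basis 2) *\<^sub>v w))"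
      using w V d[OF so3_basis_in_so3]
      by (intro eq_vecI) (auto simp: scalar_prod_def sum_distrib_left sum.distrib distrib_right mult.assoc)
    also have "\<dots> \<in> V" using w by (intro add smult inv) auto
    finally show ?thesis .
  qed
  with irr sub have "V = {0\<^sub>v m} \<or> V = carrier_vec m" by (simp add: irreducible_so3_rep_def)
  with x show "V = carrier_vec m" by auto
qed

section \<open>Indices, products and block diagonal matrices for the ladder of summands\<close>

definition ladder_dim :: "nat \<Rightarrow> nat \<Rightarrow> nat" where "ladder_dim n k = (\<Sum>a\<le>k. n + 2 * a)"

lemma ladder_dim_Suc: "ladder_dim n (Suc k) = n + 2 * Suc k + ladder_dim n k"
  by (simp add: ladder_dim_def)

lemma ladder_offset_top [simp]: "ladder_offset n k k = 0"
  by (simp add: ladder_offset_def)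

lemma ladder_offset_Suc: "a \<le> k \<Longrightarrow> ladder_offset n (Suc k) a = n + 2 * Suc k + ladder_offset n k a"
proof -
  assume "a \<le> k"
  hence "{a<..Suc k} = insert (Suc k) {a<..k}" by auto
  thus ?thesis by (simp add: ladder_offset_def)
qed

lemma ladder_offset_bound: "a \<le> k \<Longrightarrow> p < n + 2 * a \<Longrightarrow> ladder_offset n k a + p < ladder_dim n k"
proof (induction k)
  case (Suc k)
  show ?case
  proof (cases "a = Suc k")
    case True
    thus ?thesis using Suc by (simp add: ladder_dim_Suc)
  next
    case False
    thus ?thesis using Suc by (simp add: ladder_dim_Suc ladder_offset_Suc)
  qed
qed (simp add: ladder_dim_def)

lemma ladder_index_cases:
  "r < ladder_dim n k \<Longrightarrow> \<exists>a\<le>k. \<exists>p<n + 2 * a. r = ladder_offset n k a + p"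
proof (induction k arbitrary: r)
  case 0
  thus ?case by (simp add: ladder_dim_def)
next
  case (Suc k)
  show ?case
  proof (cases "r < n + 2 * Suc k")
    case True
    thus ?thesis by (intro exI[of _ "Suc k"]) simp
  next
    case False
    hence "r - (n + 2 * Suc k) < ladder_dim n k" using Suc.prems by (simp add: ladder_dim_Suc)
    from Suc.IH[OF this] obtain a p where
      "a \<le> k" "p < n + 2 * a" "r - (n + 2 * Suc k) = ladder_offset n k a + p" by blast
    thus ?thesis using False by (intro exI[of _ a]) (auto simp: ladder_offset_Suc)
  qed
qed

text \<open>Regroups the index sum of a matrix product by summands, so that blocks multiply
  blockwise.\<close>

lemma sum_ladder_dim:
  fixes f :: "nat \<Rightarrow> 'a :: comm_monoid_add"
  shows "(\<Sum>r<ladder_dim n k. f r) = (\<Sum>a\<le>k. \<Sum>p<n + 2 * a. f (ladder_offset n k a + p))"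
proof (induction k arbitrary: f)
  case 0
  thus ?case by (simp add: ladder_dim_def)
next
  case (Suc k)
  define d where "d = n + 2 * Suc k"
  have "(\<Sum>r<d + ladder_dim n k. f r) = (\<Sum>r<d. f r) + (\<Sum>r<ladder_dim n k. f (d + r))"
    using sum.atLeastLessThan_concat[of 0 d "d + ladder_dim n k" f]
      sum.shift_bounds_nat_ivl[of f 0 d "ladder_dim n k"]
    by (simp add: lessThan_atLeast0 add.commute)
  also have "\<dots> = (\<Sum>p<d. f (ladder_offset n (Suc k) (Suc k) + p)) + (\<Sum>a\<le>k. \<Sum>p<n + 2 * a. f (ladder_offset n (Suc k) a + p))"
    unfolding Suc.IH by (simp add: ladder_offset_Suc d_def add.assoc)
  finally show ?case unfolding ladder_dim_Suc d_def[symmetric] by (simp add: d_def add.commute)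
qed

lemma ladder_block_carrier [simp]: "ladder_block n k a b M \<in> carrier_mat (n + 2 * a) (n + 2 * b)"
  by (simp add: ladder_block_def)

lemma ladder_block_dim [simp]:
  "dim_row (ladder_block n k a b M) = n + 2 * a" "dim_col (ladder_block n k a b M) = n + 2 * b"
  by (simp_all add: ladder_block_def)

lemma ladder_block_index [simp]:
  "p < n + 2 * a \<Longrightarrow> q < n + 2 * b \<Longrightarrow>
     ladder_block n k a b M $$ (p, q) = M $$ (ladder_offset n k a + p, ladder_offset n k b + q)"
  by (simp add: ladder_block_def)

lemma ladder_blocks_eqI:
  assumes M: "M \<in> carrier_mat (ladder_dim n k) (ladder_dim n k)" "M' \<in> carrier_mat (ladder_dim n k) (ladder_dim n k)"
    and eq: "\<And>a b. a \<le> k \<Longrightarrow> b \<le> k \<Longrightarrow> ladder_block n k a b M = ladder_block n k a b M'"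
  shows "M = M'"
proof (rule eq_matI)
  fix r s assume "r < dim_row M'" "s < dim_col M'"
  hence rs: "r < ladder_dim n k" "s < ladder_dim n k" using M by auto
  obtain a p where a: "a \<le> k" "p < n + 2 * a" "r = ladder_offset n k a + p"
    using ladder_index_cases[OF rs(1)] by blast
  obtain b q where b: "b \<le> k" "q < n + 2 * b" "s = ladder_offset n k b + q"
    using ladder_index_cases[OF rs(2)] by blast
  show "M $$ (r, s) = M' $$ (r, s)"
    using arg_cong[OF eq[OF a(1) b(1)], of "\<lambda>A. A $$ (p, q)"] a b by simp
qed (use M in auto)

lemma ladder_block_linear:
  assumes "M \<in> carrier_mat (ladder_dim n k) (ladder_dim n k)" "M' \<in> carrier_mat (ladder_dim n k) (ladder_dim n k)"
    and "a \<le> k" "b \<le> k"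
  shows "ladder_block n k a b (M + M') = ladder_block n k a b M + ladder_block n k a b M'"
    and "ladder_block n k a b (M - M') = ladder_block n k a b M - ladder_block n k a b M'"
    and "ladder_block n k a b (c \<cdot>\<^sub>m M) = c \<cdot>\<^sub>m ladder_block n k a b M"
    and "ladder_block n k a b (mat_adjoint M) = mat_adjoint (ladder_block n k b a M)"
  by (rule eq_matI; use assms ladder_offset_bound[of a k _ n] ladder_offset_bound[of b k _ n] in simp)+

lemma app_sum: "app (\<Sum>s\<in>S. f s) x i = (\<Sum>s\<in>S. app (f s) x i)"
  by (induction S rule: infinite_finite_induct) (auto simp: zero_op.rep_eq plus_op.rep_eq)

text \<open>The sum is formed among operators, where matrices of all sizes share one zero.\<close>

lemma Op_eq_sum:
  assumes A: "A \<in> carrier_mat r c" and B: "\<And>s. s \<in> S \<Longrightarrow> B s \<in> carrier_mat r c"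
    and eq: "\<And>i j. i < r \<Longrightarrow> j < c \<Longrightarrow> A $$ (i, j) = (\<Sum>s\<in>S. B s $$ (i, j))"
  shows "Op A = (\<Sum>s\<in>S. Op (B s))"
proof -
  have "app (Op A) x i = app (\<Sum>s\<in>S. Op (B s)) x i" for x i
  proof (cases "i < r")
    case True
    have "app (Op A) x i = (\<Sum>j<c. \<Sum>s\<in>S. B s $$ (i, j) * x j)"
      using A True eq by (simp add: Op.rep_eq sum_distrib_right)
    also have "\<dots> = (\<Sum>s\<in>S. \<Sum>j<c. B s $$ (i, j) * x j)" by (rule sum.swap)
    also have "\<dots> = (\<Sum>s\<in>S. app (Op (B s)) x i)"
      by (rule sum.cong) (use B True in \<open>auto simp: Op.rep_eq\<close>)
    finally show ?thesis by (simp add: app_sum)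
  next
    case False
    have "(\<Sum>s\<in>S. app (Op (B s)) x i) = 0"
      by (rule sum.neutral) (use B False in \<open>auto simp: Op.rep_eq\<close>)
    thus ?thesis using A False by (simp add: app_sum Op.rep_eq)
  qed
  thus ?thesis by (simp add: app_inject[symmetric] fun_eq_iff)
qed

lemma Op_ladder_block_mult:
  assumes M: "M \<in> carrier_mat (ladder_dim n k) (ladder_dim n k)" "M' \<in> carrier_mat (ladder_dim n k) (ladder_dim n k)"
    and ab: "a \<le> k" "b \<le> k"
  shows "Op (ladder_block n k a b (M * M')) =
    (\<Sum>c\<le>k. Op (ladder_block n k a c M) * Op (ladder_block n k c b M'))"
proof -
  have "Op (ladder_block n k a b (M * M')) = (\<Sum>c\<le>k. Op (ladder_block n k a c M * ladder_block n k c b M'))"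
  proof (rule Op_eq_sum[OF ladder_block_carrier])
    fix i j assume ij: "i < n + 2 * a" "j < n + 2 * b"
    note bd = ladder_offset_bound[OF ab(1) ij(1)] ladder_offset_bound[OF ab(2) ij(2)]
    have "ladder_block n k a b (M * M') $$ (i, j) = (\<Sum>r<ladder_dim n k.
        M $$ (ladder_offset n k a + i, r) * M' $$ (r, ladder_offset n k b + j))"
      using ij bd M by (simp add: scalar_prod_def lessThan_atLeast0)
    also have "\<dots> = (\<Sum>c\<le>k. (ladder_block n k a c M * ladder_block n k c b M') $$ (i, j))"
      unfolding sum_ladder_dim
      using ij by (intro sum.cong) (auto simp: scalar_prod_def lessThan_atLeast0)
    finally show "ladder_block n k a b (M * M') $$ (i, j) = (\<Sum>c\<le>k. (ladder_block n k a c M * ladder_block n k c b M') $$ (i, j))" .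
  qed (rule mult_carrier_mat[OF ladder_block_carrier ladder_block_carrier])
  thus ?thesis by (simp add: Op_mult)
qed

text \<open>Raising \<open>k\<close> adds the new largest summand in front and leaves the rest
  unchanged, so inductions on \<open>k\<close> split off the first block.\<close>

lemma ladder_rep_Suc:
  assumes "\<phi> (n + 2 * Suc k) A \<in> carrier_mat (n + 2 * Suc k) (n + 2 * Suc k)"
    and "ladder_rep \<phi> n k A \<in> carrier_mat (ladder_dim n k) (ladder_dim n k)"
  shows "ladder_rep \<phi> n (Suc k) A =
    four_block_mat (\<phi> (n + 2 * Suc k) A) (0\<^sub>m (n + 2 * Suc k) (ladder_dim n k))
      (0\<^sub>m (ladder_dim n k) (n + 2 * Suc k)) (ladder_rep \<phi> n k A)"
proof -
  have "map (\<lambda>a. \<phi> (n + 2 * (Suc k - a)) A) [0..<Suc (Suc k)] =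
     \<phi> (n + 2 * Suc k) A # map (\<lambda>a. \<phi> (n + 2 * (k - a)) A) [0..<Suc k]"
    by (subst upt_conv_Cons) (simp_all add: map_Suc_upt[symmetric] del: upt_Suc)
  thus ?thesis
    using assms unfolding ladder_rep_def by (simp add: Let_def del: upt_Suc)
qed

lemma ladder_rep_carrier:
  assumes "\<And>a. a \<le> k \<Longrightarrow> \<phi> (n + 2 * a) A \<in> carrier_mat (n + 2 * a) (n + 2 * a)"
  shows "ladder_rep \<phi> n k A \<in> carrier_mat (ladder_dim n k) (ladder_dim n k)"
  using assms
proof (induction k)
  case 0
  thus ?case using four_block_carrier_mat[OF 0[of 0], of "0\<^sub>m 0 0" 0 0]
    by (simp add: ladder_rep_def ladder_dim_def Let_def)
next
  case (Suc k)
  have IH: "ladder_rep \<phi> n k A \<in> carrier_mat (ladder_dim n k) (ladder_dim n k)" using Suc by simp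
  show ?case unfolding ladder_rep_Suc[OF Suc.prems[OF order_refl] IH] ladder_dim_Suc
    by (rule four_block_carrier_mat[OF Suc.prems[OF order_refl] IH])
qed

lemma ladder_rep_block:
  assumes c: "\<And>a. a \<le> k \<Longrightarrow> \<phi> (n + 2 * a) A \<in> carrier_mat (n + 2 * a) (n + 2 * a)"
    and ab: "a \<le> k" "b \<le> k"
  shows "ladder_block n k a b (ladder_rep \<phi> n k A) =
    (if a = b then \<phi> (n + 2 * a) A else 0\<^sub>m (n + 2 * a) (n + 2 * b))"
proof -
  have "ladder_rep \<phi> n k A $$ (ladder_offset n k a + p, ladder_offset n k b + q) =
      (if a = b then \<phi> (n + 2 * a) A $$ (p, q) else 0)" if "p < n + 2 * a" "q < n + 2 * b" for p q
    using c ab that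
  proof (induction k)
    case 0
    thus ?case using 0(1)[of 0] by (simp add: ladder_rep_def Let_def)
  next
    case (Suc k)
    have IH: "ladder_rep \<phi> n k A \<in> carrier_mat (ladder_dim n k) (ladder_dim n k)"
      using Suc.prems by (intro ladder_rep_carrier) simp
    have c: "\<phi> (n + 2 * Suc k) A \<in> carrier_mat (n + 2 * Suc k) (n + 2 * Suc k)"
      by (rule Suc.prems) simp
    have o: "ladder_offset n (Suc k) a + p < ladder_dim n (Suc k)" "ladder_offset n (Suc k) b + q < ladder_dim n (Suc k)"
      by (rule ladder_offset_bound; use Suc.prems in simp)+
    have e: "ladder_rep \<phi> n (Suc k) A $$ (i, j) =
      (if i < n + 2 * Suc k then if j < n + 2 * Suc k then \<phi> (n + 2 * Suc k) A $$ (i, j) else 0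
       else if j < n + 2 * Suc k then 0 else ladder_rep \<phi> n k A $$ (i - (n + 2 * Suc k), j - (n + 2 * Suc k)))"
      if "i < ladder_dim n (Suc k)" "j < ladder_dim n (Suc k)" for i j
      unfolding ladder_rep_Suc[OF c IH] using that c IH unfolding ladder_dim_Suc
      by (subst index_mat_four_block(1)) auto
    consider "a = Suc k" "b = Suc k" | "a = Suc k" "b \<le> k" | "a \<le> k" "b = Suc k" | "a \<le> k" "b \<le> k"
      using Suc.prems by linarith
    thus ?case
    proof cases
      case 4
      thus ?thesis unfolding e[OF o] using Suc.prems Suc.IH by (simp add: ladder_offset_Suc)
    qed (use e[OF o] Suc.prems in \<open>auto simp: ladder_offset_Suc\<close>)
  qed
  thus ?thesis using c[OF ab(1)] by (intro eq_matI) auto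
qed

section \<open>Ordinary differential equations\<close>

text \<open>All equations share one index set \<open>R\<close> of monomials; a monomial that is
  absent from an equation gets the coefficient zero there.\<close>

locale quadratic_system =
  fixes S :: "'s set" and R :: "'r set" and c :: "'s \<Rightarrow> 'r \<Rightarrow> real" and p q :: "'s \<Rightarrow> 'r \<Rightarrow> 's"
    and x :: "'s \<Rightarrow> real \<Rightarrow> real" and J :: "real set"
  assumes S: "finite S" and R: "finite R"
    and pq: "\<And>s r. s \<in> S \<Longrightarrow> r \<in> R \<Longrightarrow> p s r \<in> S \<and> q s r \<in> S"
    and J: "open J"
    and ode: "\<And>s t. s \<in> S \<Longrightarrow> t \<in> J \<Longrightarrow>
      (x s has_real_derivative (\<Sum>r\<in>R. c s r * (x (p s r) t * x (q s r) t))) (at t)"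
begin

text \<open>The \<open>m\<close>-th derivatives divided by \<open>m!\<close>.\<close>

fun D :: "nat \<Rightarrow> 's \<Rightarrow> real \<Rightarrow> real" where
  "D 0 s t = x s t"
| "D (Suc m) s t = (\<Sum>r\<in>R. c s r * (\<Sum>i\<le>m. D i (p s r) t * D (m - i) (q s r) t)) / real (Suc m)"

declare D.simps(2) [simp del]

text \<open>The product rule maps a convolution of normalized derivatives to one of the next order;
  all lower orders enter, hence the strong induction.\<close>

lemma D_derivative:
  "s \<in> S \<Longrightarrow> t \<in> J \<Longrightarrow> (D m s has_real_derivative real (Suc m) * D (Suc m) s t) (at t)"
proof (induction m arbitrary: s rule: less_induct)
  case (less m)
  show ?case
  proof (cases m)
    case 0
    have "D 0 s = x s" by (simp add: fun_eq_iff)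
    thus ?thesis using ode[OF less.prems] 0 by (simp add: D.simps(2))
  next
    case (Suc l)
    have D: "D m s = (\<lambda>t. (\<Sum>r\<in>R. c s r * (\<Sum>i\<le>l. D i (p s r) t * D (l - i) (q s r) t)) / real (Suc l))"
      unfolding Suc by (simp add: fun_eq_iff D.simps(2))
    have "(D m s has_real_derivative (\<Sum>r\<in>R. c s r * (\<Sum>i\<le>l.
        (real (Suc i) * D (Suc i) (p s r) t) * D (l - i) (q s r) t
        + (real (Suc (l - i)) * D (Suc (l - i)) (q s r) t) * D i (p s r) t)) / real (Suc l)) (at t)"
      unfolding D
    proof (intro DERIV_cdivide DERIV_sum DERIV_cmult DERIV_mult)
      fix r i assume r: "r \<in> R" and i: "i \<in> {..l}"
      show "(D i (p s r) has_real_derivative real (Suc i) * D (Suc i) (p s r) t) (at t)"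
        by (rule less.IH) (use less.prems pq[OF less.prems(1) r] i Suc in auto)
      show "(D (l - i) (q s r) has_real_derivative real (Suc (l - i)) * D (Suc (l - i)) (q s r) t) (at t)"
        by (rule less.IH) (use less.prems pq[OF less.prems(1) r] i Suc in auto)
    qed
    also have "(\<Sum>r\<in>R. c s r * (\<Sum>i\<le>l.
        (real (Suc i) * D (Suc i) (p s r) t) * D (l - i) (q s r) t
        + (real (Suc (l - i)) * D (Suc (l - i)) (q s r) t) * D i (p s r) t)) / real (Suc l)
      = (\<Sum>r\<in>R. c s r * (real (Suc l) * (\<Sum>i\<le>Suc l. D i (p s r) t * D (Suc l - i) (q s r) t))) / real (Suc l)"
    proof -
      \<comment> \<open>Both sums are extended to \<open>i \<le> Suc l\<close> by a term of weight
        zero; then the weights \<open>i\<close> and \<open>Suc l - i\<close> add up to the constant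
        \<open>Suc l\<close>.\<close>
      have conv: "(\<Sum>i\<le>l. (real (Suc i) * u (Suc i)) * v (l - i) + (real (Suc (l - i)) * v (Suc (l - i))) * u i)
          = real (Suc l) * (\<Sum>i\<le>Suc l. u i * v (Suc l - i))" for u v :: "nat \<Rightarrow> real"
      proof -
        have 1: "(\<Sum>i\<le>l. (real (Suc i) * u (Suc i)) * v (l - i)) = (\<Sum>i\<le>Suc l. (real i * u i) * v (Suc l - i))"
          by (subst sum.atMost_Suc_shift) simp
        have 2: "(\<Sum>i\<le>l. (real (Suc (l - i)) * v (Suc (l - i))) * u i) = (\<Sum>i\<le>Suc l. (real (Suc l - i) * v (Suc l - i)) * u i)"
          by (simp add: Suc_diff_le add_diff_eq)
        have "(\<Sum>i\<le>Suc l. (real i * u i) * v (Suc l - i) + (real (Suc l - i) * v (Suc l - i)) * u i)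
            = (\<Sum>i\<le>Suc l. real (Suc l) * (u i * v (Suc l - i)))"
          by (rule sum.cong) (auto simp: of_nat_diff algebra_simps)
        thus ?thesis unfolding sum.distrib 1 2 sum_distrib_left[symmetric] .
      qed
      show ?thesis
        by (rule arg_cong[where f = "\<lambda>z. z / real (Suc l)"], rule sum.cong[OF refl],
          rule arg_cong[where f = "(*) _"], rule conv[of "\<lambda>i. D i (p s _) t" "\<lambda>i. D i (q s _) t"])
    qed
    also have "\<dots> = real (Suc m) * D (Suc m) s t"
      unfolding Suc by (simp add: D.simps(2) sum_distrib_left sum_divide_distrib mult.left_commute del: sum.atMost_Suc)
    finally show ?thesis .
  qed
qed

text \<open>The convolution has \<open>Suc l\<close> summands, each at most
  \<open>A * A * (C * A) ^ l\<close>. The division by \<open>Suc l\<close> in the recursion cancels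
  their number, so that a geometric bound reproduces itself.\<close>

lemma D_bound:
  assumes A: "\<And>s. s \<in> S \<Longrightarrow> \<bar>x s t\<bar> \<le> A" and C: "\<And>s. s \<in> S \<Longrightarrow> (\<Sum>r\<in>R. \<bar>c s r\<bar>) \<le> C"
    and s: "s \<in> S"
  shows "\<bar>D m s t\<bar> \<le> A * (C * A) ^ m"
  using s
proof (induction m arbitrary: s rule: less_induct)
  case (less m)
  have A0: "A \<ge> 0" using A[OF less.prems] by linarith
  have C0: "C \<ge> 0" by (rule order.trans[OF sum_nonneg C[OF less.prems]]) simp
  show ?case
  proof (cases m)
    case 0
    thus ?thesis using A[OF less.prems] by simp
  next
    case (Suc l)
    have "\<bar>\<Sum>i\<le>l. D i (p s r) t * D (l - i) (q s r) t\<bar> \<le> real (Suc l) * (A * A * (C * A) ^ l)" if r: "r \<in> R" for r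
    proof -
      have "\<bar>\<Sum>i\<le>l. D i (p s r) t * D (l - i) (q s r) t\<bar> \<le> (\<Sum>i\<le>l. A * A * (C * A) ^ l)"
      proof (rule order.trans[OF sum_abs], rule sum_mono)
        fix i assume i: "i \<in> {..l}"
        have "\<bar>D i (p s r) t\<bar> * \<bar>D (l - i) (q s r) t\<bar> \<le> (A * (C * A) ^ i) * (A * (C * A) ^ (l - i))"
          using pq[OF less.prems r] i Suc A0 C0 by (intro mult_mono less.IH) auto
        also have "\<dots> = A * A * (C * A) ^ l"
          using i power_add[of "C * A" i "l - i"] by simp
        finally show "\<bar>D i (p s r) t * D (l - i) (q s r) t\<bar> \<le> A * A * (C * A) ^ l" by (simp add: abs_mult)
      qed
      thus ?thesis by simp
    qed
    hence "\<bar>\<Sum>r\<in>R. c s r * (\<Sum>i\<le>l. D i (p s r) t * D (l - i) (q s r) t)\<bar>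
      \<le> (\<Sum>r\<in>R. \<bar>c s r\<bar> * (real (Suc l) * (A * A * (C * A) ^ l)))"
      by (intro order.trans[OF sum_abs] sum_mono) (auto simp: abs_mult intro!: mult_left_mono)
    also have "\<dots> = (\<Sum>r\<in>R. \<bar>c s r\<bar>) * (real (Suc l) * (A * A * (C * A) ^ l))"
      by (simp add: sum_distrib_right)
    also have "\<dots> \<le> C * (real (Suc l) * (A * A * (C * A) ^ l))"
      using A0 C0 by (intro mult_right_mono C less.prems) auto
    also have "\<dots> = real (Suc l) * (A * (C * A) ^ m)" unfolding Suc by simp
    finally have "\<bar>\<Sum>r\<in>R. c s r * (\<Sum>i\<le>l. D i (p s r) t * D (l - i) (q s r) t)\<bar> / real (Suc l) \<le> A * (C * A) ^ m"
      by (simp add: pos_divide_le_eq mult.commute)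
    thus ?thesis unfolding Suc by (simp add: abs_divide D.simps(2))
  qed
qed

text \<open>The Taylor remainder contains a derivative at an unknown intermediate point, so the
  bound on the derivatives has to be uniform on a compact interval around \<open>z\<close>.\<close>

lemma analytic:
  assumes s: "s \<in> S"
  shows "real_analytic_on (x s) J"
  unfolding real_analytic_on_def
proof
  fix z assume z: "z \<in> J"
  obtain e' where e': "e' > 0" "\<And>y. dist y z < e' \<Longrightarrow> y \<in> J" using J z unfolding open_dist by blast
  define e where "e = e' / 2"
  have e: "e > 0" using e' by (simp add: e_def)
  have I: "{z - e..z + e} \<subseteq> J"
  proof
    fix y assume "y \<in> {z - e..z + e}"
    hence "dist y z < e'" using e'(1) by (auto simp: dist_real_def e_def abs_if field_simps)
    thus "y \<in> J" by (rule e')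
  qed
  have cont: "continuous_on {z - e..z + e} (x s)" if "s \<in> S" for s
    using ode[OF that] I by (intro DERIV_continuous_on[of _ "x s"]) (blast intro: has_field_derivative_at_within)
  have "\<exists>A. \<forall>t\<in>{z - e..z + e}. \<bar>x s t\<bar> \<le> A" if "s \<in> S" for s
    using continuous_attains_sup[OF compact_Icc _ continuous_on_rabs[OF cont[OF that]]] e by fastforce
  then obtain A' where A': "\<And>s t. s \<in> S \<Longrightarrow> t \<in> {z - e..z + e} \<Longrightarrow> \<bar>x s t\<bar> \<le> A' s" by metis
  \<comment> \<open>Sums of absolute values serve as common bounds for all components.\<close>
  define A where "A = (\<Sum>s\<in>S. \<bar>A' s\<bar>)"
  define C where "C = (\<Sum>s\<in>S. \<Sum>r\<in>R. \<bar>c s r\<bar>)"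
  define K where "K = C * A"
  have A: "\<bar>x s t\<bar> \<le> A" if "s \<in> S" "t \<in> {z - e..z + e}" for s t
  proof -
    have "\<bar>A' s\<bar> \<le> A" unfolding A_def using S that by (intro member_le_sum) auto
    thus ?thesis using A'[OF that] by linarith
  qed
  have C: "(\<Sum>r\<in>R. \<bar>c s r\<bar>) \<le> C" if "s \<in> S" for s
    unfolding C_def using S that by (intro member_le_sum) (auto intro: sum_nonneg)
  have K: "K \<ge> 0" unfolding K_def A_def C_def by (intro mult_nonneg_nonneg sum_nonneg) auto
  have A0: "A \<ge> 0" unfolding A_def by (intro sum_nonneg) auto
  \<comment> \<open>Ensures \<open>K * \<bar>y - z\<bar> < 1\<close>, also when \<open>K\<close> is
    zero.\<close>
  define r where "r = min e (1 / (K + 1))"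
  have r: "r > 0" using e K by (simp add: r_def)
  have "(\<lambda>m. D m s z * (y - z) ^ m) sums x s y" if y: "\<bar>y - z\<bar> < r" for y
  proof -
    have Ky: "K * \<bar>y - z\<bar> < 1"
    proof -
      have "K * \<bar>y - z\<bar> \<le> (K + 1) * \<bar>y - z\<bar>" by (intro mult_right_mono) auto
      also have "\<dots> < (K + 1) * (1 / (K + 1))" using y K by (intro mult_strict_left_mono) (auto simp: r_def)
      also have "\<dots> = 1" using K by simp
      finally show ?thesis .
    qed
    have yz: "y \<in> {z - e..z + e}" using y by (auto simp: r_def abs_if split: if_splits)
    have rem: "\<bar>x s y - (\<Sum>m<n. D m s z * (y - z) ^ m)\<bar> \<le> A * (K * \<bar>y - z\<bar>) ^ n" if n: "n > 0" for n
    proof (cases "y = z")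
      case True
      have "(\<Sum>m<n. D m s z * (y - z) ^ m) = x s y" using n True
        by (cases n) (simp_all add: sum.lessThan_Suc_shift del: sum.lessThan_Suc)
      thus ?thesis using n A0 True by simp
    next
      case False
      have "\<exists>t. (if y < z then y < t \<and> t < z else z < t \<and> t < y) \<and>
        x s y = (\<Sum>m<n. (fact m * D m s z) / fact m * (y - z) ^ m) + (fact n * D n s t) / fact n * (y - z) ^ n"
      proof (rule Taylor[where a = "z - e" and b = "z + e" and diff = "\<lambda>m t. fact m * D m s t"])
        show "\<forall>m t. m < n \<and> z - e \<le> t \<and> t \<le> z + e \<longrightarrow>
          ((\<lambda>t. fact m * D m s t) has_real_derivative fact (Suc m) * D (Suc m) s t) (at t)"
        proof (intro allI impI)
          fix m t assume "m < n \<and> z - e \<le> t \<and> t \<le> z + e"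
          hence "t \<in> J" using I by auto
          from DERIV_cmult[OF D_derivative[OF s this], of "fact m" m]
          show "((\<lambda>t. fact m * D m s t) has_real_derivative fact (Suc m) * D (Suc m) s t) (at t)"
            by (simp only: fact_Suc mult_ac of_nat_mult)
        qed
      qed (use n e yz False in \<open>auto simp: fun_eq_iff\<close>)
      then obtain t where t: "if y < z then y < t \<and> t < z else z < t \<and> t < y"
        and xy: "x s y = (\<Sum>m<n. D m s z * (y - z) ^ m) + D n s t * (y - z) ^ n"
        by auto
      have "t \<in> {z - e..z + e}" using t yz by (auto split: if_splits)
      hence "\<bar>D n s t\<bar> \<le> A * K ^ n" unfolding K_def by (intro D_bound[OF _ C s] A)
      hence "\<bar>D n s t\<bar> * \<bar>y - z\<bar> ^ n \<le> A * K ^ n * \<bar>y - z\<bar> ^ n" by (intro mult_right_mono) auto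
      thus ?thesis unfolding xy by (simp add: abs_mult power_abs power_mult_distrib)
    qed
    have lim: "(\<lambda>n. A * (K * \<bar>y - z\<bar>) ^ n) \<longlonglongrightarrow> 0"
      using LIMSEQ_realpow_zero[of "K * \<bar>y - z\<bar>"] Ky K tendsto_mult_right_zero by fastforce
    have "(\<lambda>n. (\<Sum>m<n. D m s z * (y - z) ^ m) - x s y) \<longlonglongrightarrow> 0"
    proof (rule tendsto_0_le[OF lim, where K = 1], rule eventually_sequentiallyI[of 1])
      fix n :: nat assume "n \<ge> 1"
      thus "norm ((\<Sum>m<n. D m s z * (y - z) ^ m) - x s y) \<le> norm (A * (K * \<bar>y - z\<bar>) ^ n) * 1"
        using rem[of n] by (simp add: abs_minus_commute)
    qed
    thus ?thesis unfolding sums_def by (subst (asm) LIM_zero_iff)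
  qed
  thus "\<exists>r>0. \<exists>d. \<forall>y. \<bar>y - z\<bar> < r \<longrightarrow> (\<lambda>m. d m * (y - z) ^ m) sums x s y"
    using r by (intro exI[of _ r] conjI exI[of _ "\<lambda>m. D m s z"]) blast+
qed

end

section \<open>Linear scalar equations\<close>

text \<open>Gronwall's argument: with \<open>C\<close> bounding the coefficient between
  \<open>t0\<close> and \<open>t\<close>, the square of the solution is nonincreasing after
  multiplication by \<open>exp (- 2 * C * s)\<close> and nondecreasing after multiplication by
  \<open>exp (2 * C * s)\<close>, which settles the two directions in time.\<close>

lemma linear_ode_zero:
  fixes y l :: "real \<Rightarrow> real"
  assumes J: "connected J" and t0: "t0 \<in> J" "y t0 = 0" and t: "t \<in> J"
    and ode: "\<And>t. t \<in> J \<Longrightarrow> (y has_real_derivative l t * y t) (at t)"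
    and cont: "continuous_on J l"
  shows "y t = 0"
proof -
  define a b where "a = min t0 t" and "b = max t0 t"
  have ab: "a \<le> b" "a \<in> J" "b \<in> J" using t0 t by (auto simp: a_def b_def min_def max_def)
  have I: "{a..b} \<subseteq> J" using connected_contains_Icc[OF J ab(2,3)] .
  obtain C where C: "\<And>s. s \<in> {a..b} \<Longrightarrow> \<bar>l s\<bar> \<le> C"
    using continuous_attains_sup[OF compact_Icc _ continuous_on_rabs[OF continuous_on_subset[OF cont I]]] ab(1) by fastforce
  have der: "((\<lambda>s. (y s)\<^sup>2 * exp (k * s)) has_real_derivative (2 * l s + k) * ((y s)\<^sup>2 * exp (k * s))) (at s)"
    if "s \<in> {a..b}" for k s
    using I that by (auto intro!: derivative_eq_intros ode simp: algebra_simps power2_eq_square)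
  show ?thesis
  proof (cases "t0 \<le> t")
    case True
    hence I: "a = t0" "b = t" by (auto simp: a_def b_def)
    have "(y t)\<^sup>2 * exp (- 2 * C * t) \<le> (y t0)\<^sup>2 * exp (- 2 * C * t0)"
    proof (rule DERIV_nonpos_imp_nonincreasing[OF True, where f = "\<lambda>s. (y s)\<^sup>2 * exp (- 2 * C * s)"])
      fix s assume s: "t0 \<le> s" "s \<le> t"
      hence "2 * l s + (- 2 * C) \<le> 0" using C[of s] I by auto
      thus "\<exists>d. ((\<lambda>s. (y s)\<^sup>2 * exp (- 2 * C * s)) has_real_derivative d) (at s) \<and> d \<le> 0"
        using der[of s "- 2 * C"] s I
        by (intro exI[of _ "(2 * l s + (- 2 * C)) * ((y s)\<^sup>2 * exp (- 2 * C * s))"] conjI mult_nonpos_nonneg) simp_all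
    qed
    thus ?thesis using t0 by (simp add: mult_le_0_iff)
  next
    case False
    hence I: "a = t" "b = t0" by (auto simp: a_def b_def)
    have "(y t)\<^sup>2 * exp (2 * C * t) \<le> (y t0)\<^sup>2 * exp (2 * C * t0)"
    proof (rule DERIV_nonneg_imp_nondecreasing[where f = "\<lambda>s. (y s)\<^sup>2 * exp (2 * C * s)"])
      fix s assume s: "t \<le> s" "s \<le> t0"
      hence "2 * l s + 2 * C \<ge> 0" using C[of s] I by auto
      thus "\<exists>d. ((\<lambda>s. (y s)\<^sup>2 * exp (2 * C * s)) has_real_derivative d) (at s) \<and> 0 \<le> d"
        using der[of s "2 * C"] s I
        by (intro exI[of _ "(2 * l s + 2 * C) * ((y s)\<^sup>2 * exp (2 * C * s))"] conjI mult_nonneg_nonneg) simp_all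
    qed (use False in simp)
    thus ?thesis using t0 by (simp add: mult_le_0_iff)
  qed
qed

text \<open>Rotate \<open>G\<close> so that it is real at a point \<open>t0\<close> where it does
  not vanish. As the factor is real, the imaginary part solves the same equation with initial value
  zero.\<close>

lemma linear_ode_constant_phase:
  fixes G :: "real \<Rightarrow> complex" and l :: "real \<Rightarrow> real"
  assumes J: "connected J"
    and ode: "\<And>t. t \<in> J \<Longrightarrow> (G has_vector_derivative of_real (l t) * G t) (at t)"
    and cont: "continuous_on J l"
  obtains w where "cmod w = 1" "\<And>t. t \<in> J \<Longrightarrow> Im (w * G t) = 0"
proof (cases "\<forall>t\<in>J. G t = 0")
  case True
  thus ?thesis using that[of 1] by simp
next
  case False
  then obtain t0 where t0: "t0 \<in> J" "G t0 \<noteq> 0" by blast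
  define w where "w = cnj (G t0) / of_real (cmod (G t0))"
  have w: "cmod w = 1" using t0 by (simp add: w_def norm_divide)
  have "Im (w * G t) = 0" if t: "t \<in> J" for t
  proof (rule linear_ode_zero[OF J t0(1) _ t _ cont, of "\<lambda>t. Im (w * G t)"])
    show "Im (w * G t0) = 0" by (simp add: w_def)
    show "((\<lambda>t. Im (w * G t)) has_real_derivative l t * Im (w * G t)) (at t)" if "t \<in> J" for t
    proof -
      have "((\<lambda>t. w * G t) has_vector_derivative w * (of_real (l t) * G t)) (at t)"
        by (rule bounded_linear.has_vector_derivative[OF bounded_linear_mult_right ode[OF that]])
      from bounded_linear.has_vector_derivative[OF bounded_linear_Im this]
      show ?thesis by (simp add: has_real_derivative_iff_has_vector_derivative algebra_simps)
    qed
  qed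
  with w that show ?thesis by blast
qed

section \<open>Solutions with spherical symmetry\<close>

lemma unitary_adjoint_mult:
  assumes "U \<in> unitary_group N"
  shows "U \<in> carrier_mat N N" "U * mat_adjoint U = 1\<^sub>m N" "mat_adjoint U * U = 1\<^sub>m N"
proof -
  show U: "U \<in> carrier_mat N N" "U * mat_adjoint U = 1\<^sub>m N"
    using assms by (auto simp: unitary_group_def)
  show "mat_adjoint U * U = 1\<^sub>m N"
    by (rule mat_mult_left_right_inverse[OF U(1) mat_adjoint_carrier[OF U(1)] U(2)])
qed

lemma conj_by_carrier: "U \<in> unitary_group N \<Longrightarrow> A \<in> carrier_mat N N \<Longrightarrow> conj_by U A \<in> carrier_mat N N"
  unfolding conj_by_def using unitary_adjoint_mult(1)[of U N] by (intro carrier_matI) auto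

lemma Op_conj_by:
  assumes "U \<in> unitary_group N" "A \<in> carrier_mat N N"
  shows "Op (conj_by U A) = Op U * Op A * Op (mat_adjoint U)"
  using unitary_adjoint_mult(1)[OF assms(1)] assms(2) by (simp add: conj_by_def Op_mult)

text \<open>The factors cancel only in front of an operator of size \<open>N\<close>, because their
  product is a projection and not the unit of the ring.\<close>

lemma Op_unitary:
  assumes "U \<in> unitary_group N" "A \<in> carrier_mat N N"
  shows "Op (mat_adjoint U) * (Op U * Op A) = Op A" "Op U * (Op (mat_adjoint U) * Op A) = Op A"
    "Op (mat_adjoint U) * (Op U * (Op A * y)) = Op A * y" "Op U * (Op (mat_adjoint U) * (Op A * y)) = Op A * y"
proof -
  note U = unitary_adjoint_mult[OF assms(1)]
  have "Op (mat_adjoint U) * Op U = Op (1\<^sub>m N)" "Op U * Op (mat_adjoint U) = Op (1\<^sub>m N)"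
    using U by (auto simp: Op_mult[symmetric])
  moreover have "Op (1\<^sub>m N) * Op A = Op A" using assms(2) by (simp add: Op_one_left)
  ultimately show "Op (mat_adjoint U) * (Op U * Op A) = Op A" "Op U * (Op (mat_adjoint U) * Op A) = Op A"
    "Op (mat_adjoint U) * (Op U * (Op A * y)) = Op A * y" "Op U * (Op (mat_adjoint U) * (Op A * y)) = Op A * y"
    by (simp_all add: mult.assoc[symmetric])
qed

lemma Op_conj_by_mult:
  assumes "U \<in> unitary_group N" "A \<in> carrier_mat N N" "A' \<in> carrier_mat N N"
  shows "Op (conj_by U (A * A')) = Op (conj_by U A) * Op (conj_by U A')"
  using assms
  by (simp add: Op_conj_by[of U N] Op_mult mult.assoc Op_unitary[OF assms(1,3)] mult_carrier_mat[OF assms(2,3)])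

lemma mat_adjoint_conj_by:
  assumes "U \<in> unitary_group N" "A \<in> carrier_mat N N"
  shows "mat_adjoint (conj_by U A) = conj_by U (mat_adjoint A)"
  unfolding conj_by_def using unitary_adjoint_mult(1)[OF assms(1)] assms(2)
  by (simp add: mat_adjoint_mult assoc_mult_mat[of _ N N _ N _ N])

lemma has_vector_derivative_sum':
  "(\<And>i. i \<in> I \<Longrightarrow> (f i has_vector_derivative f' i) F) \<Longrightarrow>
     ((\<lambda>s. \<Sum>i\<in>I. f i s) has_vector_derivative (\<Sum>i\<in>I. f' i)) F"
  by (induction I rule: infinite_finite_induct) (auto intro!: has_vector_derivative_add)

lemma has_vector_derivative_cong_open:
  assumes "(f has_vector_derivative d) (at t)" "open J" "t \<in> J" "\<And>s. s \<in> J \<Longrightarrow> f s = g s"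
  shows "(g has_vector_derivative d) (at t)"
  using assms unfolding has_vector_derivative_def by (rule has_derivative_transform_within_open)

lemma conj_by_entry_derivative:
  assumes U: "U \<in> unitary_group N" and M: "\<And>s. s \<in> J \<Longrightarrow> M s \<in> carrier_mat N N" and D: "D \<in> carrier_mat N N"
    and J: "open J" "t \<in> J" and der: "has_mat_derivative M D t" and pq: "p < N" "q < N"
  shows "((\<lambda>s. conj_by U (M s) $$ (p, q)) has_vector_derivative conj_by U D $$ (p, q)) (at t)"
proof -
  have Uc: "U \<in> carrier_mat N N" using unitary_adjoint_mult(1)[OF U] .
  have entry: "conj_by U A $$ (p, q) = (\<Sum>j<N. \<Sum>i<N. U $$ (p, i) * A $$ (i, j) * cnj (U $$ (q, j)))"
    if "A \<in> carrier_mat N N" for A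
    using that Uc pq unfolding conj_by_def
    by (simp add: scalar_prod_def lessThan_atLeast0 sum_distrib_right)
  have "((\<lambda>s. \<Sum>j<N. \<Sum>i<N. U $$ (p, i) * M s $$ (i, j) * cnj (U $$ (q, j))) has_vector_derivative
      (\<Sum>j<N. \<Sum>i<N. U $$ (p, i) * D $$ (i, j) * cnj (U $$ (q, j)))) (at t)"
  proof (intro has_vector_derivative_sum')
    fix i j assume "j \<in> {..<N}" "i \<in> {..<N}"
    hence "((\<lambda>s. M s $$ (i, j)) has_vector_derivative D $$ (i, j)) (at t)"
      using der D by (simp add: has_mat_derivative_def)
    from bounded_linear.has_vector_derivative[OF bounded_linear_mult_left
        bounded_linear.has_vector_derivative[OF bounded_linear_mult_right this]]
    show "((\<lambda>s. U $$ (p, i) * M s $$ (i, j) * cnj (U $$ (q, j))) has_vector_derivative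
      U $$ (p, i) * D $$ (i, j) * cnj (U $$ (q, j))) (at t)" .
  qed
  thus ?thesis unfolding entry[OF D]
    by (rule has_vector_derivative_cong_open[OF _ J]) (simp add: entry[OF M])
qed

lemma levi_civita_cyclic: "levi_civita i j k = levi_civita j k i"
  unfolding levi_civita_def by auto

section \<open>The blocks of the triple in coordinates adapted to the decomposition\<close>

locale nahm_ladder =
  fixes n k N :: nat
    and \<phi> :: "nat \<Rightarrow> real mat \<Rightarrow> complex mat"
    and B :: "nat \<Rightarrow> nat \<Rightarrow> complex mat"
    and \<rho> :: "real mat \<Rightarrow> complex mat"
    and W :: "complex mat"
    and J :: "real set"
    and T :: "nat \<Rightarrow> real \<Rightarrow> complex mat"
    and Y :: "nat \<Rightarrow> complex mat"
  assumes n: "n \<ge> 1"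
    and N: "N = (\<Sum>a\<le>k. n + 2 * a)"
    and irreps: "\<And>m. m \<ge> 1 \<Longrightarrow> irreducible_so3_rep m (\<phi> m) \<and> unitary_so3_rep m (\<phi> m)"
    and B: "\<And>m. m \<ge> 1 \<Longrightarrow> normalized_B_triple \<phi> m (B m)"
    and J: "open J" "connected J"
    and nahm: "nahm_solution N J T"
    and generators: "symmetry_generators N J T Y"
    and induce: "generators_induce_rep N Y \<rho>"
    and W: "W \<in> unitary_group N"
    and decomposition: "\<And>A. A \<in> so3 \<Longrightarrow> conj_by W (\<rho> A) = ladder_rep \<phi> n k A"
begin

lemma N_dim: "N = ladder_dim n k"
  by (simp add: N ladder_dim_def)

abbreviation "Yb a i \<equiv> \<phi> (n + 2 * a) (so3_basis i)"
abbreviation "Bb a i \<equiv> B (n + 2 * a) i"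
abbreviation "blk a b M \<equiv> ladder_block n k a b M"

lemma irrep_Yb: "irrep (n + 2 * a) (Yb a)"
  using irreps[of "n + 2 * a"] n by (intro irrepI) auto

lemma normalized_Bb: "normalized_intertwiner (n + 2 * a) (Yb (Suc a)) (Yb a) (Bb a)"
proof (rule normalized_intertwiner.intro)
  have e: "n + 2 * Suc a = n + 2 * a + 2" by simp
  show "irrep (n + 2 * a + 2) (Yb (Suc a))" using irrep_Yb[of "Suc a"] unfolding e .
  show "irrep (n + 2 * a) (Yb a)" by (rule irrep_Yb)
  have Bn: "normalized_B_triple \<phi> (n + 2 * a) (Bb a)" using n by (intro B) simp
  show "intertwiner (n + 2 * a + 2) (n + 2 * a) (Yb (Suc a)) (Yb a) (Bb a)"
    using Bn unfolding normalized_B_triple_def intertwiner_def e by blast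
  show "lincomb3 (\<lambda>_. 1) (\<lambda>i. Bb a i * mat_adjoint (Bb a i)) = 1\<^sub>m (n + 2 * a + 2)"
    using Bn unfolding normalized_B_triple_def by blast
qed

definition M :: "nat \<Rightarrow> real \<Rightarrow> complex mat" where "M i t = conj_by W (T i t)"

lemma T_carrier: "i < 3 \<Longrightarrow> t \<in> J \<Longrightarrow> T i t \<in> carrier_mat N N"
  and T_adjoint: "i < 3 \<Longrightarrow> t \<in> J \<Longrightarrow> mat_adjoint (T i t) = - T i t"
  using nahm by (auto simp: nahm_solution_def su_def)

lemma M_carrier: "i < 3 \<Longrightarrow> t \<in> J \<Longrightarrow> M i t \<in> carrier_mat N N"
  unfolding M_def by (intro conj_by_carrier[OF W] T_carrier)

lemma M_adjoint: "i < 3 \<Longrightarrow> t \<in> J \<Longrightarrow> mat_adjoint (M i t) = - M i t"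
proof -
  assume a: "i < 3" "t \<in> J"
  note c = T_carrier[OF a]
  have "conj_by W (- T i t) = - conj_by W (T i t)"
    by (rule Op_inj[OF conj_by_carrier[OF W] uminus_carrier_mat[OF conj_by_carrier[OF W]]])
      (use c in \<open>simp_all add: Op_conj_by[OF W] Op_uminus\<close>)
  thus ?thesis unfolding M_def mat_adjoint_conj_by[OF W c] T_adjoint[OF a] .
qed

lemma ladder_carrier: "ladder_rep \<phi> n k (so3_basis i) \<in> carrier_mat N N" if "i < 3"
  unfolding N_dim by (rule ladder_rep_carrier) (use irrep.carrier[OF irrep_Yb that] in simp)

text \<open>Conjugation by \<open>W\<close> carries the generators to the block diagonal matrices of
  the ladder.\<close>

lemma M_equivariant:
  assumes "i < 3" "j < 3" "t \<in> J"
  shows "Op (ladder_rep \<phi> n k (so3_basis i)) * Op (M j t) - Op (M j t) * Op (ladder_rep \<phi> n k (so3_basis i))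
    = levi_civita i j 0 \<star> Op (M 0 t) + levi_civita i j 1 \<star> Op (M 1 t) + levi_civita i j 2 \<star> Op (M 2 t)"
proof -
  have Yc: "Y i \<in> carrier_mat N N" using generators assms by (auto simp: symmetry_generators_def su_def)
  have L: "ladder_rep \<phi> n k (so3_basis i) = conj_by W (Y i)"
    using decomposition[of "so3_basis i"] induce assms by (simp add: generators_induce_rep_def)
  have "commutator (Y i) (T j t) = lincomb3 (levi_civita i j) (\<lambda>k. T k t)"
    using generators assms by (simp add: symmetry_generators_def)
  hence "Op (commutator (Y i) (T j t)) = Op (lincomb3 (levi_civita i j) (\<lambda>k. T k t))" by simp
  hence e: "Op (Y i) * Op (T j t) - Op (T j t) * Op (Y i)
     = levi_civita i j 0 \<star> Op (T 0 t) + levi_civita i j 1 \<star> Op (T 1 t) + levi_civita i j 2 \<star> Op (T 2 t)"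
    using Op_lincomb3[of "\<lambda>k. T k t" N N "levi_civita i j"] T_carrier[OF _ assms(3)] T_carrier[OF assms(2,3)] Yc
    by (simp add: commutator_def Op_diff Op_mult)
  have "Op W * (Op (Y i) * Op (T j t) - Op (T j t) * Op (Y i)) * Op (mat_adjoint W)
     = levi_civita i j 0 \<star> Op (M 0 t) + levi_civita i j 1 \<star> Op (M 1 t) + levi_civita i j 2 \<star> Op (M 2 t)"
    unfolding e M_def using T_carrier[OF _ assms(3)]
    by (simp add: Op_conj_by[OF W] distrib_left distrib_right del: One_nat_def)
  moreover have "Op W * (Op (Y i) * Op (T j t) - Op (T j t) * Op (Y i)) * Op (mat_adjoint W)
     = Op (conj_by W (Y i)) * Op (M j t) - Op (M j t) * Op (conj_by W (Y i))"
    unfolding M_def using T_carrier[OF assms(2,3)] Yc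
    by (simp add: Op_conj_by[OF W] right_diff_distrib left_diff_distrib mult.assoc
        Op_unitary[OF W T_carrier[OF assms(2,3)]] Op_unitary[OF W Yc])
  ultimately show ?thesis unfolding L by simp
qed

text \<open>Stated for an arbitrary block diagonal factor, since it serves both the representation
  and the gauge matrix.\<close>

lemma Op_block_diagonal_mult:
  assumes L: "L \<in> carrier_mat N N" and M': "M' \<in> carrier_mat N N" and ab: "a \<le> k" "b \<le> k"
    and bl: "\<And>c d. c \<le> k \<Longrightarrow> d \<le> k \<Longrightarrow> Op (blk c d L) = (if c = d then D c else 0)"
  shows "Op (blk a b (L * M')) = D a * Op (blk a b M')"
    and "Op (blk a b (M' * L)) = Op (blk a b M') * D b"
proof -
  have "(\<Sum>c\<le>k. Op (blk a c L) * Op (blk c b M')) = (\<Sum>c\<le>k. if c = a then D a * Op (blk a b M') else 0)"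
    by (rule sum.cong) (use ab in \<open>auto simp: bl\<close>)
  thus "Op (blk a b (L * M')) = D a * Op (blk a b M')"
    unfolding Op_ladder_block_mult[OF L[unfolded N_dim] M'[unfolded N_dim] ab] using ab by simp
  have "(\<Sum>c\<le>k. Op (blk a c M') * Op (blk c b L)) = (\<Sum>c\<le>k. if c = b then Op (blk a b M') * D b else 0)"
    by (rule sum.cong) (use ab in \<open>auto simp: bl\<close>)
  thus "Op (blk a b (M' * L)) = Op (blk a b M') * D b"
    unfolding Op_ladder_block_mult[OF M'[unfolded N_dim] L[unfolded N_dim] ab] using ab by simp
qed

lemma Op_block_ladder_rep:
  assumes "A \<in> so3" "c \<le> k" "d \<le> k"
  shows "Op (blk c d (ladder_rep \<phi> n k A)) = (if c = d then Op (\<phi> (n + 2 * c) A) else 0)"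
proof -
  have "\<phi> (n + 2 * c) A \<in> carrier_mat (n + 2 * c) (n + 2 * c)" for c
    using irreps[of "n + 2 * c"] n assms(1) by (simp add: unitary_so3_rep_def so3_rep_def)
  thus ?thesis using ladder_rep_block[of k \<phi> n A c d] assms by (simp add: Op_zero)
qed

lemma Op_ladder_block_rep_mult:
  assumes "i < 3" "M' \<in> carrier_mat N N" "a \<le> k" "b \<le> k"
  shows "Op (blk a b (ladder_rep \<phi> n k (so3_basis i) * M')) = Op (Yb a i) * Op (blk a b M')"
    and "Op (blk a b (M' * ladder_rep \<phi> n k (so3_basis i))) = Op (blk a b M') * Op (Yb b i)"
  using Op_block_diagonal_mult[OF ladder_carrier[OF assms(1)] assms(2-4) Op_block_ladder_rep[OF so3_basis_in_so3]]
  by blast+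

lemma Op_blk_linear:
  assumes "A \<in> carrier_mat N N" "A' \<in> carrier_mat N N" "a \<le> k" "b \<le> k"
  shows "Op (blk a b (A + A')) = Op (blk a b A) + Op (blk a b A')"
    "Op (blk a b (A - A')) = Op (blk a b A) - Op (blk a b A')"
    "Op (blk a b (c \<cdot>\<^sub>m A)) = c \<star> Op (blk a b A)"
  using ladder_block_linear(1,2,3)[OF assms(1,2)[unfolded N_dim] assms(3,4)]
  by (simp_all add: Op_add Op_diff Op_smult)

text \<open>The generators are block diagonal, so their relation with the triple holds for each
  block separately; cyclic invariance of the Levi-Civita symbol matches the two index
  orders.\<close>

lemma block_intertwiner:
  assumes t: "t \<in> J" and ab: "a \<le> k" "b \<le> k"
  shows "intertwiner (n + 2 * a) (n + 2 * b) (Yb a) (Yb b) (\<lambda>i. blk a b (M i t))"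
proof -
  have "Op (Yb a i) * Op (blk a b (M j t)) - Op (blk a b (M j t)) * Op (Yb b i) =
    levi_civita 0 i j \<star> Op (blk a b (M 0 t)) + levi_civita 1 i j \<star> Op (blk a b (M 1 t)) + levi_civita 2 i j \<star> Op (blk a b (M 2 t))"
    if ij: "i < 3" "j < 3" for i j
  proof -
    define L where "L = ladder_rep \<phi> n k (so3_basis i)"
    have L: "L \<in> carrier_mat N N" unfolding L_def by (rule ladder_carrier[OF ij(1)])
    note Mc = M_carrier[OF _ t]
    have LM: "L * M j t \<in> carrier_mat N N" "M j t * L \<in> carrier_mat N N"
      using L Mc[OF ij(2)] by (auto intro: mult_carrier_mat)
    have m: "M 0 t \<in> carrier_mat N N" "M 1 t \<in> carrier_mat N N" "M 2 t \<in> carrier_mat N N"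
      by (rule Mc, simp)+
    note sm = smult_carrier_mat[OF m(1)] smult_carrier_mat[OF m(2)] smult_carrier_mat[OF m(3)]
    define X where "X = levi_civita i j 0 \<cdot>\<^sub>m M 0 t + levi_civita i j 1 \<cdot>\<^sub>m M 1 t"
    have X: "X \<in> carrier_mat N N" unfolding X_def by (rule add_carrier_mat[OF sm(2)])
    have "L * M j t - M j t * L = X + levi_civita i j 2 \<cdot>\<^sub>m M 2 t"
    proof (rule Op_inj)
      show "L * M j t - M j t * L \<in> carrier_mat N N" by (rule minus_carrier_mat[OF LM(2)])
      show "X + levi_civita i j 2 \<cdot>\<^sub>m M 2 t \<in> carrier_mat N N" by (rule add_carrier_mat[OF sm(3)])
      show "Op (L * M j t - M j t * L) = Op (X + levi_civita i j 2 \<cdot>\<^sub>m M 2 t)"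
        using M_equivariant[OF ij t] L Mc[OF ij(2)] m unfolding L_def[symmetric] X_def
        by (simp add: Op_diff Op_add Op_mult Op_smult del: One_nat_def)
    qed
    hence "Op (blk a b (L * M j t - M j t * L)) = Op (blk a b (X + levi_civita i j 2 \<cdot>\<^sub>m M 2 t))"
      by (simp only:)
    hence "Op (Yb a i) * Op (blk a b (M j t)) - Op (blk a b (M j t)) * Op (Yb b i) =
      levi_civita i j 0 \<star> Op (blk a b (M 0 t)) + levi_civita i j 1 \<star> Op (blk a b (M 1 t)) + levi_civita i j 2 \<star> Op (blk a b (M 2 t))"
      by (simp only: Op_blk_linear(2)[OF LM ab, unfolded L_def] Op_blk_linear(1)[OF X sm(3) ab, unfolded X_def]
        X_def Op_blk_linear(1)[OF sm(1,2) ab] Op_blk_linear(3)[OF m(1) m(1) ab]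
        Op_blk_linear(3)[OF m(2) m(2) ab] Op_blk_linear(3)[OF m(3) m(3) ab]
        L_def Op_ladder_block_rep_mult[OF ij(1) Mc[OF ij(2)] ab])
    thus ?thesis by (simp only: levi_civita_cyclic[of 0 i j] levi_civita_cyclic[of 1 i j] levi_civita_cyclic[of 2 i j])
  qed
  thus ?thesis
    by (subst intertwiner_intertwines[OF irrep_Yb irrep_Yb]) (simp_all add: intertwines_iff del: One_nat_def)
qed

lemma block_adjoint:
  assumes "i < 3" "t \<in> J" "a \<le> k" "b \<le> k"
  shows "mat_adjoint (blk a b (M i t)) = - blk b a (M i t)"
proof -
  note c = M_carrier[OF assms(1,2)]
  have "mat_adjoint (blk a b (M i t)) = blk b a (mat_adjoint (M i t))"
    using ladder_block_linear(4)[OF c[unfolded N_dim] c[unfolded N_dim] assms(4,3)] by simp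
  also have "\<dots> = blk b a (- M i t)" using M_adjoint[OF assms(1,2)] by simp
  also have "\<dots> = - blk b a (M i t)"
    by (rule eq_matI)
      (use c ladder_offset_bound[of a k _ n] ladder_offset_bound[of b k _ n] assms(3,4) in \<open>auto simp: N_dim\<close>)
  finally show ?thesis .
qed

text \<open>On a one-dimensional summand the generators are zero and do not determine the factor.
  The value 0 makes the coefficient real, continuous and analytic there as well.\<close>

definition F :: "nat \<Rightarrow> real \<Rightarrow> complex" where
  "F a t = (if n + 2 * a = 1 then 0 else SOME f. \<forall>i<3. blk a a (M i t) = f \<cdot>\<^sub>m Yb a i)"

definition G :: "nat \<Rightarrow> real \<Rightarrow> complex" where
  "G a t = (SOME g. \<forall>i<3. blk (Suc a) a (M i t) = g \<cdot>\<^sub>m Bb a i)"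

lemma block_diag:
  assumes "t \<in> J" "a \<le> k" "i < 3"
  shows "blk a a (M i t) = F a t \<cdot>\<^sub>m Yb a i"
proof -
  obtain f where f: "\<And>i. i < 3 \<Longrightarrow> blk a a (M i t) = f \<cdot>\<^sub>m Yb a i"
    by (rule intertwiner_scalar[OF irrep_Yb block_intertwiner[OF assms(1,2,2)]]) blast
  show ?thesis
  proof (cases "n + 2 * a = 1")
    case True
    have "Yb a i = 0\<^sub>m 1 1" using irrep.Y_eq_0[OF irrep_Yb True assms(3)] .
    thus ?thesis using f[OF assms(3)] by simp
  next
    case False
    have "\<exists>f. \<forall>i<3. blk a a (M i t) = f \<cdot>\<^sub>m Yb a i" using f by blast
    from someI_ex[OF this] False assms(3) show ?thesis unfolding F_def by simp
  qed
qed

lemma Bb_nonzero: "\<exists>i<3. mat_adjoint (Bb a i) \<noteq> 0\<^sub>m (n + 2 * a) (n + 2 * a + 2)"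
proof (rule ccontr)
  interpret normalized_intertwiner "n + 2 * a" "Yb (Suc a)" "Yb a" "Bb a" by (rule normalized_Bb)
  assume "\<not> ?thesis"
  hence "Op (mat_adjoint (Bb a i)) = 0" if "i < 3" for i using that by (simp add: Op_zero)
  hence "Op (1\<^sub>m (n + 2 * a + 2)) = 0" using Op_normalized by (simp del: One_nat_def)
  hence "1\<^sub>m (n + 2 * a + 2) = (0\<^sub>m (n + 2 * a + 2) (n + 2 * a + 2) :: complex mat)"
    by (intro Op_eq_0) auto
  hence "(1\<^sub>m (n + 2 * a + 2) :: complex mat) $$ (0, 0) = 0\<^sub>m (n + 2 * a + 2) (n + 2 * a + 2) $$ (0, 0)"
    by (simp only:)
  thus False by simp
qed

text \<open>Uniqueness applies to triples that lower the dimension, hence to the opposite block and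
  the adjoint of \<open>B\<close>; skew-adjointness of the triple carries the result over to this
  block.\<close>

lemma block_lower:
  assumes "t \<in> J" "a < k" "i < 3"
  shows "blk (Suc a) a (M i t) = G a t \<cdot>\<^sub>m Bb a i"
proof -
  interpret normalized_intertwiner "n + 2 * a" "Yb (Suc a)" "Yb a" "Bb a" by (rule normalized_Bb)
  have e: "n + 2 * Suc a = n + 2 * a + 2" by simp
  have ak: "a \<le> k" "Suc a \<le> k" using assms by auto
  obtain i0 where i0: "i0 < 3" "mat_adjoint (Bb a i0) \<noteq> 0\<^sub>m (n + 2 * a) (n + 2 * a + 2)"
    using Bb_nonzero by blast
  have X: "intertwiner (n + 2 * a) (n + 2 * a + 2) (Yb a) (Yb (Suc a)) (\<lambda>i. blk a (Suc a) (M i t))"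
    unfolding e[symmetric] by (rule block_intertwiner[OF assms(1) ak])
  obtain u where u: "\<And>i. i < 3 \<Longrightarrow> blk a (Suc a) (M i t) = u \<cdot>\<^sub>m mat_adjoint (Bb a i)"
    by (rule intertwiner_unique[OF R L refl X down.X i0]) blast
  have "blk (Suc a) a (M i t) = (- cnj u) \<cdot>\<^sub>m Bb a i" if i: "i < 3" for i
  proof (rule Op_eqI)
    have "Op (- blk (Suc a) a (M i t)) = Op (mat_adjoint (u \<cdot>\<^sub>m mat_adjoint (Bb a i)))"
      using block_adjoint[OF i assms(1) ak] u[OF i] by simp
    hence h: "- Op (blk (Suc a) a (M i t)) = cnj u \<star> Op (Bb a i)"
      by (simp add: Op_uminus mat_adjoint_smult Op_smult)
    show "Op (blk (Suc a) a (M i t)) = Op ((- cnj u) \<cdot>\<^sub>m Bb a i)"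
      by (simp add: Op_smult scale_add h[symmetric])
  qed (use i in auto)
  hence "\<exists>g. \<forall>i<3. blk (Suc a) a (M i t) = g \<cdot>\<^sub>m Bb a i" by blast
  from someI_ex[OF this] assms(3) show ?thesis unfolding G_def by simp
qed

lemma block_upper:
  assumes "t \<in> J" "a < k" "i < 3"
  shows "blk a (Suc a) (M i t) = (- cnj (G a t)) \<cdot>\<^sub>m mat_adjoint (Bb a i)"
proof (rule Op_eqI)
  interpret normalized_intertwiner "n + 2 * a" "Yb (Suc a)" "Yb a" "Bb a" by (rule normalized_Bb)
  have "Op (- blk a (Suc a) (M i t)) = Op (mat_adjoint (G a t \<cdot>\<^sub>m Bb a i))"
    using block_adjoint[OF assms(3,1), of "Suc a" a] block_lower[OF assms] assms(2) by simp
  hence h: "- Op (blk a (Suc a) (M i t)) = cnj (G a t) \<star> Op (mat_adjoint (Bb a i))"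
    by (simp add: Op_uminus mat_adjoint_smult Op_smult)
  show "Op (blk a (Suc a) (M i t)) = Op ((- cnj (G a t)) \<cdot>\<^sub>m mat_adjoint (Bb a i))"
    by (simp add: Op_smult scale_add h[symmetric])
  show "dim_row (blk a (Suc a) (M i t)) = dim_row ((- cnj (G a t)) \<cdot>\<^sub>m mat_adjoint (Bb a i))"
    "dim_col (blk a (Suc a) (M i t)) = dim_col ((- cnj (G a t)) \<cdot>\<^sub>m mat_adjoint (Bb a i))"
    using assms(3) by simp_all
qed

lemma block_far:
  assumes "t \<in> J" "a \<le> k" "b \<le> k" "i < 3" "a \<noteq> b" "a \<noteq> Suc b" "b \<noteq> Suc a"
  shows "blk a b (M i t) = 0\<^sub>m (n + 2 * a) (n + 2 * b)"
  by (rule intertwined_irreps.zero_if_far[OF intertwined_irreps.intro[OF irrep_Yb irrep_Yb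
      block_intertwiner[OF assms(1-3)]] _ _ _ assms(4)]) (use assms in auto)

definition DM :: "nat \<Rightarrow> real \<Rightarrow> complex mat" where
  "DM i t = conj_by W (if i = 0 then commutator (T 1 t) (T 2 t)
     else if i = 1 then commutator (T 2 t) (T 0 t) else commutator (T 0 t) (T 1 t))"

lemma M_derivative:
  assumes "t \<in> J" "i < 3" "p < N" "q < N"
  shows "((\<lambda>s. M i s $$ (p, q)) has_vector_derivative DM i t $$ (p, q)) (at t)"
proof -
  have c: "commutator (T i t) (T j t) \<in> carrier_mat N N" if "i < 3" "j < 3" for i j
    unfolding commutator_def
    by (rule minus_carrier_mat[OF mult_carrier_mat[OF T_carrier[OF that(2) assms(1)] T_carrier[OF that(1) assms(1)]]])
  show ?thesis unfolding M_def DM_def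
    by (rule conj_by_entry_derivative[OF W T_carrier _ J(1) assms(1) _ assms(3,4)])
       (use nahm assms c in \<open>auto simp: nahm_solution_def less_3 simp del: One_nat_def\<close>)
qed

text \<open>The commutators form the cross product of the conjugated triple with itself, and block
  multiplication distributes it over the intermediate summands.\<close>

lemma Op_block_DM:
  assumes t: "t \<in> J" and i: "i < 3" and ab: "a \<le> k" "b \<le> k"
  shows "Op (blk a b (DM i t)) =
    (\<Sum>c\<le>k. cross (\<lambda>i. Op (blk a c (M i t))) (\<lambda>i. Op (blk c b (M i t))) i)"
proof -
  have *: "Op (blk a b (conj_by W (commutator (T j t) (T l t)))) =
      (\<Sum>c\<le>k. Op (blk a c (M j t)) * Op (blk c b (M l t)) - Op (blk a c (M l t)) * Op (blk c b (M j t)))"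
    if jl: "j < 3" "l < 3" for j l
  proof -
    note Tc = T_carrier[OF jl(1) t] T_carrier[OF jl(2) t]
    note Mc = M_carrier[OF jl(1) t] M_carrier[OF jl(2) t]
    have TT: "T j t * T l t \<in> carrier_mat N N" "T l t * T j t \<in> carrier_mat N N"
      by (rule mult_carrier_mat[OF Tc] mult_carrier_mat[OF Tc(2,1)])+
    have MM: "M j t * M l t \<in> carrier_mat N N" "M l t * M j t \<in> carrier_mat N N"
      by (rule mult_carrier_mat[OF Mc] mult_carrier_mat[OF Mc(2,1)])+
    have "conj_by W (commutator (T j t) (T l t)) = M j t * M l t - M l t * M j t"
    proof (rule Op_inj[OF conj_by_carrier[OF W] minus_carrier_mat[OF MM(2)]])
      show "commutator (T j t) (T l t) \<in> carrier_mat N N"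
        unfolding commutator_def by (rule minus_carrier_mat[OF TT(2)])
      have "Op (conj_by W (commutator (T j t) (T l t))) = Op (conj_by W (T j t * T l t)) - Op (conj_by W (T l t * T j t))"
        using Tc TT unfolding commutator_def
        by (simp add: Op_conj_by[OF W] Op_conj_by[OF W minus_carrier_mat[OF TT(2)]] Op_diff right_diff_distrib left_diff_distrib)
      also have "\<dots> = Op (M j t * M l t - M l t * M j t)"
        using Mc unfolding Op_conj_by_mult[OF W Tc] Op_conj_by_mult[OF W Tc(2,1)] M_def[symmetric]
        by (simp add: Op_diff Op_mult)
      finally show "Op (conj_by W (commutator (T j t) (T l t))) = Op (M j t * M l t - M l t * M j t)" .
    qed
    thus ?thesis
      using Op_blk_linear(2)[OF MM ab] Op_ladder_block_mult[OF Mc[unfolded N_dim] ab]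
        Op_ladder_block_mult[OF Mc(2,1)[unfolded N_dim] ab]
      by (simp add: sum_subtractf)
  qed
  show ?thesis
    using i *[of 1 2] *[of 2 0] *[of 0 1] unfolding less_3 cross_def DM_def by (auto simp del: One_nat_def)
qed

end

section \<open>Nonvanishing entries, determinants and sums over neighbouring blocks\<close>

lemma cross_cong:
  "(\<And>i. i < 3 \<Longrightarrow> b i = d i) \<Longrightarrow> (\<And>i. i < 3 \<Longrightarrow> b' i = d' i) \<Longrightarrow> cross b b' i = cross d d' i"
  by (simp add: cross_def)

lemma nonzero_entry:
  assumes "A \<in> carrier_mat r c" "A \<noteq> 0\<^sub>m r c"
  obtains p q where "p < r" "q < c" "A $$ (p, q) \<noteq> 0"
proof (rule ccontr)
  assume "\<not> thesis"
  hence "A $$ (p, q) = 0" if "p < r" "q < c" for p q using that \<open>\<And>p q. p < r \<Longrightarrow> q < c \<Longrightarrow> A $$ (p, q) \<noteq> 0 \<Longrightarrow> thesis\<close> by blast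
  hence "A = 0\<^sub>m r c" using assms(1) by (intro eq_matI) auto
  with assms(2) show False by simp
qed

lemma (in irrep) Y_nonzero:
  assumes "m \<ge> 2"
  shows "\<exists>i<3. Y i \<noteq> 0\<^sub>m m m"
proof (rule ccontr)
  assume "\<not> ?thesis"
  hence "Op (Y i) = 0" if "i < 3" for i using that by (simp add: Op_zero)
  hence "casimir m \<star> Op (1\<^sub>m m) = 0" using Op_Cas by (simp del: One_nat_def)
  hence "Op (1\<^sub>m m) = 0" using casimir_nonzero[OF assms] by (rule scale_cancel)
  hence "1\<^sub>m m = (0\<^sub>m m m :: complex mat)" by (intro Op_eq_0) auto
  hence "(1\<^sub>m m :: complex mat) $$ (0, 0) = 0\<^sub>m m m $$ (0, 0)" by (simp only:)
  thus False using pos by simp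
qed

lemma cmod_det_unitary:
  assumes "U \<in> unitary_group N"
  shows "cmod (det U) = 1"
proof -
  note U = unitary_adjoint_mult[OF assms]
  interpret cnj: comm_ring_hom cnj by unfold_locales auto
  have "mat_adjoint U = transpose_mat (map_mat cnj U)"
    by (rule eq_matI) auto
  hence "det (mat_adjoint U) = cnj (det U)"
    using det_transpose[of "map_mat cnj U" N] U(1) by simp
  moreover have "det U * det (mat_adjoint U) = 1"
    using det_mult[OF U(1) mat_adjoint_carrier[OF U(1)]] U(2) by simp
  ultimately have "(cmod (det U))\<^sup>2 = 1"
    by (metis complex_norm_square of_real_eq_1_iff)
  thus ?thesis using norm_ge_zero[of "det U"] by (simp add: power2_eq_1_iff)
qed

text \<open>The factor is an \<open>N\<close>-th root of the inverse determinant, which has modulus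
  1.\<close>

lemma unitary_scale_to_SU:
  assumes U: "U \<in> unitary_group N" and N: "N > 0"
  obtains z where "cmod z = 1" "z \<cdot>\<^sub>m U \<in> SU N"
proof -
  have d: "cmod (det U) = 1" by (rule cmod_det_unitary[OF U])
  define z where "z = cis (- Arg (det U) / real N)"
  have z: "cmod z = 1" by (simp add: z_def)
  have "z ^ N = cis (- Arg (det U))" using N by (simp add: z_def DeMoivre)
  moreover have "det U = cis (Arg (det U))" using rcis_cmod_Arg[of "det U"] d by (simp add: rcis_def)
  ultimately have det: "z ^ N * det U = 1" by (metis cis_mult cis_zero add.left_inverse)
  note Uc = unitary_adjoint_mult[OF U]
  have "z \<cdot>\<^sub>m U * mat_adjoint (z \<cdot>\<^sub>m U) = 1\<^sub>m N"
  proof (rule Op_eqI)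
    have "z * cnj z = 1" using z by (simp add: complex_norm_square[symmetric])
    moreover have "Op U * Op (mat_adjoint U) = Op (1\<^sub>m N)" using Uc by (simp add: Op_mult[symmetric])
    ultimately show "Op (z \<cdot>\<^sub>m U * mat_adjoint (z \<cdot>\<^sub>m U)) = Op (1\<^sub>m N)"
      using Uc by (simp add: Op_mult Op_smult mat_adjoint_smult mult.commute)
  qed (use Uc in auto)
  hence "z \<cdot>\<^sub>m U \<in> SU N"
    using Uc(1) det by (simp add: SU_def unitary_group_def)
  with z that show ?thesis by blast
qed

text \<open>Writing the identity as a ladder of identities makes the block formula for
  \<open>ladder_rep\<close> available.\<close>

lemma ladder_rep_one:
  "ladder_rep (\<lambda>m _. 1\<^sub>m m) n k A = 1\<^sub>m (ladder_dim n k)"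
proof (induction k)
  case 0
  show ?case by (simp add: ladder_rep_def ladder_dim_def Let_def) (rule eq_matI; simp)
next
  case (Suc k)
  show ?case
    by (subst ladder_rep_Suc) (auto simp: Suc ladder_dim_Suc intro!: eq_matI)
qed

lemma Op_ladder_block_one:
  "a \<le> k \<Longrightarrow> b \<le> k \<Longrightarrow> Op (ladder_block n k a b (1\<^sub>m (ladder_dim n k))) = (if a = b then Op (1\<^sub>m (n + 2 * a)) else 0)"
  using ladder_rep_block[of k "\<lambda>m _. 1\<^sub>m m" n undefined a b] unfolding ladder_rep_one by (simp add: Op_zero)

lemma sum_neighbours:
  fixes h :: "nat \<Rightarrow> 'a :: comm_monoid_add"
  assumes "a \<le> k" "\<And>c. c \<le> k \<Longrightarrow> c \<noteq> a \<Longrightarrow> Suc c \<noteq> a \<Longrightarrow> c \<noteq> Suc a \<Longrightarrow> h c = 0"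
  shows "(\<Sum>c\<le>k. h c) = h a + (if a = 0 then 0 else h (a - 1)) + (if a < k then h (Suc a) else 0)"
proof -
  have "(\<Sum>c\<le>k. h c) = (\<Sum>c\<in>{a} \<union> (if a = 0 then {} else {a - 1}) \<union> (if a < k then {Suc a} else {}). h c)"
  proof (rule sum.mono_neutral_right)
    show "\<forall>c\<in>{..k} - ({a} \<union> (if a = 0 then {} else {a - 1}) \<union> (if a < k then {Suc a} else {})). h c = 0"
      by (intro ballI assms(2)) (auto split: if_splits)
  qed (use assms(1) in auto)
  also have "\<dots> = h a + (if a = 0 then 0 else h (a - 1)) + (if a < k then h (Suc a) else 0)"
    by (cases "a = 0"; cases "a < k") (auto simp: add_ac)
  finally show ?thesis .
qed

section \<open>Equations for the coefficients and removal of the phases\<close>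

context nahm_ladder
begin

lemma Op_blocks:
  assumes "t \<in> J" "i < 3"
  shows "a \<le> k \<Longrightarrow> Op (blk a a (M i t)) = F a t \<star> Op (Yb a i)"
    and "a < k \<Longrightarrow> Op (blk (Suc a) a (M i t)) = G a t \<star> Op (Bb a i)"
    and "a < k \<Longrightarrow> Op (blk a (Suc a) (M i t)) = (- cnj (G a t)) \<star> Op (mat_adjoint (Bb a i))"
    and "a \<le> k \<Longrightarrow> b \<le> k \<Longrightarrow> a \<noteq> b \<Longrightarrow> a \<noteq> Suc b \<Longrightarrow> b \<noteq> Suc a \<Longrightarrow> Op (blk a b (M i t)) = 0"
  using assms block_diag[OF assms(1) _ assms(2)] block_lower[OF assms(1) _ assms(2)]
    block_upper[OF assms(1) _ assms(2)] block_far[OF assms(1) _ _ assms(2)]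
  by (simp_all add: Op_smult Op_zero)

lemma cross_zero: "(\<And>i. i < 3 \<Longrightarrow> b i = 0) \<Longrightarrow> cross b b' i = 0" "(\<And>i. i < 3 \<Longrightarrow> b' i = 0) \<Longrightarrow> cross b b' i = 0"
  by (simp_all add: cross_def)

text \<open>For \<open>m = n + 2 * a\<close>, the contribution of the next larger summand to the
  diagonal block: the constant of \<open>cross_b'b\<close> for \<open>q = m\<close>. Below,
  \<open>down_coeff\<close> is minus the constant of \<open>cross_bb'\<close> for
  \<open>q = m - 2\<close>.\<close>

definition up_coeff :: "nat \<Rightarrow> complex" where
  "up_coeff a = 2 * (of_nat (n + 2 * a) + 2) / (of_nat (n + 2 * a) * (of_nat (n + 2 * a) + 1))"

definition down_coeff :: "nat \<Rightarrow> complex" where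
  "down_coeff a = 2 / (of_nat (n + 2 * a) - 1)"

lemma block_DM_diag:
  assumes t: "t \<in> J" and i: "i < 3" and a: "a \<le> k" "n + 2 * a \<ge> 2"
  shows "Op (blk a a (DM i t)) =
    ((F a t)\<^sup>2 + (if a = 0 then 0 else down_coeff a * (G (a - 1) t * cnj (G (a - 1) t)))
      - (if a < k then up_coeff a * (G a t * cnj (G a t)) else 0)) \<star> Op (Yb a i)"
proof -
  define h where "h c = cross (\<lambda>i. Op (blk a c (M i t))) (\<lambda>i. Op (blk c a (M i t))) i" for c
  have ha: "h a = (F a t)\<^sup>2 \<star> Op (Yb a i)"
  proof -
    have "h a = cross (\<lambda>i. F a t \<star> Op (Yb a i)) (\<lambda>i. F a t \<star> Op (Yb a i)) i"
      unfolding h_def by (rule cross_cong) (simp_all add: Op_blocks[OF t] a)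
    thus ?thesis using irrep.cross_self[OF irrep_Yb i] by (simp add: cross_scale power2_eq_square)
  qed
  have hd: "h (a - 1) = (down_coeff a * (G (a - 1) t * cnj (G (a - 1) t))) \<star> Op (Yb a i)" if "a \<noteq> 0"
  proof -
    obtain c where c: "a = Suc c" using \<open>a \<noteq> 0\<close> by (cases a) auto
    interpret normalized_intertwiner "n + 2 * c" "Yb (Suc c)" "Yb c" "Bb c" by (rule normalized_Bb)
    have "h c = cross (\<lambda>i. G c t \<star> b i) (\<lambda>i. (- cnj (G c t)) \<star> b' i) i"
      unfolding h_def c by (rule cross_cong) (use a c in \<open>simp_all add: Op_blocks[OF t]\<close>)
    also have "\<dots> = (2 / (of_nat (n + 2 * c) + 1) * (G c t * cnj (G c t))) \<star> Op (Yb a i)"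
      unfolding cross_scale cross_bb'[OF i] c by (simp add: mult.commute)
    also have "2 / (of_nat (n + 2 * c) + 1) = down_coeff a"
      unfolding down_coeff_def c by (simp add: algebra_simps)
    finally show ?thesis by (simp add: c)
  qed
  have hu: "h (Suc a) = (- (up_coeff a * (G a t * cnj (G a t)))) \<star> Op (Yb a i)" if "a < k"
  proof -
    interpret normalized_intertwiner "n + 2 * a" "Yb (Suc a)" "Yb a" "Bb a" by (rule normalized_Bb)
    have "h (Suc a) = cross (\<lambda>i. (- cnj (G a t)) \<star> b' i) (\<lambda>i. G a t \<star> b i) i"
      unfolding h_def by (rule cross_cong) (use that in \<open>simp_all add: Op_blocks[OF t]\<close>)
    also have "\<dots> = (- cnj (G a t) * G a t * up_coeff a) \<star> Op (Yb a i)"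
      unfolding cross_scale cross_b'b[OF i a(2)] up_coeff_def by simp
    finally show ?thesis by (simp add: mult_ac)
  qed
  have "Op (blk a a (DM i t)) = h a + (if a = 0 then 0 else h (a - 1)) + (if a < k then h (Suc a) else 0)"
    unfolding Op_block_DM[OF t i a(1) a(1)] h_def[symmetric]
  proof (rule sum_neighbours[OF a(1)])
    fix c assume "c \<le> k" "c \<noteq> a" "Suc c \<noteq> a" "c \<noteq> Suc a"
    thus "h c = 0" unfolding h_def by (intro cross_zero(1)) (use a in \<open>auto simp: Op_blocks(4)[OF t]\<close>)
  qed
  thus ?thesis using ha hd hu by (simp add: scale_add)
qed

lemma block_DM_lower:
  assumes t: "t \<in> J" and i: "i < 3" and a: "a < k"
  shows "Op (blk (Suc a) a (DM i t)) =
    (((of_nat (n + 2 * a) + 3) / 2 * F (Suc a) t - (of_nat (n + 2 * a) - 1) / 2 * F a t) * G a t) \<star> Op (Bb a i)"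
proof -
  interpret normalized_intertwiner "n + 2 * a" "Yb (Suc a)" "Yb a" "Bb a" by (rule normalized_Bb)
  define h where "h c = cross (\<lambda>i. Op (blk (Suc a) c (M i t))) (\<lambda>i. Op (blk c a (M i t))) i" for c
  have "h a = cross (\<lambda>i. G a t \<star> b i) (\<lambda>i. F a t \<star> Op (Yb a i)) i"
    unfolding h_def by (rule cross_cong) (use a in \<open>simp_all add: Op_blocks[OF t]\<close>)
  hence ha: "h a = (G a t * F a t * ((1 - of_nat (n + 2 * a)) / 2)) \<star> b i"
    unfolding cross_scale cross_bz[OF i] by simp
  have "h (Suc a) = cross (\<lambda>i. F (Suc a) t \<star> Op (Yb (Suc a) i)) (\<lambda>i. G a t \<star> b i) i"
    unfolding h_def by (rule cross_cong) (use a in \<open>simp_all add: Op_blocks[OF t]\<close>)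
  hence hs: "h (Suc a) = (F (Suc a) t * G a t * ((of_nat (n + 2 * a) + 3) / 2)) \<star> b i"
    unfolding cross_scale cross_yb[OF i] by simp
  have "Op (blk (Suc a) a (DM i t)) = (\<Sum>c\<le>k. h c)"
    unfolding h_def by (rule Op_block_DM[OF t i]) (use a in auto)
  also have "\<dots> = (\<Sum>c\<in>{a, Suc a}. h c)"
  proof (rule sum.mono_neutral_right)
    show "\<forall>c\<in>{..k} - {a, Suc a}. h c = 0"
    proof
      fix c assume c: "c \<in> {..k} - {a, Suc a}"
      show "h c = 0"
      \<comment> \<open>For \<open>c = a - 1\<close> the left factor is two steps off the diagonal;
        every other remaining \<open>c\<close> is not adjacent to \<open>a\<close>, so the right
        factor vanishes.\<close>
      proof (cases "Suc c = a")
        case True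
        thus ?thesis unfolding h_def using a by (intro cross_zero(1)) (auto simp: Op_blocks(4)[OF t])
      next
        case False
        thus ?thesis unfolding h_def using a c by (intro cross_zero(2)) (auto simp: Op_blocks(4)[OF t])
      qed
    qed
  qed (use a in auto)
  also have "\<dots> = (G a t * F a t * ((1 - of_nat (n + 2 * a)) / 2) + F (Suc a) t * G a t * ((of_nat (n + 2 * a) + 3) / 2)) \<star> b i"
    by (simp add: ha hs scale_add(4))
  also have "G a t * F a t * ((1 - of_nat (n + 2 * a)) / 2) + F (Suc a) t * G a t * ((of_nat (n + 2 * a) + 3) / 2)
    = ((of_nat (n + 2 * a) + 3) / 2 * F (Suc a) t - (of_nat (n + 2 * a) - 1) / 2 * F a t) * G a t"
    by (simp add: field_simps)
  finally show ?thesis .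
qed

text \<open>At a nonzero entry of the constant matrix \<open>C\<close> the coefficient is a fixed
  multiple of an entry of the triple. This gives its differentiability as well as its derivative,
  although it was obtained by choice at each time.\<close>

lemma coefficient_derivative:
  assumes t: "t \<in> J" and ab: "a \<le> k" "b \<le> k" and i: "i < 3"
    and C: "C \<in> carrier_mat (n + 2 * a) (n + 2 * b)" "C \<noteq> 0\<^sub>m (n + 2 * a) (n + 2 * b)"
    and M: "\<And>s. s \<in> J \<Longrightarrow> blk a b (M i s) = v s \<cdot>\<^sub>m C" and D: "Op (blk a b (DM i t)) = X \<star> Op C"
  shows "(v has_vector_derivative X) (at t)"
proof -
  obtain p q where pq: "p < n + 2 * a" "q < n + 2 * b" "C $$ (p, q) \<noteq> 0"
    using nonzero_entry[OF C] by blast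
  define P Q where "P = ladder_offset n k a + p" and "Q = ladder_offset n k b + q"
  have PQ: "P < N" "Q < N"
    unfolding P_def Q_def N_dim using ladder_offset_bound ab pq by auto
  have e: "blk a b A $$ (p, q) = A $$ (P, Q)" for A unfolding P_def Q_def using pq by simp
  have Ms: "M i s $$ (P, Q) = v s * C $$ (p, q)" if "s \<in> J" for s
    unfolding e[symmetric] M[OF that] using C(1) pq by simp
  have "blk a b (DM i t) = X \<cdot>\<^sub>m C"
    by (rule Op_eqI) (use C(1) D in \<open>auto simp: Op_smult\<close>)
  hence Ds: "DM i t $$ (P, Q) = X * C $$ (p, q)"
    unfolding e[symmetric] using C(1) pq by simp
  have "((\<lambda>s. M i s $$ (P, Q) * (1 / C $$ (p, q))) has_vector_derivative DM i t $$ (P, Q) * (1 / C $$ (p, q))) (at t)"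
    by (rule bounded_linear.has_vector_derivative[OF bounded_linear_mult_left M_derivative[OF t i PQ]])
  hence "((\<lambda>s. M i s $$ (P, Q) * (1 / C $$ (p, q))) has_vector_derivative X) (at t)"
    unfolding Ds using pq(3) by simp
  thus ?thesis
    by (rule has_vector_derivative_cong_open[OF _ J(1) t]) (use Ms pq(3) in simp)
qed

lemma F_derivative:
  assumes "t \<in> J" "a \<le> k" "n + 2 * a \<ge> 2"
  shows "(F a has_vector_derivative
    ((F a t)\<^sup>2 + (if a = 0 then 0 else down_coeff a * (G (a - 1) t * cnj (G (a - 1) t)))
      - (if a < k then up_coeff a * (G a t * cnj (G a t)) else 0))) (at t)"
proof -
  obtain i where i: "i < 3" "Yb a i \<noteq> 0\<^sub>m (n + 2 * a) (n + 2 * a)"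
    using irrep.Y_nonzero[OF irrep_Yb assms(3)] by blast
  show ?thesis
    by (rule coefficient_derivative[OF assms(1,2,2) i(1) irrep.carrier[OF irrep_Yb i(1)] i(2)
      block_diag[OF _ assms(2) i(1)] block_DM_diag[OF assms(1) i(1) assms(2,3)]])
qed

lemma G_derivative:
  assumes "t \<in> J" "a < k"
  shows "(G a has_vector_derivative
    (((of_nat (n + 2 * a) + 3) / 2 * F (Suc a) t - (of_nat (n + 2 * a) - 1) / 2 * F a t) * G a t)) (at t)"
proof -
  interpret normalized_intertwiner "n + 2 * a" "Yb (Suc a)" "Yb a" "Bb a" by (rule normalized_Bb)
  obtain i where i: "i < 3" "mat_adjoint (Bb a i) \<noteq> 0\<^sub>m (n + 2 * a) (n + 2 * a + 2)"
    using Bb_nonzero by blast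
  have c: "Bb a i \<in> carrier_mat (n + 2 * Suc a) (n + 2 * a)" using up.X_carrier[OF i(1)] by simp
  have nz: "Bb a i \<noteq> 0\<^sub>m (n + 2 * Suc a) (n + 2 * a)"
  proof
    assume "Bb a i = 0\<^sub>m (n + 2 * Suc a) (n + 2 * a)"
    hence "mat_adjoint (Bb a i) = 0\<^sub>m (n + 2 * a) (n + 2 * a + 2)" by (intro eq_matI) auto
    with i(2) show False ..
  qed
  show ?thesis
    by (rule coefficient_derivative[OF assms(1) _ _ i(1) c nz
      block_lower[OF _ assms(2) i(1)] block_DM_lower[OF assms(1) i(1) assms(2)]]) (use assms in auto)
qed

text \<open>Both the diagonal block and the generators are skew-adjoint, and some generator is
  nonzero when the dimension is at least 2.\<close>

lemma F_real:
  assumes "t \<in> J" "a \<le> k"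
  shows "Im (F a t) = 0"
proof (cases "n + 2 * a = 1")
  case True
  thus ?thesis by (simp add: F_def)
next
  case False
  hence "n + 2 * a \<ge> 2" using n by simp
  then obtain i where i: "i < 3" "Yb a i \<noteq> 0\<^sub>m (n + 2 * a) (n + 2 * a)"
    using irrep.Y_nonzero[OF irrep_Yb] by blast
  note c = irrep.carrier[OF irrep_Yb i(1), of a]
  obtain p q where pq: "p < n + 2 * a" "q < n + 2 * a" "Yb a i $$ (p, q) \<noteq> 0"
    using nonzero_entry[OF c i(2)] by blast
  have "mat_adjoint (F a t \<cdot>\<^sub>m Yb a i) = - (F a t \<cdot>\<^sub>m Yb a i)"
    using block_adjoint[OF i(1) assms(1,2,2)] block_diag[OF assms i(1)] by simp
  hence "cnj (F a t) \<cdot>\<^sub>m (- Yb a i) = - (F a t \<cdot>\<^sub>m Yb a i)"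
    unfolding mat_adjoint_smult irrep.adjoint[OF irrep_Yb i(1)] .
  from arg_cong[OF this, of "\<lambda>A. A $$ (p, q)"] have "cnj (F a t) * Yb a i $$ (p, q) = F a t * Yb a i $$ (p, q)"
    using c pq by simp
  hence "cnj (F a t) = F a t" using pq(3) by simp
  thus ?thesis by (simp add: complex_eq_iff)
qed

definition f :: "nat \<Rightarrow> real \<Rightarrow> real" where "f a t = Re (F a t)"

lemma F_eq: "t \<in> J \<Longrightarrow> a \<le> k \<Longrightarrow> F a t = of_real (f a t)"
  using F_real by (simp add: f_def complex_eq_iff)

definition growth :: "nat \<Rightarrow> real \<Rightarrow> real" where
  "growth a t = real (n + 2 * a + 3) / 2 * f (a + 1) t - (real (n + 2 * a) - 1) / 2 * f a t"

lemma f_continuous: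
  assumes "a \<le> k"
  shows "continuous_on J (f a)"
proof (cases "n + 2 * a = 1")
  case True
  hence "f a = (\<lambda>t. 0)" by (auto simp: f_def F_def)
  thus ?thesis by simp
next
  case False
  hence "n + 2 * a \<ge> 2" using n by simp
  have "continuous (at t) (f a)" if "t \<in> J" for t
    unfolding f_def
    by (rule has_vector_derivative_continuous)
      (rule bounded_linear.has_vector_derivative[OF bounded_linear_Re F_derivative[OF that assms \<open>n + 2 * a \<ge> 2\<close>]])
  thus ?thesis by (intro continuous_at_imp_continuous_on) blast
qed

lemma phases:
  obtains \<eta> where "\<And>a. a < k \<Longrightarrow> cmod (\<eta> a) = 1" "\<And>a t. a < k \<Longrightarrow> t \<in> J \<Longrightarrow> Im (\<eta> a * G a t) = 0"
proof -
  have "\<exists>w. cmod w = 1 \<and> (\<forall>t\<in>J. Im (w * G a t) = 0)" if a: "a < k" for a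
  proof -
    have "continuous_on J (growth a)"
      unfolding growth_def using a by (intro continuous_intros f_continuous) auto
    moreover have "(G a has_vector_derivative of_real (growth a t) * G a t) (at t)" if "t \<in> J" for t
      using G_derivative[OF that a] a by (simp add: growth_def F_eq[OF that])
    ultimately obtain w where "cmod w = 1" "\<And>t. t \<in> J \<Longrightarrow> Im (w * G a t) = 0"
      using linear_ode_constant_phase[OF J(2)] by blast
    thus ?thesis by blast
  qed
  hence "\<exists>\<eta>. \<forall>a<k. cmod (\<eta> a) = 1 \<and> (\<forall>t\<in>J. Im (\<eta> a * G a t) = 0)" by (intro choice) auto
  thus ?thesis using that by blast
qed

text \<open>A block scalar matrix commutes with the representation. Transported back by
  \<open>W\<close> it is unitary, and the global phase that corrects its determinant cancels in the
  conjugation.\<close>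

lemma gauge:
  assumes w: "\<And>a. cmod (w a) = 1"
  obtains S where "S \<in> SU N" "\<And>A. A \<in> so3 \<Longrightarrow> S * \<rho> A = \<rho> A * S"
    "\<And>a b i t. a \<le> k \<Longrightarrow> b \<le> k \<Longrightarrow> i < 3 \<Longrightarrow> t \<in> J \<Longrightarrow>
       Op (blk a b (conj_by W (conj_by S (T i t)))) = (w a * cnj (w b)) \<star> Op (blk a b (M i t))"
proof -
  \<comment> \<open>\<open>(m - n) div 2\<close> recovers the summand index \<open>a\<close> from
    the size \<open>m = n + 2 * a\<close>; the argument of the ladder is a dummy.\<close>
  define L where "L = ladder_rep (\<lambda>m _. w ((m - n) div 2) \<cdot>\<^sub>m 1\<^sub>m m) n k (0\<^sub>m 3 3)"
  have L: "L \<in> carrier_mat N N" unfolding L_def N_dim by (rule ladder_rep_carrier) simp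
  have bl: "Op (blk c d L) = (if c = d then w c \<star> Op (1\<^sub>m (n + 2 * c)) else 0)" if "c \<le> k" "d \<le> k" for c d
    unfolding L_def using that
    by (subst ladder_rep_block) (auto simp: Op_smult Op_zero)
  have bl': "Op (blk c d (mat_adjoint L)) = (if c = d then cnj (w c) \<star> Op (1\<^sub>m (n + 2 * c)) else 0)"
    if "c \<le> k" "d \<le> k" for c d
  proof -
    have "blk c d (mat_adjoint L) = mat_adjoint (blk d c L)"
      by (rule ladder_block_linear(4)[OF L[unfolded N_dim] L[unfolded N_dim] that])
    also have "blk d c L = (if d = c then w c \<cdot>\<^sub>m 1\<^sub>m (n + 2 * c) else 0\<^sub>m (n + 2 * d) (n + 2 * c))"
      by (rule Op_inj[of _ "n + 2 * d" "n + 2 * c"]) (use bl[OF that(2,1)] in \<open>auto simp: Op_smult Op_zero\<close>)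
    finally show ?thesis
      by (cases "d = c") (simp_all add: mat_adjoint_smult mat_adjoint_one mat_adjoint_zero Op_smult Op_zero)
  qed
  have La: "mat_adjoint L \<in> carrier_mat N N" using L by simp
  have ww: "w a * cnj (w a) = 1" for a using w[of a] by (simp add: complex_norm_square[symmetric])
  have LL: "L * mat_adjoint L = 1\<^sub>m N"
  proof (rule ladder_blocks_eqI[of _ n k])
    fix a b assume ab: "a \<le> k" "b \<le> k"
    show "blk a b (L * mat_adjoint L) = blk a b (1\<^sub>m N)"
    proof (rule Op_eqI)
      show "Op (blk a b (L * mat_adjoint L)) = Op (blk a b (1\<^sub>m N))"
        unfolding Op_block_diagonal_mult(1)[OF L La ab bl, simplified]
        using ab bl'[OF ab] Op_ladder_block_one[OF ab] ww by (simp add: N_dim Op_one_left)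
    qed auto
  qed (use mult_carrier_mat[OF L La] in \<open>auto simp: N_dim\<close>)
  have LU: "L \<in> unitary_group N" using L LL by (simp add: unitary_group_def)
  note Wc = unitary_adjoint_mult[OF W]
  have WaU: "mat_adjoint W \<in> unitary_group N" using Wc by (simp add: unitary_group_def)
  define V where "V = conj_by (mat_adjoint W) L"
  have V: "V \<in> carrier_mat N N" unfolding V_def by (rule conj_by_carrier[OF WaU L])
  have omV: "Op V = Op (mat_adjoint W) * Op L * Op W"
    unfolding V_def Op_conj_by[OF WaU L] by simp
  have omVa: "Op (mat_adjoint V) = Op (mat_adjoint W) * Op (mat_adjoint L) * Op W"
    unfolding V_def mat_adjoint_conj_by[OF WaU L] Op_conj_by[OF WaU La] by simp
  have "V * mat_adjoint V = 1\<^sub>m N"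
  proof (rule Op_eqI)
    have "Op L * Op (mat_adjoint L) = Op (1\<^sub>m N)" using LL L by (simp add: Op_mult[symmetric])
    hence "Op L * (Op (mat_adjoint L) * Op W) = Op W"
      using Op_one_left[of W N] Wc(1) by (simp add: mult.assoc[symmetric])
    moreover have "Op (mat_adjoint W) * Op W = Op (1\<^sub>m N)" using Wc by (simp add: Op_mult[symmetric])
    ultimately show "Op (V * mat_adjoint V) = Op (1\<^sub>m N)"
      using V by (simp add: Op_mult omV omVa mult.assoc Op_unitary[OF W La])
  qed (use V in auto)
  hence VU: "V \<in> unitary_group N" using V by (simp add: unitary_group_def)
  have "N > 0" unfolding N using n by (intro sum_pos) auto
  then obtain z where z: "cmod z = 1" "z \<cdot>\<^sub>m V \<in> SU N" by (rule unitary_scale_to_SU[OF VU])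
  have zz: "z * cnj z = 1" using z by (simp add: complex_norm_square[symmetric])
  define S where "S = z \<cdot>\<^sub>m V"
  have SU: "S \<in> unitary_group N" "S \<in> carrier_mat N N" using z(2) V by (auto simp: S_def SU_def)
  have omS: "Op S = z \<star> Op V" "Op (mat_adjoint S) = cnj z \<star> Op (mat_adjoint V)"
    by (simp_all add: S_def Op_smult mat_adjoint_smult)
  show ?thesis
  proof (rule that)
    show "S \<in> SU N" unfolding S_def by (rule z)
    show "S * \<rho> A = \<rho> A * S" if A: "A \<in> so3" for A
    proof (rule Op_eqI)
      define R where "R = ladder_rep \<phi> n k A"
      have rc: "\<rho> A \<in> carrier_mat N N" using induce A by (simp add: generators_induce_rep_def so3_rep_def)
      have Rc: "R \<in> carrier_mat N N" unfolding R_def decomposition[OF A, symmetric] by (rule conj_by_carrier[OF W rc])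
      have "Op R = Op W * Op (\<rho> A) * Op (mat_adjoint W)"
        unfolding R_def decomposition[OF A, symmetric] by (rule Op_conj_by[OF W rc])
      hence "Op (mat_adjoint W) * Op R * Op W = Op (\<rho> A) * (Op (mat_adjoint W) * Op W)"
        by (simp add: mult.assoc Op_unitary[OF W rc])
      also have "Op (mat_adjoint W) * Op W = Op (1\<^sub>m N)" using Wc by (simp add: Op_mult[symmetric])
      finally have r: "Op (\<rho> A) = Op (mat_adjoint W) * (Op R * Op W)"
        using rc by (simp add: Op_one_right mult.assoc)
      have "L * R = R * L"
      proof (rule ladder_blocks_eqI[of _ n k])
        fix a b assume ab: "a \<le> k" "b \<le> k"
        show "blk a b (L * R) = blk a b (R * L)"
        proof (rule Op_eqI)
          have "Op (blk a b R) = 0" if "a \<noteq> b"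
            using Op_block_ladder_rep[OF A ab] that unfolding R_def by simp
          thus "Op (blk a b (L * R)) = Op (blk a b (R * L))"
            unfolding Op_block_diagonal_mult(1)[OF L Rc ab bl, simplified]
              Op_block_diagonal_mult(2)[OF L Rc ab bl, simplified]
            by (cases "a = b") (simp_all add: Op_one_left Op_one_right)
        qed auto
      qed (use mult_carrier_mat[OF L Rc] mult_carrier_mat[OF Rc L] in \<open>auto simp: N_dim\<close>)
      hence "Op L * Op R = Op R * Op L" using L Rc by (simp add: Op_mult[symmetric])
      hence LR: "Op L * (Op R * x) = Op R * (Op L * x)" for x by (simp add: mult.assoc[symmetric])
      show "Op (S * \<rho> A) = Op (\<rho> A * S)"
        using SU(2) rc by (simp add: Op_mult omS omV r mult.assoc Op_unitary[OF W Rc] Op_unitary[OF W L] LR)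
    qed (use SU(2) induce A in \<open>auto simp: generators_induce_rep_def so3_rep_def\<close>)
    fix a b i t assume ab: "a \<le> k" "b \<le> k" and i: "i < (3::nat)" and t: "t \<in> J"
    note Tc = T_carrier[OF i t] and Mc = M_carrier[OF i t]
    have "conj_by W (conj_by S (T i t)) = L * (M i t * mat_adjoint L)"
    proof (rule Op_inj[OF conj_by_carrier[OF W conj_by_carrier[OF SU(1) Tc]] mult_carrier_mat[OF L mult_carrier_mat[OF Mc La]]])
      have "Op (L * (M i t * mat_adjoint L)) = Op L * (Op W * (Op (T i t) * (Op (mat_adjoint W) * Op (mat_adjoint L))))"
        using L La Mc Op_conj_by[OF W Tc] by (simp add: Op_mult M_def mult.assoc)
      moreover have "Op (conj_by W (conj_by S (T i t))) =
         Op W * (Op (mat_adjoint W) * (Op L * (Op W * (Op (T i t) * (Op (mat_adjoint W) * (Op (mat_adjoint L) * (Op W * Op (mat_adjoint W))))))))"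
        unfolding Op_conj_by[OF W conj_by_carrier[OF SU(1) Tc]] Op_conj_by[OF SU(1) Tc] omS omV omVa
        using zz by (simp add: mult.assoc mult.commute)
      moreover have "Op W * Op (mat_adjoint W) = Op (1\<^sub>m N)"
        using Wc by (simp add: Op_mult[symmetric])
      moreover have "Op (mat_adjoint L) * Op (1\<^sub>m N) = Op (mat_adjoint L)"
        using L by (intro Op_one_right) simp
      ultimately show "Op (conj_by W (conj_by S (T i t))) = Op (L * (M i t * mat_adjoint L))"
        by (simp add: Op_unitary[OF W L])
    qed
    thus "Op (blk a b (conj_by W (conj_by S (T i t)))) = (w a * cnj (w b)) \<star> Op (blk a b (M i t))"
      using Op_block_diagonal_mult(1)[OF L mult_carrier_mat[OF Mc La] ab bl, simplified]
        Op_block_diagonal_mult(2)[OF La Mc ab bl', simplified]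
      by (simp add: Op_one_left Op_one_right mult.assoc[symmetric])
  qed
qed

text \<open>Only the squared modulus of \<open>G\<close> enters, so any real \<open>g\<close> with
  the same squares will do. The conventions at both ends replace the case distinctions for the
  extreme summands.\<close>

lemma f_derivative:
  assumes t: "t \<in> J" and a: "a \<le> k" "n + 2 * a \<ge> 2"
    and g: "\<And>a t. a < k \<Longrightarrow> t \<in> J \<Longrightarrow> G a t * cnj (G a t) = of_real ((g a t)\<^sup>2)" "\<And>t. g k t = 0"
  shows "(f a has_real_derivative
      (f a t)\<^sup>2 + 2 / (real (n + 2 * a) - 1) * (shifted g a t)\<^sup>2
      - 2 * real (n + 2 * a + 2) / (real (n + 2 * a) * real (n + 2 * a + 1)) * (g a t)\<^sup>2) (at t)"
proof -
  define d where "d = (f a t)\<^sup>2 + 2 / (real (n + 2 * a) - 1) * (shifted g a t)\<^sup>2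
      - 2 * real (n + 2 * a + 2) / (real (n + 2 * a) * real (n + 2 * a + 1)) * (g a t)\<^sup>2"
  have 1: "(if a = 0 then 0 else down_coeff a * (G (a - 1) t * cnj (G (a - 1) t)))
      = of_real (2 / (real (n + 2 * a) - 1) * (shifted g a t)\<^sup>2)"
    using a g(1)[OF _ t, of "a - 1"] by (cases a) (simp_all add: down_coeff_def)
  have 2: "(if a < k then up_coeff a * (G a t * cnj (G a t)) else 0)
      = of_real (2 * real (n + 2 * a + 2) / (real (n + 2 * a) * real (n + 2 * a + 1)) * (g a t)\<^sup>2)"
    using a g(1)[OF _ t, of a] g(2) by (cases "a < k") (simp_all add: up_coeff_def add_ac)
  have "(F a has_vector_derivative of_real d) (at t)"
    using F_derivative[OF t a] unfolding 1 2 F_eq[OF t a(1)] d_def of_real_diff of_real_add of_real_power .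
  from bounded_linear.has_vector_derivative[OF bounded_linear_Re this]
  moreover have "f a = (\<lambda>t. Re (F a t))" by (simp add: f_def fun_eq_iff)
  ultimately have "(f a has_real_derivative d) (at t)"
    by (simp only: has_real_derivative_iff_has_vector_derivative Re_complex_of_real)
  thus ?thesis unfolding d_def .
qed

lemma block_form_and_equations:
  "\<exists>S\<in>SU N. (\<forall>A\<in>so3. S * \<rho> A = \<rho> A * S) \<and>
    (\<exists>f g :: nat \<Rightarrow> real \<Rightarrow> real.
       (\<forall>a\<le>k. real_analytic_on (f a) J) \<and>
       (\<forall>a<k. real_analytic_on (g a) J) \<and>
       (\<forall>t. g k t = 0) \<and>
       (\<forall>i<3. \<forall>t\<in>J. \<forall>a\<le>k. \<forall>b\<le>k.
          ladder_block n k a b (conj_by W (conj_by S (T i t))) =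
            (if a = b then complex_of_real (f a t) \<cdot>\<^sub>m \<phi> (n + 2 * a) (so3_basis i)
             else if a = b + 1 then complex_of_real (g b t) \<cdot>\<^sub>m B (n + 2 * b) i
             else if b = a + 1 then complex_of_real (- g a t) \<cdot>\<^sub>m mat_adjoint (B (n + 2 * a) i)
             else 0\<^sub>m (n + 2 * a) (n + 2 * b))) \<and>
       (n = 1 \<longrightarrow>
          (\<forall>i<3. \<phi> 1 (so3_basis i) = 0\<^sub>m 1 1) \<and>
          (\<forall>t\<in>J. \<forall>a\<in>{1..k}.
             (f a has_real_derivative
                (f a t)\<^sup>2 + 1 / real a * (shifted g a t)\<^sup>2
                - real (2 * a + 3) / real ((2 * a + 1) * (a + 1)) * (g a t)\<^sup>2) (at t)) \<and>
          (\<forall>t\<in>J. \<forall>a<k.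
             (g a has_real_derivative
                (real (a + 2) * f (a + 1) t - real a * f a t) * g a t) (at t))) \<and>
       (n \<ge> 2 \<longrightarrow>
          (\<forall>t\<in>J. \<forall>a\<le>k.
             (f a has_real_derivative
                (f a t)\<^sup>2 + 2 / (real (n + 2 * a) - 1) * (shifted g a t)\<^sup>2
                - 2 * real (n + 2 * a + 2) / (real (n + 2 * a) * real (n + 2 * a + 1)) * (g a t)\<^sup>2) (at t)) \<and>
          (\<forall>t\<in>J. \<forall>a<k.
             (g a has_real_derivative
                (real (n + 2 * a + 3) / 2 * f (a + 1) t
                 - (real (n + 2 * a) - 1) / 2 * f a t) * g a t) (at t))))"
proof -
  obtain \<eta> where \<eta>: "\<And>a. a < k \<Longrightarrow> cmod (\<eta> a) = 1" "\<And>a t. a < k \<Longrightarrow> t \<in> J \<Longrightarrow> Im (\<eta> a * G a t) = 0"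
    using phases by blast
  \<comment> \<open>Partial products of the phases, so that the ratio of consecutive block scalars
    is \<open>\<eta> a\<close>; the value 1 beyond the range keeps the modulus equal to 1 for all
    indices.\<close>
  define w where "w a = (\<Prod>c<a. if c < k then \<eta> c else 1)" for a
  have w: "cmod (w a) = 1" for a
    unfolding w_def prod_norm[symmetric] by (rule prod.neutral) (simp add: \<eta>)
  have ww: "w a * cnj (w a) = 1" for a using w[of a] by (simp add: complex_norm_square[symmetric])
  have w_Suc: "w (Suc a) * cnj (w a) = \<eta> a" if "a < k" for a
    using ww[of a] that by (simp add: w_def mult.commute mult.left_commute)
  obtain S where gS: "S \<in> SU N" "\<And>A. A \<in> so3 \<Longrightarrow> S * \<rho> A = \<rho> A * S"
    and blocks: "\<And>a b i t. a \<le> k \<Longrightarrow> b \<le> k \<Longrightarrow> i < 3 \<Longrightarrow> t \<in> J \<Longrightarrow>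
       Op (blk a b (conj_by W (conj_by S (T i t)))) = (w a * cnj (w b)) \<star> Op (blk a b (M i t))"
    using gauge[of w] w by blast
  define g where "g a t = (if a < k then Re (\<eta> a * G a t) else 0)" for a t
  have gk: "g k t = 0" for t by (simp add: g_def)
  have G: "\<eta> a * G a t = of_real (g a t)" if "a < k" "t \<in> J" for a t
    using \<eta>(2)[OF that] that by (simp add: g_def complex_eq_iff)
  have GG: "G a t * cnj (G a t) = of_real ((g a t)\<^sup>2)" if "a < k" "t \<in> J" for a t
  proof -
    have "cmod (G a t) = \<bar>g a t\<bar>"
      using arg_cong[OF G[OF that], of cmod] \<eta>(1)[OF that(1)] by (simp add: norm_mult)
    hence "(cmod (G a t))\<^sup>2 = (g a t)\<^sup>2" by simp
    thus ?thesis by (simp only: complex_norm_square[symmetric])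
  qed
  note f_der = f_derivative[OF _ _ _ GG gk]
  have g_der: "(g a has_real_derivative growth a t * g a t) (at t)" if t: "t \<in> J" and a: "a < k" for a t
  proof -
    have "((\<lambda>t. \<eta> a * G a t) has_vector_derivative \<eta> a * (of_real (growth a t) * G a t)) (at t)"
      using G_derivative[OF t a] a
      by (intro bounded_linear.has_vector_derivative[OF bounded_linear_mult_right])
        (simp add: growth_def F_eq[OF t])
    also have "\<eta> a * (of_real (growth a t) * G a t) = of_real (growth a t * g a t)"
      using G[OF a t] by (simp add: mult.left_commute)
    finally have "((\<lambda>t. Re (\<eta> a * G a t)) has_vector_derivative Re (of_real (growth a t * g a t))) (at t)"
      by (rule bounded_linear.has_vector_derivative[OF bounded_linear_Re])
    moreover have "g a = (\<lambda>t. Re (\<eta> a * G a t))" using a by (simp add: g_def fun_eq_iff)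
    ultimately show ?thesis by (simp add: has_real_derivative_iff_has_vector_derivative)
  qed
  \<comment> \<open>The unknowns are indexed by pairs: \<open>(True, a)\<close> stands for
    \<open>f a\<close> and \<open>(False, a)\<close> for \<open>g a\<close>. The monomials for
    \<open>f a\<close> are the squares of \<open>f a\<close>, \<open>g (a - 1)\<close> and
    \<open>g a\<close>; those for \<open>g a\<close> are \<open>g a\<close> times
    \<open>f (a + 1)\<close> and \<open>f a\<close>.\<close>
  define x where "x s = (if fst s then f (snd s) else g (snd s))" for s :: "bool \<times> nat"
  define p where "p s r = (if fst s then (if r = 0 then (True, snd s) else if r = 1 then (False, snd s - 1) else (False, snd s))
     else (if r = 0 then (True, min (Suc (snd s)) k) else (True, snd s)))" for s :: "bool \<times> nat" and r :: nat
  define q where "q s r = (if fst s then p s r else (False, snd s))" for s :: "bool \<times> nat" and r :: nat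
  \<comment> \<open>Zero coefficients neutralize the boundary cases: the truncated index
    \<open>a - 1\<close> at \<open>a = 0\<close>, the index cut off by \<open>min\<close> at
    \<open>a = k\<close>, and the diagonal function of the one-dimensional summand.\<close>
  define c where "c s r = (if fst s then
      (if n + 2 * snd s = 1 then 0 else if r = 0 then 1
       else if r = 1 then (if snd s = 0 then 0 else 2 / (real (n + 2 * snd s) - 1))
       else - (2 * real (n + 2 * snd s + 2) / (real (n + 2 * snd s) * real (n + 2 * snd s + 1))))
     else (if \<not> snd s < k then 0 else if r = 0 then real (n + 2 * snd s + 3) / 2
       else if r = 1 then - ((real (n + 2 * snd s) - 1) / 2) else 0))" for s :: "bool \<times> nat" and r :: nat
  have sum3: "(\<Sum>r<3. h r) = h 0 + h 1 + h 2" for h :: "nat \<Rightarrow> real"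
    by (simp add: numeral_3_eq_3 numeral_2_eq_2)
  interpret quadratic_system "UNIV \<times> {..k}" "{..<3}" c p q x J
  proof
    show "p s r \<in> UNIV \<times> {..k} \<and> q s r \<in> UNIV \<times> {..k}" if "s \<in> UNIV \<times> {..k}" for s :: "bool \<times> nat" and r
      using that by (auto simp: p_def q_def)
    fix s :: "bool \<times> nat" and t assume s: "s \<in> UNIV \<times> {..k}" and t: "t \<in> J"
    obtain b a where ba: "s = (b, a)" "a \<le> k" using s by auto
    consider "b" "n + 2 * a = 1" | "b" "n + 2 * a \<noteq> 1" | "\<not> b" "a < k" | "\<not> b" "a = k" using ba by linarith
    thus "(x s has_real_derivative (\<Sum>r<3. c s r * (x (p s r) t * x (q s r) t))) (at t)"
    proof cases
      case 1
      hence "f a = (\<lambda>t. 0)" by (auto simp: f_def F_def)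
      thus ?thesis using 1 ba unfolding sum3 by (simp add: x_def c_def)
    next
      case 2
      hence "n + 2 * a \<ge> 2" using n by simp
      from f_der[OF t ba(2) this] show ?thesis
        unfolding sum3 using 2 ba by (cases a) (simp_all add: x_def c_def p_def q_def power2_eq_square)
    next
      case 3
      from g_der[OF t 3(2)] show ?thesis
        unfolding sum3 using 3 ba by (simp add: x_def c_def p_def q_def growth_def algebra_simps)
    next
      case 4
      hence "g a = (\<lambda>t. 0)" by (simp add: gk fun_eq_iff)
      thus ?thesis using 4 ba unfolding sum3 by (simp add: x_def c_def)
    qed
  qed (use J in auto)
  have f_an: "real_analytic_on (f a) J" and g_an: "real_analytic_on (g a) J" if "a \<le> k" for a
    using analytic[of "(True, a)"] analytic[of "(False, a)"] that by (simp_all add: x_def)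
  have blk_eq: "blk a b (conj_by W (conj_by S (T i t))) =
      (if a = b then complex_of_real (f a t) \<cdot>\<^sub>m Yb a i
       else if a = b + 1 then complex_of_real (g b t) \<cdot>\<^sub>m Bb b i
       else if b = a + 1 then complex_of_real (- g a t) \<cdot>\<^sub>m mat_adjoint (Bb a i)
       else 0\<^sub>m (n + 2 * a) (n + 2 * b))"
    if i: "i < 3" and t: "t \<in> J" and ab: "a \<le> k" "b \<le> k" for i t a b
  proof -
    note bl = blocks[OF ab i t]
    have Yd: "dim_row (Yb a i) = n + 2 * a" "dim_col (Yb a i) = n + 2 * a" for a
      using irrep.carrier[OF irrep_Yb i, of a] by auto
    have Bd: "dim_row (Bb a i) = n + 2 * a + 2" "dim_col (Bb a i) = n + 2 * a" for a
      using intertwinerD[OF normalized_intertwiner.B[OF normalized_Bb] i, of a] by auto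
    consider "a = b" | "a = Suc b" | "b = Suc a" | "a \<noteq> b" "a \<noteq> Suc b" "b \<noteq> Suc a" by blast
    thus ?thesis
    proof cases
      case 1
      have "blk a a (conj_by W (conj_by S (T i t))) = complex_of_real (f a t) \<cdot>\<^sub>m Yb a i"
        by (rule Op_eqI) (use bl 1 ab in \<open>simp_all add: Yd Op_smult Op_blocks(1)[OF t i] ww F_eq[OF t]\<close>)
      thus ?thesis using 1 by simp
    next
      case 2
      hence b: "b < k" using ab by simp
      have "blk (Suc b) b (conj_by W (conj_by S (T i t))) = complex_of_real (g b t) \<cdot>\<^sub>m Bb b i"
        by (rule Op_eqI) (use bl 2 b in \<open>simp_all add: Bd Op_smult Op_blocks(2)[OF t i] w_Suc G[OF _ t]\<close>)
      thus ?thesis using 2 by simp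
    next
      case 3
      hence a: "a < k" using ab by simp
      \<comment> \<open>For the upper block the ratio of the block scalars is conjugated, which
        matches the conjugate of \<open>G\<close> there, so one choice of phases makes both blocks
        real multiples.\<close>
      have "w a * cnj (w (Suc a)) * - cnj (G a t) = - cnj (w (Suc a) * cnj (w a) * G a t)"
        by (simp add: mult_ac)
      also have "\<dots> = of_real (- g a t)" unfolding w_Suc[OF a] G[OF a t] by simp
      finally have e: "w a * cnj (w (Suc a)) * - cnj (G a t) = of_real (- g a t)" .
      have "blk a (Suc a) (conj_by W (conj_by S (T i t))) = complex_of_real (- g a t) \<cdot>\<^sub>m mat_adjoint (Bb a i)"
      proof (rule Op_eqI)
        show "Op (blk a (Suc a) (conj_by W (conj_by S (T i t)))) = Op (complex_of_real (- g a t) \<cdot>\<^sub>m mat_adjoint (Bb a i))"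
          unfolding bl[unfolded 3] Op_blocks(3)[OF t i a] scale_simps(3) e Op_smult ..
      qed (use Bd in simp_all)
      thus ?thesis using 3 by simp
    next
      case 4
      have "blk a b (conj_by W (conj_by S (T i t))) = 0\<^sub>m (n + 2 * a) (n + 2 * b)"
        by (rule Op_eqI) (use bl Op_blocks(4)[OF t i ab 4] in \<open>simp_all add: Op_zero\<close>)
      thus ?thesis using 4 by simp
    qed
  qed
  show ?thesis
  proof (rule bexI[OF _ gS(1)], rule conjI, use gS(2) in blast,
      rule exI[of _ f], rule exI[of _ g], intro conjI impI)
    show "\<forall>a\<le>k. real_analytic_on (f a) J" "\<forall>a<k. real_analytic_on (g a) J" using f_an g_an by auto
    show "\<forall>t. g k t = 0" using gk by blast
    show "\<forall>i<3. \<forall>t\<in>J. \<forall>a\<le>k. \<forall>b\<le>k. blk a b (conj_by W (conj_by S (T i t))) =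
      (if a = b then complex_of_real (f a t) \<cdot>\<^sub>m Yb a i
       else if a = b + 1 then complex_of_real (g b t) \<cdot>\<^sub>m Bb b i
       else if b = a + 1 then complex_of_real (- g a t) \<cdot>\<^sub>m mat_adjoint (Bb a i)
       else 0\<^sub>m (n + 2 * a) (n + 2 * b))" using blk_eq by blast
  next
    assume n1: "n = 1"
    show "\<forall>i<3. \<phi> 1 (so3_basis i) = 0\<^sub>m 1 1"
      using irrep.Y_eq_0[OF irrep_Yb, of 0] n1 by simp
    show "\<forall>t\<in>J. \<forall>a\<in>{1..k}. (f a has_real_derivative (f a t)\<^sup>2 + 1 / real a * (shifted g a t)\<^sup>2
        - real (2 * a + 3) / real ((2 * a + 1) * (a + 1)) * (g a t)\<^sup>2) (at t)"
    proof (intro ballI)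
      fix t a assume t: "t \<in> J" and a: "a \<in> {1..k}"
      have "2 / (real (n + 2 * a) - 1) = 1 / real a" using n1 a by (simp add: field_simps)
      moreover have "2 * real (n + 2 * a + 2) / (real (n + 2 * a) * real (n + 2 * a + 1))
          = real (2 * a + 3) / real ((2 * a + 1) * (a + 1))"
      proof -
        \<comment> \<open>For \<open>n = 1\<close> the factor \<open>n + 2 * a + 1\<close> is even
          and cancels the 2 in the numerator.\<close>
        have "real (n + 2 * a + 1) = 2 * real (a + 1)" "real (n + 2 * a + 2) = real (2 * a + 3)" "real (n + 2 * a) = real (2 * a + 1)"
          using n1 by simp_all
        thus ?thesis by (simp only: of_nat_mult mult.left_commute mult_divide_mult_cancel_left)
      qed
      ultimately show "(f a has_real_derivative (f a t)\<^sup>2 + 1 / real a * (shifted g a t)\<^sup>2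
          - real (2 * a + 3) / real ((2 * a + 1) * (a + 1)) * (g a t)\<^sup>2) (at t)"
        using f_der[OF t, of a] a n1 by (simp only:) simp
    qed
    show "\<forall>t\<in>J. \<forall>a<k. (g a has_real_derivative (real (a + 2) * f (a + 1) t - real a * f a t) * g a t) (at t)"
    proof (intro ballI allI impI)
      fix t a assume t: "t \<in> J" and a: "a < k"
      have "growth a t = real (a + 2) * f (a + 1) t - real a * f a t"
      proof -
        have "real (n + 2 * a + 3) / 2 = real (a + 2)" "(real (n + 2 * a) - 1) / 2 = real a"
          using n1 by (simp_all add: field_simps)
        thus ?thesis unfolding growth_def by (simp only:)
      qed
      thus "(g a has_real_derivative (real (a + 2) * f (a + 1) t - real a * f a t) * g a t) (at t)"
        using g_der[OF t a] by simp
    qed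
  next
    assume n2: "n \<ge> 2"
    show "\<forall>t\<in>J. \<forall>a\<le>k. (f a has_real_derivative
        (f a t)\<^sup>2 + 2 / (real (n + 2 * a) - 1) * (shifted g a t)\<^sup>2
        - 2 * real (n + 2 * a + 2) / (real (n + 2 * a) * real (n + 2 * a + 1)) * (g a t)\<^sup>2) (at t)"
      using f_der n2 by auto
    show "\<forall>t\<in>J. \<forall>a<k. (g a has_real_derivative
        (real (n + 2 * a + 3) / 2 * f (a + 1) t - (real (n + 2 * a) - 1) / 2 * f a t) * g a t) (at t)"
      using g_der unfolding growth_def by auto
  qed
qed

end

theorem theorem4p10:
  fixes n k N :: nat
    and \<phi> :: "nat \<Rightarrow> real mat \<Rightarrow> complex mat"
    and B :: "nat \<Rightarrow> nat \<Rightarrow> complex mat"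
    and \<rho> :: "real mat \<Rightarrow> complex mat"
    and W :: "complex mat"
    and J :: "real set"
    and T :: "nat \<Rightarrow> real \<Rightarrow> complex mat"
    and Y :: "nat \<Rightarrow> complex mat"
  assumes n: "n \<ge> 1" and k: "k \<ge> 1"
    and N: "N = (\<Sum>a\<le>k. n + 2 * a)"
    and irreps: "\<And>m. m \<ge> 1 \<Longrightarrow> irreducible_so3_rep m (\<phi> m) \<and> unitary_so3_rep m (\<phi> m)"
    and B: "\<And>m. m \<ge> 1 \<Longrightarrow> normalized_B_triple \<phi> m (B m)"
    and J: "open J" "connected J"
    and nahm: "nahm_solution N J T"
    and symmetric: "spherically_symmetric N J T"
    and generators: "symmetry_generators N J T Y"
    and induce: "generators_induce_rep N Y \<rho>"
    and W: "W \<in> unitary_group N"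
    and decomposition: "\<And>A. A \<in> so3 \<Longrightarrow> conj_by W (\<rho> A) = ladder_rep \<phi> n k A"
  shows "\<exists>S\<in>SU N. (\<forall>A\<in>so3. S * \<rho> A = \<rho> A * S) \<and>
    (\<exists>f g :: nat \<Rightarrow> real \<Rightarrow> real.
       (\<forall>a\<le>k. real_analytic_on (f a) J) \<and>
       (\<forall>a<k. real_analytic_on (g a) J) \<and>
       (\<forall>t. g k t = 0) \<and>
       (\<forall>i<3. \<forall>t\<in>J. \<forall>a\<le>k. \<forall>b\<le>k.
          ladder_block n k a b (conj_by W (conj_by S (T i t))) =
            (if a = b then complex_of_real (f a t) \<cdot>\<^sub>m \<phi> (n + 2 * a) (so3_basis i)
             else if a = b + 1 then complex_of_real (g b t) \<cdot>\<^sub>m B (n + 2 * b) i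
             else if b = a + 1 then complex_of_real (- g a t) \<cdot>\<^sub>m mat_adjoint (B (n + 2 * a) i)
             else 0\<^sub>m (n + 2 * a) (n + 2 * b))) \<and>
       (n = 1 \<longrightarrow>
          (\<forall>i<3. \<phi> 1 (so3_basis i) = 0\<^sub>m 1 1) \<and>
          (\<forall>t\<in>J. \<forall>a\<in>{1..k}.
             (f a has_real_derivative
                (f a t)\<^sup>2 + 1 / real a * (shifted g a t)\<^sup>2
                - real (2 * a + 3) / real ((2 * a + 1) * (a + 1)) * (g a t)\<^sup>2) (at t)) \<and>
          (\<forall>t\<in>J. \<forall>a<k.
             (g a has_real_derivative
                (real (a + 2) * f (a + 1) t - real a * f a t) * g a t) (at t))) \<and>
       (n \<ge> 2 \<longrightarrow>
          (\<forall>t\<in>J. \<forall>a\<le>k.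
             (f a has_real_derivative
                (f a t)\<^sup>2 + 2 / (real (n + 2 * a) - 1) * (shifted g a t)\<^sup>2
                - 2 * real (n + 2 * a + 2) / (real (n + 2 * a) * real (n + 2 * a + 1)) * (g a t)\<^sup>2) (at t)) \<and>
          (\<forall>t\<in>J. \<forall>a<k.
             (g a has_real_derivative
                (real (n + 2 * a + 3) / 2 * f (a + 1) t
                 - (real (n + 2 * a) - 1) / 2 * f a t) * g a t) (at t))))"
proof -
  interpret nahm_ladder n k N \<phi> B \<rho> W J T Y
    by (rule nahm_ladder.intro) (fact n N irreps B J nahm generators induce W decomposition)+
  show ?thesis by (rule block_form_and_equations)
qed

end
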